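(* Let $n\ge 1$ be an integer. For each $n$-leaved painted binary tree $t$ let $M_0(t)=(x_1,\dots,x_{n-1})\in\mathbb{R}^{n-1}$ be the point with $x_i=0$ if the $i$-th trivalent node of $t$ is of type (1) (unpainted), and $x_i=l_ir_i$ if the $i$-th trivalent node of $t$ is of type (2) (painted), where $l_i$ and $r_i$ are the numbers of leaves of the left and right subtrees at that node. Then the convex hull in $\mathbb{R}^{n-1}$ of the points $M_0(t)$, where $t$ ranges over all $n$-leaved painted binary trees, is the $n$-th composihedron; that is, this convex hull is combinatorially equivalent to the CW-complex $\mathcal{CK}(n)$.
   Context: **Painted trees.** All trees are planar rooted trees with a root edge and leaf edges; the root and leaves are exterior vertices, all other vertices are called nodes. In a painted tree each edge is painted or unpainted; the root edge is painted and all leaf edges are unpainted. Each node must be of one of these types: (1) trivalent (one edge below, two above), all edges unpainted; (2) trivalent, all edges painted; (3) bivalent, lower edge painted and the single upper edge unpainted; (4) one lower and at least two upper edges, all unpainted; (5) one lower and at least two upper edges, all painted; (6) painted lower edge and one or more upper edges, all unpainted. A painted binary tree has only nodes of types (1), (2), (3). The $n$-leaved painted corolla is the painted tree with $n$ leaves and only one node, of type (6). A painted tree $t$ refines $t'$ if $t'$ results from $t$ by collapsing some (possibly none) of the internal edges of $t$. A minimal refinement is a proper refinement with no painted tree strictly in between. **Domain equivalence.** Two painted trees are domain equivalent if both refine a common painted tree, where the collapses involved in both refinements are only of unpainted internal edges whose two end nodes are of type (1) or (4). **Numbering of nodes.** The leaves of an $n$-leaved tree are numbered $0,1,\dots,n-1$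 from left to right. In a painted binary tree the trivalent nodes (types (1) and (2)) are numbered $1,\dots,n-1$, node $i$ being the one at which the paths down to the root from leaf $i-1$ and leaf $i$ first meet. Each trivalent node has a left and a right branch, each supporting a subtree. **Associahedra.** $\mathcal{K}(m)$ is the $(m-2)$-dimensional associahedron for $m\ge2$ ($\mathcal{K}(1)=\mathcal{K}(2)$ is a point); its faces correspond to $m$-leaved planar rooted (unpainted) trees all of whose nodes have at least two upper edges, ordered by refinement. **Composihedra.** The CW-complexes $\mathcal{CK}(n)$ (of dimension $n-1$) are defined recursively. $\mathcal{CK}(1)$ is a point, associated to the one-leaved painted tree (one type (3) node). Suppose $\mathcal{CK}(k)$ is defined for $k<n$, with the $k$-leaved painted corolla associated to $\mathcal{CK}(k)$. Then $\mathcal{CK}(n)$ is the cone on an $(n-2)$-dimensional CW-complex $\partial\mathcal{CK}(n)$, and is associated to the $n$-leaved painted corolla. The top-dimensional cells of $\partial\mathcal{CK}(n)$ (the facets of $\mathcal{CK}(n)$) are in bijection with the following painted trees with $n$ leaves: - upper trees $u(m;r_1,\dots,r_m)$, for $2\le m\le n$, $r_i\ge1$, $r_1+\dots+r_m=n$: the lowest node is painted with $m$ painted upper edges, and the $i$-th of these (from the left) ends in a type (6) node with $r_i$ leaves (type (3) if $r_i=1$). The corresponding upper facet is a copy of $\mathcal{K}(m)\times\mathcal{CK}(r_1)\times\dots\times\mathcal{CK}(r_m)$; - minimal lower trees $l(k,2)$, for $1\le k\le n-1$: the lowest node is of type (6) with $n-1$ upper edges, all of which are leaf edges except the $k$-th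 from the left, which ends in a type (1) node carrying the leaves $k-1$ and $k$. The corresponding lower facet $\mathcal{CK}_k(n-1,2)$ is a copy of $\mathcal{CK}(n-1)\times\mathcal{K}(2)\cong\mathcal{CK}(n-1)$. Each sub-facet (codimension-one face) of one of these facets is a product of faces of smaller associahedra and composihedra, and inductively comes with associated trees for its factors, from which one gets an $n$-leaved painted tree that is a minimal refinement of the tree of the facet: for a sub-facet of an upper facet, paint entirely the $m$-leaved tree associated to the face of $\mathcal{K}(m)$ and graft to its leaves, in order, the painted trees associated to the faces of $\mathcal{CK}(r_1),\dots,\mathcal{CK}(r_m)$; for a sub-facet of $\mathcal{CK}_k(n-1,2)$, with associated $(n-1)$-leaved upper or minimal lower tree $T$, graft an unpainted 2-leaved tree with one node to the $k$-th leaf of $T$. The complex $\partial\mathcal{CK}(n)$ is the union of all these facets, where the intersection of two facets consists of the sub-facets of each whose associated trees are domain equivalent (these being identified). In particular the 0-cells (vertices) of $\mathcal{CK}(n)$ are labelled bijectively by the domain equivalence classes of $n$-leaved painted binary trees. Combinatorially equivalent means having isomorphic face posets. *)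

theory Defs
  imports "HOL-Analysis.Analysis" "HOL-Analysis.Finite_Function_Topology"
begin

section \<open>Painted trees\<close>

text \<open>
  A planar rooted tree is identified with its root edge: it is either a leaf edge, or an edge that
  ends in a node with a list of upper edges, from left to right. The Boolean at a node records
  whether the \<^emph>\<open>lower\<close> edge of that node is painted; leaf edges are never painted.
\<close>

datatype ptree = Leaf | Node bool "ptree list"

fun painted_edge :: "ptree \<Rightarrow> bool" where
  "painted_edge Leaf \<longleftrightarrow> False"
| "painted_edge (Node p ts) \<longleftrightarrow> p"

fun leaves :: "ptree \<Rightarrow> nat" where
  "leaves Leaf = 1"
| "leaves (Node p ts) = sum_list (map leaves ts)"

fun nodes :: "ptree \<Rightarrow> ptree set" where
  "nodes Leaf = {}"
| "nodes (Node p ts) = insert (Node p ts) (\<Union>t\<in>set ts. nodes t)"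

text \<open>A node is represented by the subtree above its lower edge. Types 1, 2 and 3 are the
  special cases of types 4, 5 and 6 that occur in painted binary trees.\<close>

inductive node_type :: "nat \<Rightarrow> ptree \<Rightarrow> bool" where
  "length ts = 2 \<Longrightarrow> \<forall>u\<in>set ts. \<not> painted_edge u \<Longrightarrow> node_type 1 (Node False ts)"
| "length ts = 2 \<Longrightarrow> \<forall>u\<in>set ts. painted_edge u \<Longrightarrow> node_type 2 (Node True ts)"
| "length ts = 1 \<Longrightarrow> \<forall>u\<in>set ts. \<not> painted_edge u \<Longrightarrow> node_type 3 (Node True ts)"
| "length ts \<ge> 2 \<Longrightarrow> \<forall>u\<in>set ts. \<not> painted_edge u \<Longrightarrow> node_type 4 (Node False ts)"
| "length ts \<ge> 2 \<Longrightarrow> \<forall>u\<in>set ts. painted_edge u \<Longrightarrow> node_type 5 (Node True ts)"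
| "length ts \<ge> 1 \<Longrightarrow> \<forall>u\<in>set ts. \<not> painted_edge u \<Longrightarrow> node_type 6 (Node True ts)"

definition painted_tree :: "ptree \<Rightarrow> bool" where
  "painted_tree t \<longleftrightarrow> painted_edge t \<and> (\<forall>v\<in>nodes t. \<exists>k\<in>{1..6}. node_type k v)"

definition painted_binary_tree :: "ptree \<Rightarrow> bool" where
  "painted_binary_tree t \<longleftrightarrow> painted_edge t \<and> (\<forall>v\<in>nodes t. \<exists>k\<in>{1,2,3}. node_type k v)"

text \<open>Collapsing one internal edge whose lower end node \<open>v\<close> and upper end node \<open>w\<close> satisfy
  \<open>E v w\<close>. All remaining edges keep their colour. Intermediate results of a sequence of such
  steps need not be painted trees.\<close>

inductive collapse :: "(ptree \<Rightarrow> ptree \<Rightarrow> bool) \<Rightarrow> ptree \<Rightarrow> ptree \<Rightarrow> bool"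
  for E :: "ptree \<Rightarrow> ptree \<Rightarrow> bool" where
  "E (Node p (us @ Node q vs # ws)) (Node q vs) \<Longrightarrow>
     collapse E (Node p (us @ Node q vs # ws)) (Node p (us @ vs @ ws))"
| "collapse E t t' \<Longrightarrow> collapse E (Node p (us @ t # ws)) (Node p (us @ t' # ws))"

text \<open>A node of type 1 or 4 has an unpainted lower edge, so the edges collapsed here are
  automatically unpainted.\<close>

definition domain_edge :: "ptree \<Rightarrow> ptree \<Rightarrow> bool" where
  "domain_edge v w \<longleftrightarrow> (node_type 1 v \<or> node_type 4 v) \<and> (node_type 1 w \<or> node_type 4 w)"

definition domain_equivalent :: "ptree \<Rightarrow> ptree \<Rightarrow> bool" where
  "domain_equivalent t t' \<longleftrightarrow> painted_tree t \<and> painted_tree t' \<and>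
     (\<exists>s. painted_tree s \<and> (collapse domain_edge)\<^sup>*\<^sup>* t s \<and> (collapse domain_edge)\<^sup>*\<^sup>* t' s)"

text \<open>\<open>graft t ss\<close> attaches the trees \<open>ss\<close> to the leaves of \<open>t\<close> in order; the edge arising from a
  leaf edge of \<open>t\<close> and the root edge of the grafted tree has the colour of the latter.\<close>

fun graft :: "ptree \<Rightarrow> ptree list \<Rightarrow> ptree"
  and graft_list :: "ptree list \<Rightarrow> ptree list \<Rightarrow> ptree list" where
  "graft Leaf ss = hd ss"
| "graft (Node p ts) ss = Node p (graft_list ts ss)"
| "graft_list [] ss = []"
| "graft_list (t # ts) ss = graft t (take (leaves t) ss) # graft_list ts (drop (leaves t) ss)"

text \<open>The leaf edges of \<open>paint t\<close> carry no colour; they become painted when painted trees are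
  grafted to them.\<close>

fun paint :: "ptree \<Rightarrow> ptree" where
  "paint Leaf = Leaf"
| "paint (Node p ts) = Node True (map paint ts)"


section \<open>Faces of the associahedra\<close>

definition assoc_face :: "nat \<Rightarrow> ptree \<Rightarrow> bool" where
  "assoc_face m t \<longleftrightarrow> leaves t = m \<and> \<not> painted_edge t \<and> (\<forall>v\<in>nodes t. node_type 4 v)"

definition assoc_le :: "ptree \<Rightarrow> ptree \<Rightarrow> bool" where
  "assoc_le s t \<longleftrightarrow> (collapse (\<lambda>_ _. True))\<^sup>*\<^sup>* s t"

definition corolla :: "nat \<Rightarrow> ptree" where
  "corolla m = Node False (replicate m Leaf)"

text \<open>A node with \<open>r\<close> upper edges contributes \<open>r - 2\<close> to the dimension of a face.\<close>

fun assoc_dim :: "ptree \<Rightarrow> nat" where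
  "assoc_dim Leaf = 0"
| "assoc_dim (Node p ts) = length ts - 2 + sum_list (map assoc_dim ts)"


section \<open>The face poset of the composihedron\<close>

text \<open>
  The cells of \<open>CK(n)\<close> are described by names, following the recursive construction of the
  complex: \<open>Whole n\<close> is the top cell of \<open>CK(n)\<close> (the cone), \<open>Upper T cs\<close> is the product cell
  \<open>T \<times> c\<^sub>1 \<times> \<dots> \<times> c\<^sub>m\<close> in the facet \<open>K(m) \<times> CK(r\<^sub>1) \<times> \<dots> \<times> CK(r\<^sub>m)\<close>, and \<open>Lower k c\<close> is the cell \<open>c\<close>
  in the \<open>k\<close>-th lower facet, a copy of \<open>CK(n - 1)\<close>. A cell may have several names; which names
  are identified is described by \<open>glued\<close> below.
\<close>

datatype cell = Whole nat | Upper ptree "cell list" | Lower nat cell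

inductive ck_cell :: "nat \<Rightarrow> cell \<Rightarrow> bool" where
  "n \<ge> 1 \<Longrightarrow> ck_cell n (Whole n)"
| "length cs \<ge> 2 \<Longrightarrow> assoc_face (length cs) T \<Longrightarrow> list_all2 ck_cell rs cs \<Longrightarrow>
     ck_cell (sum_list rs) (Upper T cs)"
| "ck_cell m c \<Longrightarrow> 1 \<le> k \<Longrightarrow> k \<le> m \<Longrightarrow> ck_cell (Suc m) (Lower k c)"

text \<open>The facets belonging to the upper trees \<open>u(m; r\<^sub>1, \<dots>, r\<^sub>m)\<close> and the minimal lower trees
  \<open>l(k, 2)\<close>.\<close>

inductive ck_facet :: "nat \<Rightarrow> cell \<Rightarrow> bool" where
  "length rs \<ge> 2 \<Longrightarrow> \<forall>r\<in>set rs. r \<ge> 1 \<Longrightarrow>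
     ck_facet (sum_list rs) (Upper (corolla (length rs)) (map Whole rs))"
| "1 \<le> k \<Longrightarrow> k \<le> m \<Longrightarrow> ck_facet (Suc m) (Lower k (Whole m))"

fun cell_dim :: "cell \<Rightarrow> nat" where
  "cell_dim (Whole n) = n - 1"
| "cell_dim (Upper T cs) = assoc_dim T + sum_list (map cell_dim cs)"
| "cell_dim (Lower k c) = cell_dim c"

text \<open>The face relation in a cone, in a product, and in a copy of a smaller composihedron, before
  any gluing.\<close>

inductive cell_face :: "cell \<Rightarrow> cell \<Rightarrow> bool" where
  "ck_cell n c \<Longrightarrow> cell_face c (Whole n)"
| "assoc_le S T \<Longrightarrow> list_all2 cell_face cs ds \<Longrightarrow> cell_face (Upper S cs) (Upper T ds)"
| "cell_face c d \<Longrightarrow> cell_face (Lower k c) (Lower k d)"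

text \<open>The associated painted trees. The leaf with number \<open>k - 1\<close> is the \<open>k\<close>-th leaf from the
  left.\<close>

fun cell_tree :: "cell \<Rightarrow> ptree" where
  "cell_tree (Whole n) = Node True (replicate n Leaf)"
| "cell_tree (Upper T cs) = graft (paint T) (map cell_tree cs)"
| "cell_tree (Lower k c) =
     graft (cell_tree c) ((replicate (leaves (cell_tree c)) Leaf)[k - 1 := corolla 2])"

definition sub_facet :: "nat \<Rightarrow> cell \<Rightarrow> cell \<Rightarrow> bool" where
  "sub_facet n F f \<longleftrightarrow>
     ck_facet n F \<and> ck_cell n f \<and> cell_face f F \<and> cell_dim f + 1 = cell_dim F"

text \<open>
  \<open>glued n x y\<close>: the names \<open>x\<close> and \<open>y\<close> denote the same cell of \<open>CK(n)\<close>. This is the equivalence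
  relation generated by the identifications already made in the smaller composihedra occurring
  as factors of the facets, and by identifying a sub-facet \<open>f\<close> of one facet with a sub-facet \<open>g\<close>
  of another facet whenever the associated trees of \<open>f\<close> and \<open>g\<close> are domain equivalent. Two such
  sub-facets are identified as closed cells, where a face \<open>x\<close> of \<open>f\<close> corresponds to the face \<open>y\<close>
  of \<open>g\<close> with domain equivalent associated tree.
\<close>

inductive glued :: "nat \<Rightarrow> cell \<Rightarrow> cell \<Rightarrow> bool" where
  refl: "ck_cell n x \<Longrightarrow> glued n x x"
| sym: "glued n x y \<Longrightarrow> glued n y x"
| trans: "glued n x y \<Longrightarrow> glued n y z \<Longrightarrow> glued n x z"
| upper: "length cs \<ge> 2 \<Longrightarrow> assoc_face (length cs) T \<Longrightarrow>
     length rs = length cs \<Longrightarrow> length ds = length cs \<Longrightarrow>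
     (\<And>i. i < length cs \<Longrightarrow> glued (rs ! i) (cs ! i) (ds ! i)) \<Longrightarrow>
     glued (sum_list rs) (Upper T cs) (Upper T ds)"
| lower: "glued m c d \<Longrightarrow> 1 \<le> k \<Longrightarrow> k \<le> m \<Longrightarrow> glued (Suc m) (Lower k c) (Lower k d)"
| sub_facets: "sub_facet n F f \<Longrightarrow> sub_facet n G g \<Longrightarrow> F \<noteq> G \<Longrightarrow>
     domain_equivalent (cell_tree f) (cell_tree g) \<Longrightarrow>
     ck_cell n x \<Longrightarrow> ck_cell n y \<Longrightarrow> cell_face x f \<Longrightarrow> cell_face y g \<Longrightarrow>
     domain_equivalent (cell_tree x) (cell_tree y) \<Longrightarrow> glued n x y"

definition composihedron_cells :: "nat \<Rightarrow> cell set set" where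
  "composihedron_cells n = {c. ck_cell n c} // {(x, y). glued n x y}"

text \<open>A cell lies in a closed cell iff this holds for suitable names of them.\<close>

definition composihedron_le :: "cell set \<Rightarrow> cell set \<Rightarrow> bool" where
  "composihedron_le X Y \<longleftrightarrow> (\<exists>x\<in>X. \<exists>y\<in>Y. cell_face x y)"


section \<open>The convex hull\<close>

text \<open>\<open>meet_node i t\<close> is the trivalent node of the binary tree \<open>t\<close> with number \<open>i\<close>: the node where
  the paths down to the root from the leaves \<open>i - 1\<close> and \<open>i\<close> (counted from 0) first meet. It is
  meaningful for \<open>1 \<le> i < leaves t\<close>.\<close>

fun meet_node :: "nat \<Rightarrow> ptree \<Rightarrow> ptree" where
  "meet_node i (Node p [t]) = meet_node i t"
| "meet_node i (Node p [l, r]) =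
     (if i < leaves l then meet_node i l
      else if i = leaves l then Node p [l, r]
      else meet_node (i - leaves l) r)"
| "meet_node i t = t"

definition M0_coord :: "ptree \<Rightarrow> nat \<Rightarrow> real" where
  "M0_coord t i = (case meet_node i t of
       Node p [l, r] \<Rightarrow> if node_type 2 (Node p [l, r]) then real (leaves l * leaves r) else 0
     | _ \<Rightarrow> 0)"

text \<open>The space of \<open>(n - 1)\<close>-tuples of reals is realised, uniformly in \<open>n\<close> and including \<open>n = 1\<close>,
  as the coordinate subspace of the finitely supported real sequences whose support is
  contained in \<open>{1..<n}\<close>.\<close>

definition M0 :: "ptree \<Rightarrow> nat \<Rightarrow>\<^sub>0 real" where
  "M0 t = (\<Sum>i = 1..<leaves t. Poly_Mapping.single i (M0_coord t i))"

definition M0_hull :: "nat \<Rightarrow> (nat \<Rightarrow>\<^sub>0 real) set" where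
  "M0_hull n = convex hull {M0 t | t. painted_binary_tree t \<and> leaves t = n}"

text \<open>A CW-complex has no empty cell, so the empty face of the polytope is left out.\<close>

definition polytope_faces :: "'a::real_vector set \<Rightarrow> 'a set set" where
  "polytope_faces P = {F. F face_of P \<and> F \<noteq> {}}"

definition poset_isomorphic ::
  "'a set \<Rightarrow> ('a \<Rightarrow> 'a \<Rightarrow> bool) \<Rightarrow> 'b set \<Rightarrow> ('b \<Rightarrow> 'b \<Rightarrow> bool) \<Rightarrow> bool" where
  "poset_isomorphic A le B le' \<longleftrightarrow>
     (\<exists>f. bij_betw f A B \<and> (\<forall>x\<in>A. \<forall>y\<in>A. le x y \<longleftrightarrow> le' (f x) (f y)))"

end

theory Submission
  imports Defs
begin

text \<open>
  The hull is a polymatroid. For a set \<open>B\<close> of gaps \<open>1, \<dots>, n - 1\<close> between consecutive leaves,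
  let \<open>f(B)\<close> be the number of intervals of gaps that meet \<open>B\<close>. Adding the gap \<open>i\<close> to \<open>B\<close> increases
  \<open>f(B)\<close> by \<open>l r\<close>, where \<open>l\<close> and \<open>r\<close> are the numbers of leaves on the two sides of \<open>i\<close> in the piece
  of the leaf set that \<open>i\<close> cuts; hence the greedy vertices of
  \<open>{x \<ge> 0. \<forall>B. (\<Sum>i\<in>B. x\<^sub>i) \<le> f(B)}\<close> are the points \<open>M\<^sub>0(t)\<close>. If \<open>A\<close> and \<open>B\<close> are
  tight at a point, every interval that meets both meets \<open>A \<inter> B\<close>. So there is a least nonempty tight set, and
  cutting at it repeatedly turns the tight sets of a face into the painted part of a tree,
  whereas the coordinates that vanish on the face are the gaps above unpainted edges.

  On the combinatorial side, a cell is determined by the painted intervals (the sets of leaves above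
  painted edges) and the unpainted gaps of its tree, and the face relation is reverse inclusion of these
  data. That cells with equal data are glued follows by moving every name of a cell to a
  normal form with three kinds of sub-facet identifications: upper facets with upper facets, lower
  with upper, and lower with lower.
\<close>

text \<open>The two posets are not compared directly: faces of the polytope and cells of the complex
  are both put in order-reversing bijection with the codes satisfying \<open>adm 0 n\<close>,
  ordered by inclusion. The code can play this role because the polytope sees an unpainted subtree
  only through vanishing coordinates, and domain equivalence forgets exactly its shape. The obstacle
  is \<open>glued\<close>: it is a generated equivalence relation on names, and
  \<open>cell_face\<close> relates names, not classes. That names are not identified needs an
  invariant, for which the code suffices; that they are identified needs explicit chains of
  sub-facets; and a face relation between classes becomes visible only after both names have been
  rewritten. The least tight set exists for a reason peculiar to intervals: the interval of all gaps
  meets every nonempty set, so by uncrossing two nonempty tight sets always share a gap. That the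
  hull fills the polymatroid is shown by moving a point that is not some \<open>M0 t\<close> both
  ways along a line until further constraints become active.\<close>

fun well_typed :: "ptree \<Rightarrow> bool" where
  "well_typed Leaf \<longleftrightarrow> True"
| "well_typed (Node p ts) \<longleftrightarrow>
     (if p then ts \<noteq> [] \<and> ((\<forall>u\<in>set ts. \<not> painted_edge u) \<or>
                          length ts \<ge> 2 \<and> (\<forall>u\<in>set ts. painted_edge u))
      else length ts \<ge> 2 \<and> (\<forall>u\<in>set ts. \<not> painted_edge u)) \<and>
     (\<forall>u\<in>set ts. well_typed u)"

fun unpainted :: "ptree \<Rightarrow> bool" where
  "unpainted Leaf \<longleftrightarrow> True"
| "unpainted (Node p ts) \<longleftrightarrow> \<not> p \<and> length ts \<ge> 2 \<and> (\<forall>u\<in>set ts. unpainted u)"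

lemma node_type_4_iff:
  "node_type 4 (Node p ts) \<longleftrightarrow> \<not> p \<and> length ts \<ge> 2 \<and> (\<forall>u\<in>set ts. \<not> painted_edge u)"
  by (auto simp: node_type.simps)

lemma node_type_1_iff:
  "node_type (Suc 0) (Node p ts) \<longleftrightarrow> \<not> p \<and> length ts = 2 \<and> (\<forall>u\<in>set ts. \<not> painted_edge u)"
  by (auto simp: node_type.simps)

lemma ex_node_type_iff:
  "(\<exists>k\<in>{1..6}. node_type k (Node p ts)) \<longleftrightarrow>
     (if p then ts \<noteq> [] \<and> ((\<forall>u\<in>set ts. \<not> painted_edge u) \<or>
                          length ts \<ge> 2 \<and> (\<forall>u\<in>set ts. painted_edge u))
      else length ts \<ge> 2 \<and> (\<forall>u\<in>set ts. \<not> painted_edge u))" (is "_ \<longleftrightarrow> ?R")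
proof
  assume ?R
  then have "node_type 4 (Node p ts) \<or> node_type 5 (Node p ts) \<or> node_type 6 (Node p ts)"
    by (cases ts) (auto simp: node_type.simps split: if_splits)
  then show "\<exists>k\<in>{1..6}. node_type k (Node p ts)"
    by force
qed (auto simp: node_type.simps)

lemma ball_nodes_iff_well_typed:
  "(\<forall>v\<in>nodes t. \<exists>k\<in>{1..6}. node_type k v) \<longleftrightarrow> well_typed t"
proof (induction t)
  case (Node p ts)
  have "(\<forall>v\<in>nodes (Node p ts). \<exists>k\<in>{1..6}. node_type k v) \<longleftrightarrow>
     (\<exists>k\<in>{1..6}. node_type k (Node p ts)) \<and> (\<forall>u\<in>set ts. \<forall>v\<in>nodes u. \<exists>k\<in>{1..6}. node_type k v)"
    by auto
  then show ?case
    using Node unfolding ex_node_type_iff by auto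
qed auto

lemma painted_tree_iff: "painted_tree t \<longleftrightarrow> painted_edge t \<and> well_typed t"
  by (simp only: painted_tree_def ball_nodes_iff_well_typed)

lemma unpainted_edge: "unpainted t \<Longrightarrow> \<not> painted_edge t"
  by (cases t) auto

lemma unpainted_iff: "(\<forall>v\<in>nodes t. node_type 4 v) \<and> \<not> painted_edge t \<longleftrightarrow> unpainted t"
proof (induction t)
  case (Node p ts)
  have "(\<forall>v\<in>nodes (Node p ts). node_type 4 v) \<longleftrightarrow>
     node_type 4 (Node p ts) \<and> (\<forall>u\<in>set ts. \<forall>v\<in>nodes u. node_type 4 v)"
    by auto
  then show ?case
    using Node unfolding node_type_4_iff by (auto dest: unpainted_edge)
qed auto

lemma assoc_face_iff: "assoc_face m t \<longleftrightarrow> leaves t = m \<and> unpainted t"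
  unfolding assoc_face_def unpainted_iff[symmetric] by auto

lemma unpainted_well_typed: "unpainted t \<Longrightarrow> well_typed t"
  by (induction t) (auto dest: unpainted_edge)

lemma sum_list_map_ge_length:
  "(\<And>x. x \<in> set xs \<Longrightarrow> f x \<ge> 1) \<Longrightarrow> length xs \<le> sum_list (map f xs)" for f :: "'a \<Rightarrow> nat"
  by (induction xs) (auto simp: Suc_le_eq intro: add_le_mono[of 1, simplified])

lemma leaves_pos: "well_typed t \<Longrightarrow> leaves t \<ge> 1"
proof (induction t)
  case (Node p ts)
  have "length ts \<le> sum_list (map leaves ts)"
    using Node by (intro sum_list_map_ge_length) auto
  moreover have "length ts \<ge> 1"
    using Node.prems by (cases ts) (auto split: if_splits)
  ultimately show ?case by simp
qed auto

section \<open>Grafting\<close>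

lemma leaves_paint [simp]: "leaves (paint t) = leaves t"
  by (induction t) (auto simp: o_def intro: arg_cong[of _ _ sum_list])

lemma length_graft_list [simp]: "length (graft_list ts ss) = length ts"
  by (induction ts arbitrary: ss) auto

lemma leaves_graft:
  "length ss = leaves t \<Longrightarrow> leaves (graft t ss) = sum_list (map leaves ss)"
  "length ss = sum_list (map leaves ts) \<Longrightarrow>
     sum_list (map leaves (graft_list ts ss)) = sum_list (map leaves ss)"
proof (induction t ss and ts ss rule: graft_graft_list.induct)
  case (1 ss)
  then show ?case by (cases ss) auto
next
  case (4 t ts ss)
  have "sum_list (map leaves ss) = sum_list (map leaves (take (leaves t) ss @ drop (leaves t) ss))"
    by simp
  also have "\<dots> = sum_list (map leaves (take (leaves t) ss)) + sum_list (map leaves (drop (leaves t) ss))"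
    unfolding map_append sum_list_append ..
  finally show ?case using 4 by simp
qed auto

lemma graft_list_append:
  "length ss = sum_list (map leaves ts) \<Longrightarrow>
   graft_list (ts @ ts') (ss @ ss') = graft_list ts ss @ graft_list ts' ss'"
  by (induction ts arbitrary: ss) auto

lemma graft_list_replicate_Leaf: "length ss = m \<Longrightarrow> graft_list (replicate m Leaf) ss = ss"
  by (induction ss arbitrary: m) auto

lemma graft_Leaves:
  "graft t (replicate (leaves t) Leaf) = t"
  "graft_list ts (replicate (sum_list (map leaves ts)) Leaf) = ts"
proof -
  have "ss = replicate (leaves t) Leaf \<Longrightarrow> graft t ss = t"
    "ss = replicate (sum_list (map leaves ts)) Leaf \<Longrightarrow> graft_list ts ss = ts" for ss
    by (induction t ss and ts ss rule: graft_graft_list.induct) auto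
  then show "graft t (replicate (leaves t) Leaf) = t"
    "graft_list ts (replicate (sum_list (map leaves ts)) Leaf) = ts" by auto
qed

text \<open>The first \<open>m\<close> trees consume as many of the grafted trees as they have
  leaves; this aligns the two levels of cutting in \<open>graft_assoc\<close>.\<close>

lemma graft_list_take_drop:
  assumes "length us = sum_list (map leaves ss)"
  shows "take m (graft_list ss us) = graft_list (take m ss) (take (sum_list (map leaves (take m ss))) us)"
    and "drop m (graft_list ss us) = graft_list (drop m ss) (drop (sum_list (map leaves (take m ss))) us)"
  using assms
  by (induction ss arbitrary: m us)
    (auto simp: take_Cons drop_Cons take_drop min_def add.commute split: nat.splits)

lemma graft_assoc:
  "length ss = leaves t \<Longrightarrow> length us = sum_list (map leaves ss) \<Longrightarrow>
     graft (graft t ss) us = graft t (graft_list ss us)"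
  "length ss = sum_list (map leaves ts) \<Longrightarrow> length us = sum_list (map leaves ss) \<Longrightarrow>
     graft_list (graft_list ts ss) us = graft_list ts (graft_list ss us)"
proof (induction t ss and ts ss arbitrary: us and us rule: graft_graft_list.induct)
  case (1 ss)
  then show ?case by (cases ss) auto
next
  case (4 t ts ss)
  let ?n = "sum_list (map leaves (take (leaves t) ss))"
  have *: "sum_list (map leaves ss) = ?n + sum_list (map leaves (drop (leaves t) ss))"
    by (metis append_take_drop_id map_append sum_list_append)
  have l: "leaves (graft t (take (leaves t) ss)) = ?n"
    using 4(3) by (intro leaves_graft) auto
  show ?case
    using 4 l * graft_list_take_drop[OF 4(4)] by simp
qed auto

lemma painted_edge_graft_unpainted:
  "length us = leaves t \<Longrightarrow> \<forall>u\<in>set us. unpainted u \<Longrightarrow> painted_edge (graft t us) = painted_edge t"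
  by (cases t; cases us) (auto dest: unpainted_edge)

lemma map_painted_edge_graft_list:
  "length us = sum_list (map leaves ts) \<Longrightarrow> \<forall>u\<in>set us. unpainted u \<Longrightarrow>
   map painted_edge (graft_list ts us) = map painted_edge ts"
proof (induction ts arbitrary: us)
  case (Cons t ts)
  have "painted_edge (graft t (take (leaves t) us)) = painted_edge t"
    using Cons.prems by (intro painted_edge_graft_unpainted) (auto dest: in_set_takeD)
  moreover have "map painted_edge (graft_list ts (drop (leaves t) us)) = map painted_edge ts"
    using Cons.prems by (intro Cons.IH) (auto dest: in_set_dropD)
  ultimately show ?case by simp
qed auto

lemma ball_painted_edge_cong:
  assumes "map painted_edge ss = map painted_edge ts"
  shows "(\<forall>u\<in>set ss. painted_edge u) \<longleftrightarrow> (\<forall>u\<in>set ts. painted_edge u)"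
    "(\<forall>u\<in>set ss. \<not> painted_edge u) \<longleftrightarrow> (\<forall>u\<in>set ts. \<not> painted_edge u)"
proof -
  have "painted_edge ` set ss = painted_edge ` set ts"
    using arg_cong[OF assms, of set] by simp
  then show "(\<forall>u\<in>set ss. painted_edge u) \<longleftrightarrow> (\<forall>u\<in>set ts. painted_edge u)"
    "(\<forall>u\<in>set ss. \<not> painted_edge u) \<longleftrightarrow> (\<forall>u\<in>set ts. \<not> painted_edge u)"
    by (metis (full_types) image_iff)+
qed

lemma well_typed_graft_unpainted:
  "length us = leaves t \<Longrightarrow> \<forall>u\<in>set us. unpainted u \<Longrightarrow> well_typed t \<Longrightarrow> well_typed (graft t us)"
  "length us = sum_list (map leaves ts) \<Longrightarrow> \<forall>u\<in>set us. unpainted u \<Longrightarrow>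
     \<forall>t\<in>set ts. well_typed t \<Longrightarrow> \<forall>t\<in>set (graft_list ts us). well_typed t"
proof (induction t us and ts us rule: graft_graft_list.induct)
  case (1 ss)
  then show ?case by (cases ss) (auto intro: unpainted_well_typed)
next
  case (2 p ts ss)
  have m: "map painted_edge (graft_list ts ss) = map painted_edge ts"
    using 2 by (intro map_painted_edge_graft_list) auto
  have l: "graft_list ts ss = [] \<longleftrightarrow> ts = []"
    by (metis length_0_conv length_graft_list)
  show ?case
    using 2 ball_painted_edge_cong[OF m] l by (simp split: if_splits)
next
  case (4 t ts ss)
  then show ?case by (auto dest: in_set_takeD in_set_dropD)
qed auto

lemma painted_tree_graft_unpainted:
  "painted_tree t \<Longrightarrow> length us = leaves t \<Longrightarrow> \<forall>u\<in>set us. unpainted u \<Longrightarrow> painted_tree (graft t us)"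
  by (simp add: painted_tree_iff well_typed_graft_unpainted painted_edge_graft_unpainted)

text \<open>Every leaf edge of \<open>paint t\<close> takes over a painted root edge, so the nodes
  of \<open>t\<close>, which have at least two upper edges, turn into type 5 nodes.\<close>

lemma painted_tree_graft_paint:
  "length ss = leaves t \<Longrightarrow> unpainted t \<Longrightarrow> \<forall>s\<in>set ss. painted_tree s \<Longrightarrow>
     painted_tree (graft (paint t) ss)"
proof (induction t arbitrary: ss)
  case Leaf
  then show ?case by (cases ss) auto
next
  case (Node p ts)
  have *: "\<forall>t\<in>set (graft_list (map paint us) ss). painted_tree t"
    if "set us \<subseteq> set ts" "length ss = sum_list (map leaves us)" "\<forall>s\<in>set ss. painted_tree s" for us ss
    using that
  proof (induction us arbitrary: ss)
    case (Cons u us)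
    have "painted_tree (graft (paint u) (take (leaves u) ss))"
      using Cons.prems Node.prems by (intro Node.IH) (auto dest: in_set_takeD)
    moreover have "\<forall>t\<in>set (graft_list (map paint us) (drop (leaves u) ss)). painted_tree t"
      using Cons.prems by (intro Cons.IH) (auto dest: in_set_dropD)
    ultimately show ?case by simp
  qed auto
  have "length (graft_list (map paint ts) ss) \<ge> 2" using Node.prems by simp
  then have "graft_list (map paint ts) ss \<noteq> []"
    by (metis list.size(3) not_numeral_le_zero)
  moreover have "\<forall>t\<in>set (graft_list (map paint ts) ss). painted_edge t \<and> well_typed t"
    using *[of ts ss] Node.prems by (simp add: painted_tree_iff)
  ultimately show ?case
    using Node.prems by (simp add: painted_tree_iff)
qed

section \<open>Cells and their trees\<close>

abbreviation cell_size :: "cell \<Rightarrow> nat" where "cell_size c \<equiv> leaves (cell_tree c)"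

text \<open>The size of a cell can be read off from its tree (\<open>ck_cell_imp\<close>), which
  allows the index of \<open>ck_cell\<close> to be dropped.\<close>

definition is_cell :: "cell \<Rightarrow> bool" where "is_cell c \<longleftrightarrow> ck_cell (cell_size c) c"

abbreviation are_cells :: "cell list \<Rightarrow> bool" where "are_cells cs \<equiv> \<forall>c\<in>set cs. is_cell c"

abbreviation total_size :: "cell list \<Rightarrow> nat" where "total_size cs \<equiv> sum_list (map cell_size cs)"

lemma replicate_update:
  "k \<ge> 1 \<Longrightarrow> k \<le> n \<Longrightarrow> (replicate n x)[k - 1 := y] = replicate (k - 1) x @ y # replicate (n - k) x"
proof -
  assume "k \<ge> 1" "k \<le> n"
  then have "replicate n x = replicate (k - 1) x @ x # replicate (n - k) x"
    by (metis Suc_pred' add.commute le_add_diff_inverse less_eq_Suc_le One_nat_def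
        replicate_Suc replicate_add replicate_app_Cons_same add_Suc_right append_Cons)
  then show ?thesis
    by (metis length_replicate list_update_length)
qed

text \<open>The list grafted by \<open>Lower k\<close>, with \<open>i = k - 1\<close> leaves before
  the doubled one and \<open>j\<close> after it. In contrast to the list update in
  \<open>cell_tree\<close>, this form splits well under \<open>take\<close> and
  \<open>drop\<close>.\<close>

definition double_leaf :: "nat \<Rightarrow> nat \<Rightarrow> ptree list" where
  "double_leaf i j = replicate i Leaf @ corolla 2 # replicate j Leaf"

lemma corolla_2: "corolla 2 = Node False [Leaf, Leaf]"
  by (simp add: corolla_def numeral_2_eq_2)

lemma unpainted_corolla: "m \<ge> 2 \<Longrightarrow> unpainted (corolla m)"
  by (simp add: corolla_def)

lemma leaves_corolla [simp]: "leaves (corolla m) = m"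
  by (simp add: corolla_def map_replicate_const sum_list_replicate)

lemma sum_list_leaves_replicate [simp]: "sum_list (map leaves (replicate m Leaf)) = m"
  by (simp add: map_replicate_const sum_list_replicate)

lemma length_double_leaf [simp]: "length (double_leaf i j) = i + j + 1"
  by (simp add: double_leaf_def)

lemma sum_list_double_leaf [simp]: "sum_list (map leaves (double_leaf i j)) = i + j + 2"
  by (simp add: double_leaf_def del: map_replicate)

lemma unpainted_double_leaf: "\<forall>u\<in>set (double_leaf i j). unpainted u"
  by (auto simp: double_leaf_def unpainted_corolla)

lemma cell_tree_Lower:
  "k \<ge> 1 \<Longrightarrow> k \<le> cell_size c \<Longrightarrow>
     cell_tree (Lower k c) = graft (cell_tree c) (double_leaf (k - 1) (cell_size c - k))"
  by (simp only: cell_tree.simps replicate_update double_leaf_def)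

declare cell_tree.simps(3) [simp del]

lemma leaves_cell_tree_Lower:
  "k \<le> cell_size c \<Longrightarrow> k \<ge> 1 \<Longrightarrow> cell_size (Lower k c) = Suc (cell_size c)"
  by (simp only: cell_tree_Lower) (simp add: leaves_graft)

lemma ck_cell_imp:
  "ck_cell n c \<Longrightarrow> cell_size c = n \<and> painted_tree (cell_tree c)"
proof (induction rule: ck_cell.induct)
  case (1 n)
  then show ?case by (auto simp: painted_tree_iff simp del: map_replicate)
next
  case (2 cs T rs)
  have rs: "rs = map cell_size cs" and p: "\<forall>c\<in>set cs. painted_tree (cell_tree c)"
    using 2(3) by (auto simp: list_all2_conv_all_nth in_set_conv_nth intro!: nth_equalityI)
  show ?case
    using 2(1,2) rs p
    by (auto simp: leaves_graft assoc_face_iff o_def intro!: painted_tree_graft_paint)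
next
  case (3 m c k)
  have "painted_tree (cell_tree (Lower k c))"
    using 3 by (subst cell_tree_Lower) (auto intro!: painted_tree_graft_unpainted simp: unpainted_double_leaf)
  then show ?case
    using 3 leaves_cell_tree_Lower by blast
qed

lemma ck_cell_iff: "ck_cell n c \<longleftrightarrow> is_cell c \<and> cell_size c = n"
  unfolding is_cell_def using ck_cell_imp by blast

lemma list_all2_ck_cell_iff:
  "list_all2 ck_cell rs cs \<longleftrightarrow> rs = map cell_size cs \<and> (are_cells cs)"
proof (induction rs arbitrary: cs)
  case (Cons r rs)
  then show ?case by (cases cs) (auto simp: ck_cell_iff)
qed auto

lemma is_cell_painted: "is_cell c \<Longrightarrow> painted_tree (cell_tree c)"
  unfolding is_cell_def using ck_cell_imp by blast

lemma cell_size_pos: "is_cell c \<Longrightarrow> cell_size c \<ge> 1"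
  using is_cell_painted by (intro leaves_pos) (auto simp: painted_tree_iff)

lemma cell_size_Whole [simp]: "cell_size (Whole n) = n"
  by (simp del: map_replicate)

lemma cell_size_Upper:
  "leaves T = length cs \<Longrightarrow> cell_size (Upper T cs) = total_size cs"
  by (simp add: leaves_graft o_def)

lemma is_cell_Whole: "is_cell (Whole n) \<longleftrightarrow> n \<ge> 1"
  unfolding is_cell_def cell_size_Whole by (subst ck_cell.simps) auto

lemma is_cell_Upper:
  "is_cell (Upper T cs) \<longleftrightarrow>
     length cs \<ge> 2 \<and> leaves T = length cs \<and> unpainted T \<and> (are_cells cs)" (is "_ \<longleftrightarrow> ?R")
proof -
  have "is_cell (Upper T cs) \<longleftrightarrow> cell_size (Upper T cs) = total_size cs \<and> ?R"
    unfolding is_cell_def[of "Upper T cs"]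
    by (subst ck_cell.simps) (auto simp: assoc_face_iff list_all2_ck_cell_iff)
  then show ?thesis using cell_size_Upper by metis
qed

lemma is_cell_Lower: "is_cell (Lower k c) \<longleftrightarrow> is_cell c \<and> 1 \<le> k \<and> k \<le> cell_size c" (is "_ \<longleftrightarrow> ?R")
proof -
  have "is_cell (Lower k c) \<longleftrightarrow> cell_size (Lower k c) = Suc (cell_size c) \<and> ?R"
    unfolding is_cell_def[of "Lower k c"]
    by (subst ck_cell.simps) (auto simp: ck_cell_iff)
  then show ?thesis using leaves_cell_tree_Lower by metis
qed

lemma cell_size_Lower: "is_cell (Lower k c) \<Longrightarrow> cell_size (Lower k c) = Suc (cell_size c)"
  using leaves_cell_tree_Lower is_cell_Lower by blast

section \<open>Codes of painted trees\<close>

text \<open>Gap \<open>i\<close> lies between the leaves \<open>i - 1\<close> and \<open>i\<close>. The code records a painted edge below the leaves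
  \<open>c, \<dots>, d - 1\<close> as \<open>(c, d)\<close>, and a gap \<open>i\<close> above an unpainted edge as \<open>(i, i)\<close>. The shape of the
  unpainted subtrees is forgotten, which makes the code invariant under domain equivalence.\<close>

fun code :: "nat \<Rightarrow> ptree \<Rightarrow> (nat \<times> nat) set"
  and codes :: "nat \<Rightarrow> ptree list \<Rightarrow> (nat \<times> nat) set" where
  "code a Leaf = {}"
| "code a (Node p ts) =
     (if p then insert (a, a + sum_list (map leaves ts)) (codes a ts)
      else (\<lambda>i. (i, i)) ` {a<..<a + sum_list (map leaves ts)})"
| "codes a [] = {}"
| "codes a (t # ts) = code a t \<union> codes (a + leaves t) ts"

lemma codes_append [simp]:
  "codes a (ss @ ts) = codes a ss \<union> codes (a + sum_list (map leaves ss)) ts"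
  by (induction ss arbitrary: a) (auto simp: add.assoc)

lemma codes_replicate_Leaf [simp]: "codes a (replicate m Leaf) = {}"
  by (induction m arbitrary: a) auto

lemma image_diag_shift:
  "(\<lambda>(c, d). (c + b, d + b)) ` (\<lambda>i. (i, i)) ` {a<..<a + n} = (\<lambda>i. (i, i)) ` {a + b<..<a + b + n}" for a b n :: nat
proof (rule set_eqI, rule iffI)
  fix x assume "x \<in> (\<lambda>i. (i, i)) ` {a + b<..<a + b + n}"
  then obtain i where "x = (i, i)" "a + b < i" "i < a + b + n" by auto
  then have "x = (\<lambda>(c, d). (c + b, d + b)) (i - b, i - b)" "i - b \<in> {a<..<a + n}" by auto
  then show "x \<in> (\<lambda>(c, d). (c + b, d + b)) ` (\<lambda>i. (i, i)) ` {a<..<a + n}" by blast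
qed auto

lemma code_shift:
  "code (a + b) t = (\<lambda>(c, d). (c + b, d + b)) ` code a t"
  "codes (a + b) ts = (\<lambda>(c, d). (c + b, d + b)) ` codes a ts"
proof (induction a t and a ts rule: code_codes.induct)
  case (2 a p ts)
  show ?case
  proof (cases p)
    case True
    then show ?thesis using 2 by (simp add: add_ac)
  next
    case False
    then show ?thesis
      using image_diag_shift[of b a "sum_list (map leaves ts)"] by (simp only: code.simps if_False)
  qed
next
  case (4 a t ts)
  then show ?case by (simp add: add_ac image_Un)
qed auto

text \<open>Excluding the end points from the degenerate pairs makes \<open>located a b\<close> and
  \<open>located b c\<close> disjoint, so that a union of codes of consecutive trees can be taken
  apart again.\<close>

definition located :: "nat \<Rightarrow> nat \<Rightarrow> (nat \<times> nat) set" where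
  "located a b = {(c, d). a \<le> c \<and> c \<le> d \<and> d \<le> b \<and> (c = d \<longrightarrow> a < c \<and> c < b)}"

lemma code_located:
  "well_typed t \<Longrightarrow> code a t \<subseteq> located a (a + leaves t)"
  "\<forall>t\<in>set ts. well_typed t \<Longrightarrow> codes a ts \<subseteq> located a (a + sum_list (map leaves ts))"
proof (induction a t and a ts rule: code_codes.induct)
  case (2 a p ts)
  have "leaves (Node p ts) \<ge> 1" using 2 leaves_pos by blast
  moreover have "codes a ts \<subseteq> located a (a + leaves (Node p ts))" if p
    using 2 that by auto
  moreover have "(a, a + leaves (Node p ts)) \<in> located a (a + leaves (Node p ts))"
    using calculation(1) by (auto simp: located_def simp del: leaves.simps)
  ultimately show ?case
    by (cases p) (auto simp: located_def)
next
  case (4 a t ts)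
  then have "code a t \<subseteq> located a (a + leaves t)"
    "codes (a + leaves t) ts \<subseteq> located (a + leaves t) (a + leaves t + sum_list (map leaves ts))" by auto
  moreover have "located a (a + leaves t) \<subseteq> located a (a + leaves t + sum_list (map leaves ts))"
    "located (a + leaves t) (a + leaves t + sum_list (map leaves ts)) \<subseteq> located a (a + leaves t + sum_list (map leaves ts))"
    by (auto simp: located_def)
  ultimately show ?case by (auto simp: add.assoc)
qed auto

lemma collapse_leaves: "collapse E t t' \<Longrightarrow> leaves t' = leaves t"
  by (induction rule: collapse.induct) auto

text \<open>The lower end of a domain edge is an unpainted node, and above an unpainted edge the
  code only depends on the number of leaves.\<close>

lemma collapse_domain_code: "collapse domain_edge t t' \<Longrightarrow> code a t' = code a t"
proof (induction arbitrary: a rule: collapse.induct)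
  case (1 p us q vs ws)
  then have "\<not> p" by (auto simp: domain_edge_def node_type_1_iff node_type_4_iff)
  then show ?case by simp
next
  case (2 t t' p us ws)
  then show ?case using collapse_leaves[OF 2(1)] by simp
qed

lemma domain_equivalent_code: "domain_equivalent s t \<Longrightarrow> code a s = code a t"
proof -
  have "(collapse domain_edge)\<^sup>*\<^sup>* t t' \<Longrightarrow> code a t' = code a t" for t t'
    by (induction rule: rtranclp_induct) (auto simp: collapse_domain_code)
  then show "domain_equivalent s t \<Longrightarrow> code a s = code a t"
    unfolding domain_equivalent_def by metis
qed

text \<open>The painted intervals contributed by the lower tree \<open>T\<close> of a graft.\<close>

fun spans :: "nat \<Rightarrow> ptree \<Rightarrow> nat list \<Rightarrow> (nat \<times> nat) set"
  and spans_list :: "nat \<Rightarrow> ptree list \<Rightarrow> nat list \<Rightarrow> (nat \<times> nat) set" where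
  "spans a Leaf rs = {}"
| "spans a (Node p ts) rs = insert (a, a + sum_list rs) (spans_list a ts rs)"
| "spans_list a [] rs = {}"
| "spans_list a (t # ts) rs =
     spans a t (take (leaves t) rs) \<union>
     spans_list (a + sum_list (take (leaves t) rs)) ts (drop (leaves t) rs)"

lemma code_graft_paint:
  "length ss = leaves t \<Longrightarrow> code a (graft (paint t) ss) = spans a t (map leaves ss) \<union> codes a ss"
  "length ss = sum_list (map leaves ts) \<Longrightarrow>
     codes a (graft_list (map paint ts) ss) = spans_list a ts (map leaves ss) \<union> codes a ss"
proof (induction a t "map leaves ss" and a ts "map leaves ss" arbitrary: ss and ss rule: spans_spans_list.induct)
  case (1 a)
  then show ?case by (cases ss) auto
next
  case (2 a p ts)
  then show ?case by (simp add: leaves_graft o_def)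
next
  case (4 a t ts)
  have *: "codes a ss = codes a (take (leaves t) ss) \<union> codes (a + sum_list (map leaves (take (leaves t) ss))) (drop (leaves t) ss)"
    by (metis append_take_drop_id codes_append)
  show ?case
    using 4 unfolding * by (auto simp: take_map drop_map leaves_graft)
qed auto

lemma spans_list_append:
  "spans_list a (us @ ws) rs =
     spans_list a us (take (sum_list (map leaves us)) rs) \<union>
     spans_list (a + sum_list (take (sum_list (map leaves us)) rs)) ws (drop (sum_list (map leaves us)) rs)"
proof (induction us arbitrary: a rs)
  case (Cons u us)
  have "sum_list (take (leaves u + m) rs) = sum_list (take (leaves u) rs) + sum_list (take m (drop (leaves u) rs))" for m
    by (simp add: take_add)
  then show ?case
    by (simp add: Cons Un_assoc drop_take add.assoc add.commute[of "sum_list (map leaves us)"])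
qed auto

text \<open>Only the span of the upper node of the collapsed edge can disappear.\<close>

lemma collapse_spans: "collapse E S T \<Longrightarrow> spans a T rs \<subseteq> spans a S rs"
proof (induction arbitrary: a rs rule: collapse.induct)
  case (1 p us q vs ws)
  have "sum_list (take (n + m) rs) = sum_list (take n rs) + sum_list (take m (drop n rs))" for n m
    by (simp add: take_add)
  then show ?case
    by (auto simp: spans_list_append drop_take add.assoc)
next
  case (2 t t' p us ws)
  then show ?case
    using collapse_leaves[OF 2(1)] by (auto simp: spans_list_append)
qed

lemma assoc_le_spans: "assoc_le S T \<Longrightarrow> spans a T rs \<subseteq> spans a S rs"
  unfolding assoc_le_def by (induction rule: rtranclp_induct) (auto dest: collapse_spans)

text \<open>Renumbering of the cut points when the leaf \<open>k - 1\<close> is doubled: the new gap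
  gets the number \<open>k\<close>, the one value that \<open>bump k\<close> omits.\<close>

definition bump :: "nat \<Rightarrow> nat \<Rightarrow> nat" where "bump k i = (if i < k then i else Suc i)"

lemma inj_bump: "inj (bump k)"
  by (auto simp: inj_def bump_def split: if_splits)

lemma bump_neq: "bump k i \<noteq> k"
  by (auto simp: bump_def)

lemma located_mono: "a' \<le> a \<Longrightarrow> b \<le> b' \<Longrightarrow> located a b \<subseteq> located a' b'"
  by (auto simp: located_def)

lemma map_prod_bump_low: "A \<subseteq> located a b \<Longrightarrow> b < k \<Longrightarrow> map_prod (bump k) (bump k) ` A = A"
proof -
  assume "A \<subseteq> located a b" "b < k"
  then have "map_prod (bump k) (bump k) ` A = id ` A"
    by (intro image_cong) (auto simp: located_def bump_def)
  then show ?thesis by simp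
qed

lemma map_prod_bump_high:
  "A \<subseteq> located a b \<Longrightarrow> k \<le> a \<Longrightarrow> map_prod (bump k) (bump k) ` A = (\<lambda>(c, d). (c + 1, d + 1)) ` A"
  by (rule image_cong) (auto simp: located_def bump_def)

lemma diag_bump:
  "a < k \<Longrightarrow> k \<le> b \<Longrightarrow> (\<lambda>i. (i, i)) ` {a<..<Suc b} =
     insert (k, k) (map_prod (bump k) (bump k) ` (\<lambda>i. (i, i)) ` {a<..<b})"
proof (rule set_eqI, rule iffI)
  fix x assume "x \<in> (\<lambda>i. (i, i)) ` {a<..<Suc b}" and k: "a < k" "k \<le> b"
  then obtain i where i: "x = (i, i)" "a < i" "i < Suc b" by auto
  consider "i < k" | "i = k" | "i > k" by linarith
  then show "x \<in> insert (k, k) (map_prod (bump k) (bump k) ` (\<lambda>i. (i, i)) ` {a<..<b})"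
  proof cases
    case 1
    then have "x = map_prod (bump k) (bump k) (i, i)" "i \<in> {a<..<b}" using i k by (auto simp: bump_def)
    then show ?thesis by blast
  next
    case 3
    then have "x = map_prod (bump k) (bump k) (i - 1, i - 1)" "i - 1 \<in> {a<..<b}"
      using i k by (auto simp: bump_def)
    then show ?thesis by blast
  qed (use i in auto)
qed (auto simp: bump_def)

lemma take_double_leaf_1: "n \<le> i \<Longrightarrow> take n (double_leaf i j) = replicate n Leaf"
  by (simp add: double_leaf_def min_def)

lemma drop_double_leaf_1: "n \<le> i \<Longrightarrow> drop n (double_leaf i j) = double_leaf (i - n) j"
  by (simp add: double_leaf_def)

lemma take_double_leaf_2: "i < n \<Longrightarrow> n \<le> i + j + 1 \<Longrightarrow> take n (double_leaf i j) = double_leaf i (n - i - 1)"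
  by (cases "n - i") (auto simp: double_leaf_def min_def)

lemma drop_double_leaf_2: "i < n \<Longrightarrow> drop n (double_leaf i j) = replicate (i + j + 1 - n) Leaf"
  by (cases "n - i") (auto simp: double_leaf_def)

text \<open>If the doubled leaf lies in the first tree of a list, the later trees are shifted by
  one, which is what \<open>bump\<close> does to them; if it lies further right, \<open>bump\<close>
  fixes the code of the first tree.\<close>

lemma code_graft_double_leaf:
  "well_typed t \<Longrightarrow> leaves t = i + j + 1 \<Longrightarrow>
     code a (graft t (double_leaf i j)) =
       insert (a + i + 1, a + i + 1) (map_prod (bump (a + i + 1)) (bump (a + i + 1)) ` code a t)"
  "\<forall>t\<in>set ts. well_typed t \<Longrightarrow> sum_list (map leaves ts) = i + j + 1 \<Longrightarrow>
     codes a (graft_list ts (double_leaf i j)) =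
       insert (a + i + 1, a + i + 1) (map_prod (bump (a + i + 1)) (bump (a + i + 1)) ` codes a ts)"
proof (induction a t and a ts arbitrary: i j and i j rule: code_codes.induct)
  case (1 a)
  then have "{a<..<Suc (Suc a)} = {Suc a}" "i = 0" "j = 0" by auto
  then show ?case by (simp add: double_leaf_def corolla_2)
next
  case (2 a p ts)
  let ?N = "sum_list (map leaves ts)"
  have l: "sum_list (map leaves (graft_list ts (double_leaf i j))) = Suc ?N"
    using 2 by (subst leaves_graft) auto
  show ?case
  proof (cases p)
    case True
    then show ?thesis using 2 l by (auto simp: bump_def)
  next
    case False
    have "a < a + i + 1" "a + i + 1 \<le> a + ?N" using 2 by auto
    from diag_bump[OF this] show ?thesis using False l by simp
  qed
next
  case (4 a t ts)
  let ?n = "leaves t" and ?k = "a + i + 1"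
  have loc: "code a t \<subseteq> located a (a + ?n)"
    "codes (a + ?n) ts \<subseteq> located (a + ?n) (a + ?n + sum_list (map leaves ts))"
    using 4 by (auto intro!: code_located)
  show ?case
  proof (cases "?n \<le> i")
    case True
    have IH: "codes (a + ?n) (graft_list ts (double_leaf (i - ?n) j)) =
      insert (?k, ?k) (map_prod (bump ?k) (bump ?k) ` codes (a + ?n) ts)"
      using 4(2)[of "i - ?n" j] 4(3,4) True by auto
    show ?thesis
      using True IH map_prod_bump_low[OF loc(1), of ?k]
      by (simp add: take_double_leaf_1 drop_double_leaf_1 graft_Leaves image_Un)
  next
    case False
    have n: "?n \<le> i + j + 1" using 4 by simp
    have IH: "code a (graft t (double_leaf i (?n - i - 1))) =
      insert (?k, ?k) (map_prod (bump ?k) (bump ?k) ` code a t)"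
      using 4(1)[of i "?n - i - 1"] 4(3,4) False by auto
    have l: "leaves (graft t (double_leaf i (?n - i - 1))) = Suc ?n"
      using False by (subst leaves_graft) auto
    have r: "graft_list ts (replicate (i + j + 1 - ?n) Leaf) = ts"
    proof -
      have "i + j + 1 - ?n = sum_list (map leaves ts)" using 4(4) by simp
      then show ?thesis by (simp only: graft_Leaves)
    qed
    have "codes (a + Suc ?n) ts = map_prod (bump ?k) (bump ?k) ` codes (a + ?n) ts"
      using map_prod_bump_high[OF loc(2), of ?k] code_shift(2)[of "a + ?n" 1 ts] False by simp
    then show ?thesis
      using False IH l r n
      by (simp add: take_double_leaf_2 drop_double_leaf_2 image_Un)
  qed
qed auto

lemma code_top: "painted_tree t \<Longrightarrow> (a, a + leaves t) \<in> code a t"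
  by (cases t) (auto simp: painted_tree_iff)

lemma codes_mono:
  "list_all2 (\<lambda>s t. leaves s = leaves t \<and> (\<forall>a. code a s \<subseteq> code a t)) ss ts \<Longrightarrow> codes a ss \<subseteq> codes a ts"
  by (induction arbitrary: a rule: list_all2_induct) auto

section \<open>Codes of cells\<close>

abbreviation ccode :: "nat \<Rightarrow> cell \<Rightarrow> (nat \<times> nat) set" where
  "ccode a c \<equiv> code a (cell_tree c)"

abbreviation ccodes :: "nat \<Rightarrow> cell list \<Rightarrow> (nat \<times> nat) set" where
  "ccodes a cs \<equiv> codes a (map cell_tree cs)"

lemma ccode_Whole [simp]: "ccode a (Whole n) = {(a, a + n)}"
  by (simp del: map_replicate)

lemma ccode_Upper:
  "leaves T = length cs \<Longrightarrow> ccode a (Upper T cs) = spans a T (map cell_size cs) \<union> ccodes a cs"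
  by (simp add: code_graft_paint o_def)

lemma ccode_Lower:
  "is_cell (Lower k c) \<Longrightarrow>
     ccode a (Lower k c) = insert (a + k, a + k) (map_prod (bump (a + k)) (bump (a + k)) ` ccode a c)"
  using is_cell_Lower[of k c] is_cell_painted[of c]
  by (simp add: cell_tree_Lower code_graft_double_leaf painted_tree_iff)

text \<open>Tells cells apart: every generating rule preserves the code, the rule
  \<open>sub_facets\<close> because it asks for domain equivalent trees of \<open>x\<close> and
  \<open>y\<close> themselves. The offset \<open>a\<close> is arbitrary since a factor of a product
  may start at any leaf.\<close>

lemma glued_invariant:
  "glued n x y \<Longrightarrow> is_cell x \<and> is_cell y \<and> cell_size x = n \<and> cell_size y = n \<and> (\<forall>a. ccode a x = ccode a y)"
proof (induction rule: glued.induct)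
  case (upper cs T rs ds)
  have l: "leaves T = length cs" "unpainted T" using upper by (auto simp: assoc_face_iff)
  have c: "are_cells cs" "are_cells ds"
    using upper by (auto simp: in_set_conv_nth)
  have rs: "rs = map cell_size cs" "rs = map cell_size ds"
    using upper by (auto intro!: nth_equalityI)
  have "ccodes a cs \<subseteq> ccodes a ds" "ccodes a ds \<subseteq> ccodes a cs" for a
    using upper by (auto intro!: codes_mono simp del: cell_tree.simps simp: list_all2_conv_all_nth)
  then have "ccodes a cs = ccodes a ds" for a by blast
  then show ?case
    using upper(1,4) l c rs by (simp add: is_cell_Upper cell_size_Upper ccode_Upper del: cell_tree.simps)
next
  case (lower m c d k)
  have "is_cell (Lower k c)" "is_cell (Lower k d)" using lower by (auto simp: is_cell_Lower)
  then show ?case using lower by (simp add: ccode_Lower cell_size_Lower)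
next
  case (sub_facets n F f G g x y)
  then show ?case by (auto simp: ck_cell_iff domain_equivalent_code)
qed (auto simp: ck_cell_iff)

text \<open>Faces have larger codes, since passing to a face refines the tree.
  \<open>faces_if_refines\<close> is the converse.\<close>

lemma cell_face_code:
  "cell_face x y \<Longrightarrow> is_cell x \<Longrightarrow> is_cell y \<Longrightarrow>
     cell_size x = cell_size y \<and> (\<forall>a. ccode a y \<subseteq> ccode a x)"
proof (induction rule: cell_face.induct)
  case (1 n c)
  then show ?case
    using code_top[OF is_cell_painted[of c]] by (auto simp: ck_cell_iff simp del: cell_tree.simps)
next
  case (2 S T cs ds)
  have l: "length cs = length ds" using 2(2) list_all2_lengthD by blast
  have *: "list_all2 (\<lambda>c d. cell_size c = cell_size d \<and> (\<forall>a. ccode a d \<subseteq> ccode a c)) cs ds"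
    using 2 by (auto simp: list_all2_conv_all_nth is_cell_Upper simp del: cell_tree.simps)
  then have "map cell_size cs = map cell_size ds"
    by (auto simp: list_all2_conv_all_nth intro!: nth_equalityI)
  moreover have "ccodes a ds \<subseteq> ccodes a cs" for a
    using * by (intro codes_mono) (auto simp: list_all2_conv_all_nth simp del: cell_tree.simps)
  moreover have "spans a T rs \<subseteq> spans a S rs" for a rs
    using 2 assoc_le_spans by blast
  ultimately show ?case
    using 2(3,4) l
    by (simp add: is_cell_Upper ccode_Upper cell_size_Upper del: cell_tree.simps) blast
next
  case (3 c d k)
  then show ?case
    using is_cell_Lower by (simp add: ccode_Lower cell_size_Lower) blast
qed

declare cell_tree.simps(1,2) [simp del]

section \<open>Gluing\<close>

lemma domain_equivalent_refl: "painted_tree t \<Longrightarrow> domain_equivalent t t"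
  unfolding domain_equivalent_def by blast

lemma cell_face_Whole: "is_cell c \<Longrightarrow> cell_face c (Whole (cell_size c))"
  by (intro cell_face.intros) (simp add: ck_cell_iff)

lemma cell_face_Wholes:
  "are_cells cs \<Longrightarrow> list_all2 cell_face cs (map (\<lambda>c. Whole (cell_size c)) cs)"
  by (auto simp: list_all2_conv_all_nth cell_face_Whole)

lemma collapse_list:
  assumes "\<And>t us ws. t \<in> set vs \<Longrightarrow>
     (collapse E)\<^sup>*\<^sup>* (Node p (us @ t # ws)) (Node p (us @ replicate (leaves t) Leaf @ ws))"
  shows "(collapse E)\<^sup>*\<^sup>* (Node p (us @ vs @ ws)) (Node p (us @ replicate (sum_list (map leaves vs)) Leaf @ ws))"
  using assms
proof (induction vs arbitrary: us)
  case (Cons v vs)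
  have "(collapse E)\<^sup>*\<^sup>* (Node p (us @ v # vs @ ws)) (Node p (us @ replicate (leaves v) Leaf @ vs @ ws))"
    using Cons.prems by auto
  also have "(collapse E)\<^sup>*\<^sup>* \<dots> (Node p ((us @ replicate (leaves v) Leaf) @ replicate (sum_list (map leaves vs)) Leaf @ ws))"
    using Cons.IH[of "us @ replicate (leaves v) Leaf"] Cons.prems by auto
  finally show ?case by (simp add: replicate_add)
qed auto

lemma collapse_subtree:
  "unpainted t \<Longrightarrow> (collapse (\<lambda>_ _. True))\<^sup>*\<^sup>* (Node p (us @ t # ws)) (Node p (us @ replicate (leaves t) Leaf @ ws))"
proof (induction t arbitrary: us ws)
  case (Node q vs)
  have "collapse (\<lambda>_ _. True) (Node p (us @ Node q vs # ws)) (Node p (us @ vs @ ws))"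
    by (rule collapse.intros) simp
  also have "(collapse (\<lambda>_ _. True))\<^sup>*\<^sup>* \<dots> (Node p (us @ replicate (sum_list (map leaves vs)) Leaf @ ws))"
    using Node by (intro collapse_list) auto
  finally show ?case by simp
qed auto

lemma collapse_subtrees:
  "\<forall>t\<in>set vs. unpainted t \<Longrightarrow>
     (collapse (\<lambda>_ _. True))\<^sup>*\<^sup>* (Node p (us @ vs @ ws)) (Node p (us @ replicate (sum_list (map leaves vs)) Leaf @ ws))"
  by (intro collapse_list collapse_subtree) auto

lemma assoc_le_corolla: "unpainted T \<Longrightarrow> T \<noteq> Leaf \<Longrightarrow> assoc_le T (corolla (leaves T))"
  using collapse_subtrees[of _ False "[]" "[]"] by (cases T) (auto simp: assoc_le_def corolla_def)

lemma collapse_cong: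
  "(collapse E)\<^sup>*\<^sup>* t t' \<Longrightarrow> (collapse E)\<^sup>*\<^sup>* (Node p (us @ t # ws)) (Node p (us @ t' # ws))"
  by (induction rule: rtranclp_induct) (auto intro: collapse.intros rtranclp.rtrancl_into_rtrancl)

lemma assoc_le_two_nodes:
  assumes "unpainted S" "S \<noteq> Leaf" "\<forall>t\<in>set ws. unpainted t"
  shows "assoc_le (Node p (us @ S # ws)) (Node p (us @ corolla (leaves S) # replicate (sum_list (map leaves ws)) Leaf))"
proof -
  have "(collapse (\<lambda>_ _. True))\<^sup>*\<^sup>* (Node p (us @ S # ws)) (Node p (us @ corolla (leaves S) # ws))"
    using assoc_le_corolla[OF assms(1,2)] by (intro collapse_cong) (simp add: assoc_le_def)
  also have "(collapse (\<lambda>_ _. True))\<^sup>*\<^sup>* \<dots> (Node p (us @ corolla (leaves S) # replicate (sum_list (map leaves ws)) Leaf))"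
    using collapse_subtrees[OF assms(3), of p "us @ [corolla (leaves S)]" "[]"] by simp
  finally show ?thesis by (simp add: assoc_le_def)
qed

lemma sum_list_diff_one:
  "\<forall>x\<in>set xs. f x \<ge> 1 \<Longrightarrow> sum_list (map (\<lambda>x. f x - 1) xs) + length xs = sum_list (map f xs)"
  for f :: "'a \<Rightarrow> nat"
  by (induction xs) auto

abbreviation whole :: "cell \<Rightarrow> cell" where "whole c \<equiv> Whole (cell_size c)"

lemma is_cell_whole: "is_cell c \<Longrightarrow> is_cell (whole c)"
  using cell_size_pos by (simp add: is_cell_Whole)

lemma ck_facet_Upper:
  assumes "are_cells cs" "length cs \<ge> 2" "n = total_size cs"
  shows "ck_facet n (Upper (corolla (length cs)) (map whole cs))"
  using ck_facet.intros(1)[of "map cell_size cs"] assms cell_size_pos by (auto simp: o_def)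

lemma ck_facet_Lower: "1 \<le> k \<Longrightarrow> k \<le> m \<Longrightarrow> n = Suc m \<Longrightarrow> ck_facet n (Lower k (Whole m))"
  by (auto intro: ck_facet.intros)

lemma graft_list_replicate_append:
  "length xs = i \<Longrightarrow> graft_list (replicate i Leaf @ ts) (xs @ ys) = xs @ graft_list ts ys"
  by (simp add: graft_list_append graft_list_replicate_Leaf del: map_replicate)

lemma cell_tree_Upper_append:
  assumes "length bs = i" "length ds = leaves S" "length es = sum_list (map leaves ws)"
  shows "cell_tree (Upper (Node False (replicate i Leaf @ S # ws)) (bs @ ds @ es)) =
    Node True (map cell_tree bs @ graft (paint S) (map cell_tree ds) # graft_list (map paint ws) (map cell_tree es))"
  using assms by (simp add: cell_tree.simps graft_list_replicate_append)

lemma cell_tree_Upper_append':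
  assumes "length bs = i" "length es = sum_list (map leaves ws)"
  shows "cell_tree (Upper (Node False (replicate i Leaf @ ws)) (bs @ es)) =
    Node True (map cell_tree bs @ graft_list (map paint ws) (map cell_tree es))"
  using assms by (simp add: cell_tree.simps graft_list_replicate_append)

text \<open>The factors \<open>ds\<close> above the branch \<open>S\<close> are gathered into a
  single factor, which moves \<open>S\<close> from the associahedron into a composihedron. The
  branches to the left of \<open>S\<close> are already leaves, which is the situation when packing
  from left to right.\<close>

lemma glued_Upper_Upper:
  assumes S: "unpainted S" "S \<noteq> Leaf" and ws: "\<forall>t\<in>set ws. unpainted t" and i: "i + length ws \<ge> 1"
    and l: "length bs = i" "length ds = leaves S" "length es = sum_list (map leaves ws)"
    and c: "are_cells (bs @ ds @ es)"
    and n: "n = total_size (bs @ ds @ es)"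
  shows "glued n (Upper (Node False (replicate i Leaf @ S # ws)) (bs @ ds @ es))
                 (Upper (Node False (replicate (Suc i) Leaf @ ws)) (bs @ Upper S ds # es))"
    (is "glued n ?x ?y")
proof -
  let ?N = "sum_list (map leaves ws)"
  define s where "s = leaves S"
  have s: "s \<ge> 2"
  proof -
    obtain q vs where q: "S = Node q vs" using S by (cases S) auto
    have "length vs \<le> sum_list (map leaves vs)"
      using S q by (intro sum_list_map_ge_length leaves_pos unpainted_well_typed) auto
    then show ?thesis using S q by (simp add: s_def)
  qed
  have lw: "length ws \<le> ?N"
    using ws by (intro sum_list_map_ge_length leaves_pos unpainted_well_typed) auto
  have cr: "corolla (length (bs @ ds @ es)) = Node False (replicate (i + s + ?N) Leaf)"
    "corolla (Suc (i + ?N)) = Node False (replicate (Suc i) Leaf @ replicate ?N Leaf)"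
    using l by (auto simp: corolla_def s_def replicate_add)
  \<comment> \<open>\<open>F\<close> keeps all factors apart, and \<open>f\<close> is its
    codimension-one face in which \<open>s\<close> of them share an edge. \<open>G\<close> counts
    these \<open>s\<close> factors as one, and \<open>g\<close> is obtained by passing to an upper
    facet of that one factor. Both \<open>f\<close> and \<open>g\<close> have the same tree.\<close>
  define F f G g where "F = Upper (corolla (length (bs @ ds @ es))) (map whole (bs @ ds @ es))"
    and "f = Upper (Node False (replicate i Leaf @ corolla s # replicate ?N Leaf))
                 (map whole bs @ map whole ds @ map whole es)"
    and "G = Upper (corolla (Suc (i + ?N))) (map whole (bs @ Upper S ds # es))"
    and "g = Upper (Node False (replicate (Suc i) Leaf @ replicate ?N Leaf))
                 (map whole bs @ Upper (corolla s) (map whole ds) # map whole es)"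
  have U: "is_cell (Upper S ds)" "cell_size (Upper S ds) = total_size ds"
    using c l s S by (auto simp: is_cell_Upper cell_size_Upper s_def)
  have U': "is_cell (Upper (corolla s) (map whole ds))"
     "cell_size (Upper (corolla s) (map whole ds)) = total_size ds"
    using c l s by (auto simp: is_cell_Upper cell_size_Upper s_def unpainted_corolla o_def is_cell_whole 
      )
  have F: "ck_facet n F"
    unfolding F_def using c n l lw i s by (intro ck_facet_Upper) (auto simp: s_def)
  have G: "ck_facet n G"
    using ck_facet_Upper[of "bs @ Upper S ds # es" n] c n l U lw i
    unfolding G_def by (auto)
  have sz: "cell_size x = n \<and> is_cell x" if "x \<in> {?x, ?y, f, g}" for x
    using that c l s S n ws U U' i lw
    by (auto simp: f_def g_def is_cell_Upper cell_size_Upper s_def unpainted_corolla o_def 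
          is_cell_whole corolla_def simp del: map_replicate)
  have fw: "list_all2 cell_face (bs @ ds @ es) (map whole bs @ map whole ds @ map whole es)"
    using cell_face_Wholes[OF c] by simp
  have ds: "list_all2 cell_face ds (map whole ds)" "list_all2 cell_face bs (map whole bs)"
    "list_all2 cell_face es (map whole es)"
    using c by (auto intro!: cell_face_Wholes)
  have dsw: "list_all2 cell_face (map whole ds) (map whole ds)" 
    "list_all2 cell_face (map whole bs) (map whole bs)" "list_all2 cell_face (map whole es) (map whole es)"
    using c by (auto simp: list_all2_conv_all_nth ck_cell_iff intro!: cell_face.intros(1) is_cell_whole)
  have sF: "sum_list (map (\<lambda>c. cell_size c - 1) cs) + length cs = total_size cs"
    if "set cs \<subseteq> set (bs @ ds @ es)" for cs
    using that c cell_size_pos by (intro sum_list_diff_one) blast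
  have sFd: "sum_list (map (\<lambda>c. cell_size c - 1) ds) + length ds = total_size ds"
    by (intro sF) auto
  have sz_ds: "total_size ds \<ge> s"
    using sFd l by (simp add: s_def)
  have U_tree: "cell_tree (Upper (corolla s) (map whole ds)) = graft (paint (corolla s)) (map cell_tree (map whole ds))"
    by (simp add: cell_tree.simps)
  have "sub_facet n F f"
  proof -
    have "cell_face f F"
    proof -
      let ?T = "Node False (replicate i Leaf @ corolla s # replicate ?N Leaf)"
      have "unpainted ?T"
        using unpainted_corolla[OF s] i lw by auto
      from assoc_le_corolla[OF this] have "assoc_le ?T (corolla (length (bs @ ds @ es)))"
        using l by (simp add: s_def add_ac del: map_replicate)
      then show ?thesis
        unfolding f_def F_def using dsw by (auto intro!: cell_face.intros list_all2_appendI)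
    qed
    moreover have "cell_dim f + 1 = cell_dim F"
      using i lw s by (auto simp: f_def F_def corolla_def o_def l s_def map_replicate_const sum_list_replicate)
    ultimately show ?thesis
      unfolding sub_facet_def using F sz[of f] by (simp add: ck_cell_iff)
  qed
  moreover have "sub_facet n G g"
  proof -
    have "cell_face g G"
      unfolding g_def G_def cr(2)
      using dsw U U' cell_face_Whole[OF U'(1)]
      by (auto intro!: cell_face.intros list_all2_appendI simp: assoc_le_def)
    moreover have "cell_dim g + 1 = cell_dim G"
      using i lw s sFd l sz_ds U by (auto simp: g_def G_def corolla_def o_def s_def map_replicate_const sum_list_replicate)
    ultimately show ?thesis
      unfolding sub_facet_def using G sz[of g] by (simp add: ck_cell_iff)
  qed
  moreover have "F \<noteq> G" using l s by (auto simp: F_def G_def s_def)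
  moreover have "cell_tree f = cell_tree g"
  proof -
    have "cell_tree f = Node True (map cell_tree (map whole bs) @
        graft (paint (corolla s)) (map cell_tree (map whole ds)) #
        graft_list (map paint (replicate ?N Leaf)) (map cell_tree (map whole es)))"
      unfolding f_def by (rule cell_tree_Upper_append) (use l in \<open>auto simp: s_def simp del: map_replicate\<close>)
    moreover have "cell_tree g = Node True (map cell_tree (map whole bs @ [Upper (corolla s) (map whole ds)]) @
        graft_list (map paint (replicate ?N Leaf)) (map cell_tree (map whole es)))"
      using cell_tree_Upper_append'[of "map whole bs @ [Upper (corolla s) (map whole ds)]" "Suc i" "map whole es" "replicate ?N Leaf"] l
      unfolding g_def by (simp del: map_replicate replicate_Suc map_map)
    ultimately show ?thesis by (simp add: cell_tree.simps(2) del: map_replicate)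
  qed
  moreover have "cell_tree ?x = cell_tree ?y"
  proof -
    have "cell_tree ?y = Node True (map cell_tree (bs @ [Upper S ds]) @
        graft_list (map paint ws) (map cell_tree es))"
      using cell_tree_Upper_append'[of "bs @ [Upper S ds]" "Suc i" es ws] l by (simp del: replicate_Suc)
    then show ?thesis unfolding cell_tree_Upper_append[OF l] by (simp add: cell_tree.simps(2))
  qed
  moreover have "cell_face ?x f"
    unfolding f_def s_def using fw assoc_le_two_nodes[OF S ws] by (intro cell_face.intros)
  moreover have "cell_face ?y g"
  proof -
    have "assoc_le (Node False (replicate (Suc i) Leaf @ ws)) (Node False (replicate (Suc i) Leaf @ replicate ?N Leaf))"
      using collapse_subtrees[OF ws, of False "replicate (Suc i) Leaf" "[]"] by (simp add: assoc_le_def)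
    moreover have "cell_face (Upper S ds) (Upper (corolla s) (map whole ds))"
      using assoc_le_corolla[OF S] ds unfolding s_def by (intro cell_face.intros)
    ultimately show ?thesis
      unfolding g_def using ds by (intro cell_face.intros list_all2_appendI) auto
  qed
  ultimately show ?thesis
    using sz is_cell_painted
    by (intro glued.sub_facets[of n F f G g]) (auto simp: ck_cell_iff intro: domain_equivalent_refl)
qed

lemma graft_list_insert:
  assumes "length us = leaves t"
  shows "graft_list (as @ t # bs) (replicate (sum_list (map leaves as)) Leaf @ us @ replicate (sum_list (map leaves bs)) Leaf)
    = as @ graft t us # bs"
  using assms by (simp add: graft_list_append graft_Leaves del: map_replicate)

lemma double_leaf_append:
  "double_leaf (m + i) (j + n) = replicate m Leaf @ double_leaf i j @ replicate n Leaf"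
  by (simp add: double_leaf_def replicate_add)

text \<open>By associativity of grafting, doubling a leaf of a product cell doubles a leaf of the
  one factor in which the position falls.\<close>

lemma cell_tree_Lower_Upper:
  assumes "is_cell (Upper T (bs @ d # es))" "is_cell (Lower k d)"
  shows "cell_tree (Lower (total_size bs + k) (Upper T (bs @ d # es))) =
         cell_tree (Upper T (bs @ Lower k d # es))"
proof -
  let ?m = "total_size bs" and ?n = "total_size es"
  let ?ts = "map cell_tree (bs @ d # es)"
  have T: "leaves T = length (bs @ d # es)" using assms(1) by (auto simp: is_cell_Upper)
  then have sz: "cell_size (Upper T (bs @ d # es)) = ?m + cell_size d + ?n"
    by (simp add: cell_size_Upper)
  have k: "1 \<le> k" "k \<le> cell_size d" using assms(2) by (auto simp: is_cell_Lower)
  have dl: "double_leaf (?m + k - 1) (?m + cell_size d + ?n - (?m + k)) =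
      replicate (sum_list (map leaves (map cell_tree bs))) Leaf @ double_leaf (k - 1) (cell_size d - k) @
      replicate (sum_list (map leaves (map cell_tree es))) Leaf"
    using k double_leaf_append[of ?m "k - 1" "cell_size d - k" ?n] by (simp add: o_def)
  have "cell_tree (Lower (?m + k) (Upper T (bs @ d # es))) =
      graft (graft (paint T) ?ts) (double_leaf (?m + k - 1) (?m + cell_size d + ?n - (?m + k)))"
  proof -
    have "cell_tree (Lower (?m + k) (Upper T (bs @ d # es))) = graft (cell_tree (Upper T (bs @ d # es)))
      (double_leaf (?m + k - 1) (cell_size (Upper T (bs @ d # es)) - (?m + k)))"
      by (rule cell_tree_Lower) (use k sz in auto)
    then show ?thesis unfolding sz unfolding cell_tree.simps(2) .
  qed
  also have "\<dots> = graft (paint T) (graft_list ?ts (double_leaf (?m + k - 1) (?m + cell_size d + ?n - (?m + k))))"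
    using T k by (intro graft_assoc) (auto simp: o_def)
  also have "graft_list ?ts (double_leaf (?m + k - 1) (?m + cell_size d + ?n - (?m + k))) =
      map cell_tree bs @ graft (cell_tree d) (double_leaf (k - 1) (cell_size d - k)) # map cell_tree es"
    unfolding dl map_append list.map using k by (intro graft_list_insert) simp
  finally show ?thesis
    using k by (simp add: cell_tree_Lower cell_tree.simps(2))
qed

lemma glued_Lower_Upper:
  assumes U: "is_cell (Upper T (bs @ d # es))" and L: "is_cell (Lower k d)"
  shows "glued (Suc (cell_size (Upper T (bs @ d # es))))
     (Lower (total_size bs + k) (Upper T (bs @ d # es)))
     (Upper T (bs @ Lower k d # es))" (is "glued (Suc ?N) ?x ?y")
proof -
  let ?k = "total_size bs + k"
  have T: "leaves T = length bs + 1 + length es" "unpainted T" "length bs + length es \<ge> 1"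
    and c: "are_cells bs" "is_cell d" "are_cells es"
    using U by (auto simp: is_cell_Upper)
  have T': "T \<noteq> Leaf" using T by auto
  have k: "1 \<le> k" "k \<le> cell_size d" using L by (auto simp: is_cell_Lower)
  have N: "?N = total_size bs + cell_size d + total_size es"
    using T by (simp add: cell_size_Upper)
  define C where "C = corolla (leaves T)"
  have C: "leaves C = length bs + 1 + length es" "unpainted C"
    using T unpainted_corolla[of "leaves T"] by (auto simp: C_def)
  \<comment> \<open>\<open>f\<close> passes to a lower facet in the factor enlarged by one leaf,
    \<open>g\<close> to an upper facet inside the lower facet \<open>G\<close>.\<close>
  define F f G g where "F = Upper C (map whole bs @ Whole (Suc (cell_size d)) # map whole es)"
    and "f = Upper C (map whole bs @ Lower k (whole d) # map whole es)"
    and "G = Lower ?k (Whole ?N)"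
    and "g = Lower ?k (Upper C (map whole bs @ whole d # map whole es))"
  have W: "is_cell (whole c)" if "is_cell c" for c using that by (rule is_cell_whole)
  have L': "is_cell (Lower k (whole d))" using L by (auto simp: is_cell_Lower W)
  have Lw: "cell_size (Lower k (whole d)) = Suc (cell_size d)" using L' by (simp add: cell_size_Lower)
  have Ld: "cell_size (Lower k d) = Suc (cell_size d)" using L by (simp add: cell_size_Lower)
  have Cw: "is_cell (Upper C (map whole bs @ whole d # map whole es))"
     "cell_size (Upper C (map whole bs @ whole d # map whole es)) = ?N"
    using C T c W by (auto simp: is_cell_Upper cell_size_Upper N o_def)
  have x: "is_cell ?x" using U k by (auto simp: is_cell_Lower N)
  have g: "is_cell g" unfolding g_def using Cw k N by (auto simp: is_cell_Lower)
  have y: "is_cell ?y" "cell_size ?y = Suc ?N"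
    using T c L by (auto simp: is_cell_Upper cell_size_Upper N Ld)
  have f: "is_cell f" "cell_size f = Suc ?N"
    using C T c W L' by (auto simp: f_def is_cell_Upper cell_size_Upper N o_def Lw)
  have refl: "cell_face (whole c) (whole c)" if "is_cell c" for c
    using W[OF that] cell_face_Whole[of "whole c"] by simp
  have refls: "list_all2 cell_face (map whole cs) (map whole cs)" if "are_cells cs" for cs
    using that refl by (auto simp: list_all2_conv_all_nth)
  have F: "ck_facet (Suc ?N) F"
    using ck_facet_Upper[of "bs @ Lower k (whole d) # es" "Suc ?N"] T c L' Lw
    by (auto simp: F_def C_def N)
  have G: "ck_facet (Suc ?N) G"
    unfolding G_def using k N by (intro ck_facet_Lower) auto
  have "sub_facet (Suc ?N) F f"
  proof -
    have "cell_face f F"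
      unfolding f_def F_def using refls c cell_face_Whole[OF L'] Lw
      by (auto intro!: cell_face.intros list_all2_appendI simp: assoc_le_def)
    moreover have "cell_dim f + 1 = cell_dim F"
      using k by (auto simp: f_def F_def)
    ultimately show ?thesis
      unfolding sub_facet_def using F f by (simp add: ck_cell_iff)
  qed
  moreover have "sub_facet (Suc ?N) G g"
  proof -
    have "cell_face g G"
      unfolding g_def G_def using cell_face_Whole[OF Cw(1)] Cw(2) by (auto intro: cell_face.intros)
    moreover have "cell_dim g + 1 = cell_dim G"
    proof -
      have "sum_list (map (\<lambda>c. cell_size c - 1) (bs @ d # es)) + length (bs @ d # es) = total_size (bs @ d # es)"
        using c cell_size_pos by (intro sum_list_diff_one) auto
      then show ?thesis
        using T by (auto simp: g_def G_def C_def N o_def corolla_def map_replicate_const sum_list_replicate)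
    qed
    ultimately show ?thesis
      unfolding sub_facet_def using G g Cw by (simp add: ck_cell_iff cell_size_Lower g_def)
  qed
  moreover have "F \<noteq> G" by (simp add: F_def G_def)
  moreover have "cell_tree g = cell_tree f"
    using cell_tree_Lower_Upper[of C "map whole bs" "whole d" "map whole es" k] Cw L'
    by (simp add: f_def g_def o_def)
  moreover have "cell_tree ?x = cell_tree ?y" by (rule cell_tree_Lower_Upper[OF U L])
  moreover have "cell_face ?x g"
    unfolding g_def using cell_face_Wholes[of "bs @ d # es"] c assoc_le_corolla[OF T(2) T']
    by (auto simp: C_def intro!: cell_face.intros)
  moreover have "cell_face ?y f"
    unfolding f_def using cell_face_Wholes[of "bs"] cell_face_Wholes[of es] c assoc_le_corolla[OF T(2) T']
      cell_face_Whole[OF c(2)]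
    by (auto simp: C_def intro!: cell_face.intros list_all2_appendI)
  ultimately show ?thesis
    using x y f g is_cell_painted cell_size_Lower[OF x]
    by (intro glued.sub_facets[of "Suc ?N" G g F f]) (auto simp: ck_cell_iff intro: domain_equivalent_refl)
qed

text \<open>Isolates the one tree of the list that receives \<open>s\<close>, uniformly in
  \<open>s\<close>, so that a collapse inside \<open>s\<close> can be lifted through the
  graft.\<close>

lemma graft_list_focus:
  "length as + 1 + length bs = sum_list (map leaves ts) \<Longrightarrow>
   \<exists>xs u ys as' bs'. u \<in> set ts \<and> length as' + 1 + length bs' = leaves u \<and>
      (\<forall>s. graft_list ts (as @ s # bs) = xs @ graft u (as' @ s # bs') # ys)"
proof (induction ts arbitrary: as)
  case (Cons t ts)
  show ?case
  proof (cases "leaves t \<le> length as")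
    case True
    then have "length (drop (leaves t) as) + 1 + length bs = sum_list (map leaves ts)"
      using Cons.prems by simp
    from Cons.IH[OF this] obtain xs u ys as' bs' where *: "u \<in> set ts" "length as' + 1 + length bs' = leaves u"
      "\<forall>s. graft_list ts (drop (leaves t) as @ s # bs) = xs @ graft u (as' @ s # bs') # ys" by blast
    show ?thesis
      by (rule exI[of _ "graft t (take (leaves t) as) # xs"], rule exI[of _ u], rule exI[of _ ys],
         rule exI[of _ as'], rule exI[of _ bs']) (use True * in auto)
  next
    case False
    define m where "m = leaves t - length as - 1"
    have m: "leaves t = length as + Suc m" using False by (simp add: m_def)
    show ?thesis
      by (rule exI[of _ "[]"], rule exI[of _ t], rule exI[of _ "graft_list ts (drop m bs)"],
         rule exI[of _ as], rule exI[of _ "take m bs"]) (use m Cons.prems in auto)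
  qed
qed auto

lemma collapse_graft:
  "length as + 1 + length bs = leaves t \<Longrightarrow> collapse E s s' \<Longrightarrow>
     collapse E (graft t (as @ s # bs)) (graft t (as @ s' # bs))"
proof (induction t arbitrary: as bs)
  case Leaf
  then show ?case by auto
next
  case (Node p ts)
  have "length as + 1 + length bs = sum_list (map leaves ts)" using Node.prems by simp
  from graft_list_focus[OF this] obtain xs u ys as' bs'
    where *: "u \<in> set ts" "length as' + 1 + length bs' = leaves u"
      "\<forall>s. graft_list ts (as @ s # bs) = xs @ graft u (as' @ s # bs') # ys"
    by blast
  then show ?case using Node by (auto intro: collapse.intros)
qed

lemma corolla_3: "corolla 3 = Node False [Leaf, Leaf, Leaf]"
  by (simp add: corolla_def numeral_3_eq_3)

text \<open>Both ways of doubling one leaf twice collapse to \<open>corolla 3\<close>. Among the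
  three kinds of identification constructed here, this is the only situation where the trees are
  domain equivalent without being equal.\<close>

lemma domain_equivalent_graft:
  assumes "painted_tree t" "leaves t = m + 1 + n"
  shows "domain_equivalent
    (graft t (replicate m Leaf @ Node False [corolla 2, Leaf] # replicate n Leaf))
    (graft t (replicate m Leaf @ Node False [Leaf, corolla 2] # replicate n Leaf))"
proof -
  have c: "collapse domain_edge (Node False [corolla 2, Leaf]) (corolla 3)"
    using collapse.intros(1)[of domain_edge False "[]" False "[Leaf, Leaf]" "[Leaf]"]
    by (auto simp: corolla_2 corolla_3 domain_edge_def node_type_1_iff)
  have d: "collapse domain_edge (Node False [Leaf, corolla 2]) (corolla 3)"
    using collapse.intros(1)[of domain_edge False "[Leaf]" False "[Leaf, Leaf]" "[]"]
    by (auto simp: corolla_2 corolla_3 domain_edge_def node_type_1_iff)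
  have u: "painted_tree (graft t (replicate m Leaf @ s # replicate n Leaf))" if "unpainted s" for s
    using assms that by (intro painted_tree_graft_unpainted) auto
  show ?thesis
    unfolding domain_equivalent_def
    using collapse_graft[OF _ c, of "replicate m Leaf" "replicate n Leaf" t]
      collapse_graft[OF _ d, of "replicate m Leaf" "replicate n Leaf" t] assms
    by (auto intro!: u exI[of _ "graft t (replicate m Leaf @ corolla 3 # replicate n Leaf)"] simp: unpainted_corolla)
qed

text \<open>An exchange rule like the simplicial identities. For \<open>k = j + 1\<close> both sides
  double the same leaf of \<open>e\<close> twice, once to the left and once to the right; otherwise
  they double two different leaves and the trees agree.\<close>

lemma domain_equivalent_Lower_Lower:
  assumes e: "is_cell e" and j: "1 \<le> j" "j < k" "k \<le> Suc (cell_size e)"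
  shows "domain_equivalent (cell_tree (Lower j (Lower (k - 1) e))) (cell_tree (Lower k (Lower j e)))"
proof -
  define i p q where "i = j - 1" and "p = k - j - 1" and "q = Suc (cell_size e) - k"
  have jk: "j = i + 1" "k = i + p + 2" "cell_size e = i + p + q + 1"
    using j by (auto simp: i_def p_def q_def)
  have painted: "painted_tree (cell_tree e)" using e by (rule is_cell_painted)
  have x: "cell_tree (Lower j (Lower (k - 1) e)) =
     graft (cell_tree e) (graft_list (double_leaf (i + p) q) (double_leaf i (p + q + 1)))"
    using jk leaves_cell_tree_Lower[of "k - 1" e] by (simp add: cell_tree_Lower graft_assoc)
  have y: "cell_tree (Lower k (Lower j e)) =
     graft (cell_tree e) (graft_list (double_leaf i (p + q)) (double_leaf (i + p + 1) q))"
    using jk leaves_cell_tree_Lower[of j e] by (simp add: cell_tree_Lower graft_assoc)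
  show ?thesis
  proof (cases p)
    case 0
    have "graft_list (double_leaf (i + p) q) (double_leaf i (p + q + 1)) =
       replicate i Leaf @ Node False [corolla 2, Leaf] # replicate q Leaf"
      using graft_list_insert[of "[corolla 2, Leaf]" "corolla 2" "replicate i Leaf" "replicate q Leaf"] 0
      by (simp add: double_leaf_def corolla_2 del: map_replicate)
    moreover have "graft_list (double_leaf i (p + q)) (double_leaf (i + p + 1) q) =
       replicate i Leaf @ Node False [Leaf, corolla 2] # replicate q Leaf"
      using graft_list_insert[of "[Leaf, corolla 2]" "corolla 2" "replicate i Leaf" "replicate q Leaf"] 0
      by (simp add: double_leaf_def corolla_2 replicate_append_same[symmetric] del: map_replicate)
    ultimately show ?thesis
      using x y painted 0 jk by (simp add: domain_equivalent_graft)
  next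
    case (Suc p')
    let ?r = "replicate i Leaf @ corolla 2 # replicate p' Leaf @ corolla 2 # replicate q Leaf"
    have "graft_list (double_leaf (i + p) q) (double_leaf i (p + q + 1)) = ?r"
    proof -
      let ?bs = "replicate p' Leaf @ corolla 2 # replicate q Leaf"
      have "double_leaf (i + p) q = replicate i Leaf @ Leaf # ?bs"
        using Suc by (simp add: double_leaf_def replicate_add replicate_app_Cons_same replicate_append_same)
      moreover have "p + q + 1 = sum_list (map leaves ?bs)"
        using Suc by (simp del: map_replicate)
      then have "double_leaf i (p + q + 1) = replicate (sum_list (map leaves (replicate i Leaf))) Leaf @
          [corolla 2] @ replicate (sum_list (map leaves ?bs)) Leaf"
        by (simp only: double_leaf_def sum_list_leaves_replicate append.simps)
      ultimately show ?thesis
        using graft_list_insert[of "[corolla 2]" Leaf "replicate i Leaf" ?bs] by simp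
    qed
    moreover have "graft_list (double_leaf i (p + q)) (double_leaf (i + p + 1) q) = ?r"
    proof -
      let ?as = "replicate i Leaf @ corolla 2 # replicate p' Leaf"
      have "double_leaf i (p + q) = ?as @ Leaf # replicate q Leaf"
        using Suc by (simp add: double_leaf_def replicate_add replicate_app_Cons_same replicate_append_same)
      moreover have "i + p + 1 = sum_list (map leaves ?as)"
        using Suc by (simp del: map_replicate)
      then have "double_leaf (i + p + 1) q = replicate (sum_list (map leaves ?as)) Leaf @
          [corolla 2] @ replicate (sum_list (map leaves (replicate q Leaf))) Leaf"
        by (simp only: double_leaf_def sum_list_leaves_replicate append.simps)
      ultimately show ?thesis
        using graft_list_insert[of "[corolla 2]" Leaf ?as "replicate q Leaf"] by simp
    qed
    ultimately have "cell_tree (Lower j (Lower (k - 1) e)) = cell_tree (Lower k (Lower j e))"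
      using x y by simp
    moreover have "is_cell (Lower k (Lower j e))"
      using e j leaves_cell_tree_Lower[of j e] by (auto simp: is_cell_Lower)
    ultimately show ?thesis using domain_equivalent_refl is_cell_painted by metis
  qed
qed

lemma glued_Lower_Lower:
  assumes e: "is_cell e" and j: "1 \<le> j" "j < k" "k \<le> Suc (cell_size e)"
  shows "glued (cell_size e + 2) (Lower j (Lower (k - 1) e)) (Lower k (Lower j e))"
proof -
  let ?n = "cell_size e"
  have c: "is_cell (Lower j (Lower (k - 1) d))" "is_cell (Lower k (Lower j d))"
    "is_cell (Lower (k - 1) d)" "is_cell (Lower j d)"
    "cell_size (Lower j (Lower (k - 1) d)) = ?n + 2" "cell_size (Lower k (Lower j d)) = ?n + 2"
    "cell_size (Lower (k - 1) d) = ?n + 1" "cell_size (Lower j d) = ?n + 1"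
    if "is_cell d" "cell_size d = ?n" for d
  proof -
    show a: "cell_size (Lower (k - 1) d) = ?n + 1" "cell_size (Lower j d) = ?n + 1"
      using j that leaves_cell_tree_Lower[of j d] leaves_cell_tree_Lower[of "k - 1" d] by auto
    show b: "is_cell (Lower j (Lower (k - 1) d))" "is_cell (Lower k (Lower j d))" "is_cell (Lower (k - 1) d)" "is_cell (Lower j d)"
      using a j that by (auto simp: is_cell_Lower)
    show "cell_size (Lower j (Lower (k - 1) d)) = ?n + 2" "cell_size (Lower k (Lower j d)) = ?n + 2"
      using b a cell_size_Lower by auto
  qed
  have W: "is_cell (whole e)" using e by (rule is_cell_whole)
  have n: "?n \<ge> 1" using e by (rule cell_size_pos)
  note ce = c[OF e HOL.refl] and cw = c[OF W, simplified]
  define F f G g where "F = Lower j (Whole (?n + 1))" and "f = Lower j (Lower (k - 1) (whole e))"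
    and "G = Lower k (Whole (?n + 1))" and "g = Lower k (Lower j (whole e))"
  have F: "ck_facet (?n + 2) F" and G: "ck_facet (?n + 2) G"
    unfolding F_def G_def using j by (auto intro: ck_facet_Lower)
  have "sub_facet (?n + 2) F f"
    unfolding sub_facet_def f_def F_def using F n cw
      cell_face_Whole[of "Lower (k - 1) (whole e)"]
    by (auto simp: F_def ck_cell_iff intro!: cell_face.intros(3))
  moreover have "sub_facet (?n + 2) G g"
    unfolding sub_facet_def g_def G_def using G n cw
      cell_face_Whole[of "Lower j (whole e)"]
    by (auto simp: G_def ck_cell_iff intro!: cell_face.intros(3))
  moreover have "F \<noteq> G" using j by (simp add: F_def G_def)
  moreover have "domain_equivalent (cell_tree f) (cell_tree g)"
    unfolding f_def g_def using j W by (intro domain_equivalent_Lower_Lower) auto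
  moreover have "domain_equivalent (cell_tree (Lower j (Lower (k - 1) e))) (cell_tree (Lower k (Lower j e)))"
    using e j by (rule domain_equivalent_Lower_Lower)
  moreover have "cell_face (Lower j (Lower (k - 1) e)) f" "cell_face (Lower k (Lower j e)) g"
    unfolding f_def g_def using cell_face_Whole[OF e] by (auto intro!: cell_face.intros(3))
  ultimately show ?thesis
    using ce by (intro glued.sub_facets[of "?n + 2" F f G g]) (auto simp: ck_cell_iff)
qed

section \<open>Normal forms of cells\<close>

definition same_cell :: "cell \<Rightarrow> cell \<Rightarrow> bool" (infix "\<doteq>" 50) where
  "c \<doteq> d \<longleftrightarrow> glued (cell_size c) c d"

lemma same_cellD:
  assumes "c \<doteq> d"
  shows "is_cell c" "is_cell d" "cell_size c = cell_size d" "ccode a c = ccode a d"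
  using glued_invariant[OF assms[unfolded same_cell_def]] by auto

lemma same_cell_refl: "is_cell c \<Longrightarrow> c \<doteq> c"
  by (auto simp: same_cell_def ck_cell_iff intro: glued.refl)

lemma same_cell_sym: "c \<doteq> d \<Longrightarrow> d \<doteq> c"
  using same_cellD(3) by (auto simp: same_cell_def intro: glued.sym)

lemma same_cell_trans [trans]: "c \<doteq> d \<Longrightarrow> d \<doteq> e \<Longrightarrow> c \<doteq> e"
  using same_cellD(3) by (auto simp: same_cell_def intro: glued.trans)

lemma same_cell_Lower: "c \<doteq> d \<Longrightarrow> 1 \<le> k \<Longrightarrow> k \<le> cell_size c \<Longrightarrow> Lower k c \<doteq> Lower k d"
  using glued.lower[of "cell_size c" c d k] same_cellD(1)[of c d] cell_size_Lower[of k c]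
  by (simp add: same_cell_def is_cell_Lower)

lemma same_cell_Upper:
  assumes "is_cell (Upper T cs)" "list_all2 same_cell cs ds"
  shows "Upper T cs \<doteq> Upper T ds"
proof -
  have *: "length cs \<ge> 2" "leaves T = length cs" "unpainted T" "are_cells cs"
    using assms(1) by (auto simp: is_cell_Upper)
  have "glued (total_size cs) (Upper T cs) (Upper T ds)"
    using * assms(2) by (intro glued.upper) (auto simp: assoc_face_iff list_all2_conv_all_nth same_cell_def)
  then show ?thesis
    using * by (simp add: same_cell_def cell_size_Upper)
qed

lemma same_cell_Upper_single:
  assumes "is_cell (Upper T (bs @ d # es))" "d \<doteq> e"
  shows "Upper T (bs @ d # es) \<doteq> Upper T (bs @ e # es)"
  using assms
  by (intro same_cell_Upper) (auto simp: is_cell_Upper list.rel_refl_strong same_cell_refl intro!: list_all2_appendI)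

lemma same_cell_Lower_Upper:
  assumes "is_cell (Upper T (bs @ d # es))" "is_cell (Lower k d)"
  shows "Lower (total_size bs + k) (Upper T (bs @ d # es)) \<doteq> Upper T (bs @ Lower k d # es)"
  using glued_Lower_Upper[OF assms] glued_invariant unfolding same_cell_def by metis

lemma same_cell_Lower_Lower:
  assumes "is_cell e" "1 \<le> j" "j < k" "k \<le> Suc (cell_size e)"
  shows "Lower j (Lower (k - 1) e) \<doteq> Lower k (Lower j e)"
  using glued_Lower_Lower[OF assms] glued_invariant unfolding same_cell_def by metis

text \<open>Combines the factors above one branch of the root into one cell. A branch
  \<open>Leaf\<close> carries a single cell already, and \<open>Upper Leaf\<close> is never a
  cell.\<close>

definition pack :: "ptree \<Rightarrow> cell list \<Rightarrow> cell" where
  "pack S cs = (if S = Leaf then hd cs else Upper S cs)"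

lemma leaves_ge_2: "unpainted S \<Longrightarrow> S \<noteq> Leaf \<Longrightarrow> leaves S \<ge> 2"
proof (cases S)
  case (Node q vs)
  assume "unpainted S"
  then have "length vs \<le> sum_list (map leaves vs)"
    using Node by (intro sum_list_map_ge_length leaves_pos unpainted_well_typed) auto
  then show ?thesis using \<open>unpainted S\<close> Node by simp
qed auto

lemma pack_cell:
  assumes "unpainted S" "length cs = leaves S" "are_cells cs"
  shows "is_cell (pack S cs)" "cell_size (pack S cs) = total_size cs"
  using assms leaves_ge_2[of S] by (auto simp: pack_def is_cell_Upper cell_size_Upper length_Suc_conv)

text \<open>The branches of the root are packed from left to right by
  \<open>glued_Upper_Upper\<close>; the first \<open>i\<close> of them, with factors
  \<open>bs\<close>, are done.\<close>

lemma same_cell_pack_aux: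
  "\<forall>t\<in>set Ss. unpainted t \<Longrightarrow> length bs = i \<Longrightarrow> list_all2 (\<lambda>S cs. length cs = leaves S) Ss css \<Longrightarrow>
   are_cells bs \<Longrightarrow> \<forall>cs\<in>set css. are_cells cs \<Longrightarrow> i + length Ss \<ge> 2 \<Longrightarrow>
   Upper (Node False (replicate i Leaf @ Ss)) (bs @ concat css) \<doteq>
   Upper (corolla (i + length Ss)) (bs @ map2 pack Ss css)"
proof (induction Ss arbitrary: i bs css)
  case Nil
  then show ?case
    by (auto intro!: same_cell_refl simp: corolla_def is_cell_Upper simp del: map_replicate)
next
  case (Cons S Ss)
  obtain cs css' where css: "css = cs # css'" "length cs = leaves S" "list_all2 (\<lambda>S cs. length cs = leaves S) Ss css'"
    using Cons.prems(3) by (auto simp: list_all2_Cons1)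
  have step: "Upper (Node False (replicate (Suc i) Leaf @ Ss)) ((bs @ [pack S cs]) @ concat css') \<doteq>
     Upper (corolla (Suc i + length Ss)) ((bs @ [pack S cs]) @ map2 pack Ss css')"
    using Cons.prems css pack_cell[of S cs] by (intro Cons.IH) auto
  show ?case
  proof (cases "S = Leaf")
    case True
    then obtain c where c: "cs = [c]" using css by (auto simp: length_Suc_conv)
    have eq: "replicate i Leaf @ S # Ss = replicate (Suc i) Leaf @ Ss"
      using True replicate_app_Cons_same[of i Leaf Ss] by simp
    have "bs @ concat css = (bs @ [pack S cs]) @ concat css'" "i + length (S # Ss) = Suc i + length Ss"
      "bs @ map2 pack (S # Ss) css = (bs @ [pack S cs]) @ map2 pack Ss css'"
      using css c True by (auto simp: pack_def)
    then show ?thesis unfolding eq using step by (simp only:)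
  next
    case False
    have len: "length (concat css') = sum_list (map leaves Ss)"
      using css(3) by (induction rule: list_all2_induct) auto
    have "glued (total_size (bs @ cs @ concat css')) (Upper (Node False (replicate i Leaf @ S # Ss)) (bs @ cs @ concat css'))
        (Upper (Node False (replicate (Suc i) Leaf @ Ss)) (bs @ Upper S cs # concat css'))"
    proof (rule glued_Upper_Upper[OF _ False _ _ _ _ len _ HOL.refl])
      show "are_cells (bs @ cs @ concat css')"
        using Cons.prems(4,5) css(1) by auto
      show "1 \<le> i + length Ss" using Cons.prems(6) by simp
    qed (use Cons.prems(1,2) css(2) in auto)
    then have "Upper (Node False (replicate i Leaf @ S # Ss)) (bs @ cs @ concat css') \<doteq>
        Upper (Node False (replicate (Suc i) Leaf @ Ss)) (bs @ Upper S cs # concat css')"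
      using glued_invariant[of _ "Upper (Node False (replicate i Leaf @ S # Ss)) (bs @ cs @ concat css')"]
      unfolding same_cell_def by metis
    from same_cell_trans[OF this] show ?thesis using step False css by (simp add: pack_def)
  qed
qed

lemma same_cell_pack:
  assumes "\<forall>t\<in>set Ss. unpainted t" "list_all2 (\<lambda>S cs. length cs = leaves S) Ss css"
    "\<forall>cs\<in>set css. are_cells cs" "length Ss \<ge> 2"
  shows "Upper (Node False Ss) (concat css) \<doteq> Upper (corolla (length Ss)) (map2 pack Ss css)"
  using same_cell_pack_aux[of Ss "[]" 0 css] assms by simp

lemma ex_chunks:
  "length cs = sum_list (map leaves Ss) \<Longrightarrow>
   \<exists>css. cs = concat css \<and> list_all2 (\<lambda>S cs. length cs = leaves S) Ss css"
proof (induction Ss arbitrary: cs)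
  case (Cons S Ss)
  then have "length (drop (leaves S) cs) = sum_list (map leaves Ss)" by simp
  then obtain css where css: "drop (leaves S) cs = concat css" "list_all2 (\<lambda>S cs. length cs = leaves S) Ss css"
    using Cons.IH by blast
  have "cs = concat (take (leaves S) cs # css)" using css(1)[symmetric] by simp
  moreover have "list_all2 (\<lambda>S cs. length cs = leaves S) (S # Ss) (take (leaves S) cs # css)"
    using css(2) Cons.prems by simp
  ultimately show ?case by blast
qed auto

section \<open>Flat names and joins\<close>

fun flat :: "cell \<Rightarrow> bool" where
  "flat (Whole n) \<longleftrightarrow> True"
| "flat (Upper T cs) \<longleftrightarrow> False"
| "flat (Lower k c) \<longleftrightarrow> flat c"

abbreviation join :: "cell list \<Rightarrow> cell" where
  "join cs \<equiv> Upper (corolla (length cs)) cs"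

lemma is_cell_join: "is_cell (join cs) \<longleftrightarrow> length cs \<ge> 2 \<and> (are_cells cs)"
  by (auto simp: is_cell_Upper unpainted_corolla)

lemma split_position:
  "1 \<le> k \<Longrightarrow> k \<le> sum_list (map f cs) \<Longrightarrow>
   \<exists>bs d es k'. cs = bs @ d # es \<and> k = sum_list (map f bs) + k' \<and> 1 \<le> k' \<and> k' \<le> f d" for k :: nat
proof (induction cs arbitrary: k)
  case (Cons c cs)
  show ?case
  proof (cases "k \<le> f c")
    case True
    then show ?thesis using Cons.prems by (intro exI[of _ "[]"]) auto
  next
    case False
    then have "1 \<le> k - f c" "k - f c \<le> sum_list (map f cs)" using Cons.prems by auto
    from Cons.IH[OF this] obtain bs d es k' where
      "cs = bs @ d # es" "k - f c = sum_list (map f bs) + k'" "1 \<le> k'" "k' \<le> f d" by blast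
    then show ?thesis using False
      by (intro exI[of _ "c # bs"] exI[of _ d] exI[of _ es] exI[of _ k']) auto
  qed
qed auto

text \<open>Packing all branches turns an \<open>Upper\<close> name into a join, and a
  \<open>Lower\<close> in front of a join moves into the factor whose leaf it doubles.\<close>

lemma normal_form:
  "is_cell x \<Longrightarrow> flat x \<or> (\<exists>cs. x \<doteq> join cs)"
proof (induction x)
  case (Upper T cs)
  obtain Ss where T: "T = Node False Ss" "length Ss \<ge> 2" "\<forall>t\<in>set Ss. unpainted t"
    using Upper.prems by (cases T) (auto simp: is_cell_Upper)
  have "length cs = sum_list (map leaves Ss)" using Upper.prems T by (auto simp: is_cell_Upper)
  from ex_chunks[OF this] obtain css
    where css: "cs = concat css" "list_all2 (\<lambda>S cs. length cs = leaves S) Ss css" by blast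
  have "Upper T cs \<doteq> Upper (corolla (length Ss)) (map2 pack Ss css)"
    unfolding T(1) css(1) using Upper.prems css T by (intro same_cell_pack) (auto simp: is_cell_Upper)
  moreover have "length (map2 pack Ss css) = length Ss"
    using css(2) list_all2_lengthD by fastforce
  ultimately show ?case by metis
next
  case (Lower k c)
  have c: "is_cell c" "1 \<le> k" "k \<le> cell_size c" using Lower.prems by (auto simp: is_cell_Lower)
  show ?case
  proof (cases "flat c")
    case False
    then obtain cs where cs: "c \<doteq> join cs" using Lower.IH c by auto
    have j: "is_cell (join cs)" "cell_size c = total_size cs"
      using same_cellD[OF cs] by (auto simp: cell_size_Upper)
    obtain bs d es k' where s: "cs = bs @ d # es" "k = total_size bs + k'" "1 \<le> k'" "k' \<le> cell_size d"
      using split_position[of k cell_size cs] c j by auto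
    have "Lower k c \<doteq> Lower k (join cs)" using c by (intro same_cell_Lower cs) auto
    also have "\<dots> \<doteq> Upper (corolla (length cs)) (bs @ Lower k' d # es)"
      unfolding s(2) using j(1) s by (subst s(1), intro same_cell_Lower_Upper) (auto simp: is_cell_Upper is_cell_Lower)
    finally show ?thesis using s by (intro disjI2 exI[of _ "bs @ Lower k' d # es"]) simp
  qed auto
qed auto

lemma ccode_join:
  "ccode a (join cs) = insert (a, a + total_size cs) (ccodes a cs)"
  by (simp add: cell_tree.simps corolla_def graft_list_replicate_Leaf o_def del: map_replicate)
     (simp add: graft_list_replicate_Leaf o_def)

lemma cell_size_join: "cell_size (join cs) = total_size cs"
  by (simp add: cell_size_Upper)

section \<open>Reading the factors off from the code of a list\<close>

lemma ccode_located: "is_cell c \<Longrightarrow> ccode a c \<subseteq> located a (a + cell_size c)"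
  using code_located(1) is_cell_painted by (auto simp: painted_tree_iff)

lemma ccodes_located: "are_cells cs \<Longrightarrow> ccodes a cs \<subseteq> located a (a + total_size cs)"
  using code_located(2)[of "map cell_tree cs"] is_cell_painted by (auto simp: painted_tree_iff o_def)

lemma ccode_top: "is_cell c \<Longrightarrow> (a, a + cell_size c) \<in> ccode a c"
  using code_top is_cell_painted by blast

lemma located_disjoint: "p \<in> located a b \<Longrightarrow> p \<in> located b c \<Longrightarrow> False"
  by (auto simp: located_def)

lemma ccode_shift: "ccode (a + b) c = (\<lambda>(c, d). (c + b, d + b)) ` ccode a c"
  by (rule code_shift)

lemma ccode_subset_shift: "ccode a d \<subseteq> ccode a c \<longleftrightarrow> ccode 0 d \<subseteq> ccode 0 c"
  using ccode_shift[of 0 a] by (simp add: inj_image_subset_iff inj_def)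

lemma ccodes_subset_shift: "ccodes a ds \<subseteq> ccode a c \<longleftrightarrow> ccodes 0 ds \<subseteq> ccode 0 c"
  using ccode_shift[of 0 a] code_shift(2)[of 0 a] by (simp add: inj_image_subset_iff inj_def)

text \<open>The top pair of \<open>d\<close> starts at \<open>a\<close> and has positive length; on
  the other side such a pair can only come from \<open>c\<close>, hence ends within
  \<open>c\<close>.\<close>

lemma ccodes_head_size:
  assumes "are_cells (c # cs)" "are_cells (d # ds)" "ccodes a (d # ds) \<subseteq> ccodes a (c # cs)"
  shows "cell_size d \<le> cell_size c"
proof -
  have "(a, a + cell_size d) \<in> ccode a c \<union> ccodes (a + cell_size c) cs"
    using assms ccode_top[of d a] by auto
  moreover have "ccode a c \<subseteq> located a (a + cell_size c)"
    using assms ccode_located by auto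
  moreover have "ccodes (a + cell_size c) cs \<subseteq> located (a + cell_size c) (a + cell_size c + total_size cs)"
    using assms ccodes_located by auto
  moreover have "cell_size c \<ge> 1" using assms cell_size_pos by auto
  ultimately show ?thesis by (auto simp: located_def)
qed

text \<open>The cut \<open>a + cell_size c\<close> separates all pairs into two disjoint regions, so
  the inclusion splits there.\<close>

lemma ccodes_subset_Cons:
  assumes "are_cells (c # cs)" "are_cells ds" "are_cells es"
    and "total_size ds = cell_size c"
    and "ccodes a (ds @ es) \<subseteq> ccodes a (c # cs)"
  shows "ccodes a ds \<subseteq> ccode a c" "ccodes (a + cell_size c) es \<subseteq> ccodes (a + cell_size c) cs"
proof -
  have "ccodes a ds \<subseteq> located a (a + cell_size c)" "ccode a c \<subseteq> located a (a + cell_size c)"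
    "ccodes (a + cell_size c) es \<subseteq> located (a + cell_size c) (a + cell_size c + total_size es)"
    "ccodes (a + cell_size c) cs \<subseteq> located (a + cell_size c) (a + cell_size c + total_size cs)"
    using assms ccode_located ccodes_located[of ds a] ccodes_located by auto
  moreover have "ccodes a ds \<union> ccodes (a + cell_size c) es \<subseteq> ccode a c \<union> ccodes (a + cell_size c) cs"
    using assms(4,5) by (simp add: o_def)
  moreover have "A \<subseteq> C \<and> B \<subseteq> D"
    if "A \<subseteq> located x y" "C \<subseteq> located x y" "B \<subseteq> located y z" "D \<subseteq> located y w" "A \<union> B \<subseteq> C \<union> D" for A B C D x y z w
  proof -
    have "located x y \<inter> located y z = {}" "located x y \<inter> located y w = {}"
      using located_disjoint by auto
    then show ?thesis using that by blast
  qed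
  ultimately show "ccodes a ds \<subseteq> ccode a c" "ccodes (a + cell_size c) es \<subseteq> ccodes (a + cell_size c) cs"
    by metis+
qed

lemma ccodes_subset_imp:
  "map cell_size cs = map cell_size ds \<Longrightarrow> are_cells cs \<Longrightarrow> are_cells ds \<Longrightarrow>
   ccodes a ds \<subseteq> ccodes a cs \<Longrightarrow> list_all2 (\<lambda>c d. ccode 0 d \<subseteq> ccode 0 c) cs ds"
proof (induction cs arbitrary: a ds)
  case (Cons c cs)
  then obtain d ds' where ds: "ds = d # ds'" "cell_size c = cell_size d" "map cell_size cs = map cell_size ds'"
    by (cases ds) auto
  have "ccodes a [d] \<subseteq> ccode a c" "ccodes (a + cell_size c) ds' \<subseteq> ccodes (a + cell_size c) cs"
    using Cons.prems ds by (intro ccodes_subset_Cons[of c cs "[d]" ds' a]; simp)+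
  then show ?case
    using Cons ds ccode_subset_shift[of a d c] by auto
qed auto

lemma ccodes_eq_imp_sizes:
  "are_cells cs \<Longrightarrow> are_cells ds \<Longrightarrow> ccodes a cs = ccodes a ds \<Longrightarrow>
   map cell_size cs = map cell_size ds"
proof (induction cs arbitrary: a ds)
  case Nil
  then show ?case using ccode_top by (cases ds) auto
next
  case (Cons c cs)
  then obtain d ds' where ds: "ds = d # ds'" using ccode_top[of c a] by (cases ds) auto
  have sz: "cell_size c = cell_size d"
    using Cons.prems ccodes_head_size[of c cs d ds' a] ccodes_head_size[of d ds' c cs a] unfolding ds by auto
  have "ccodes (a + cell_size c) ds' \<subseteq> ccodes (a + cell_size c) cs"
    using Cons.prems ds sz by (intro ccodes_subset_Cons[of c cs "[d]" ds' a]) auto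
  moreover have "ccodes (a + cell_size c) cs \<subseteq> ccodes (a + cell_size c) ds'"
    using Cons.prems ds sz by (simp, intro ccodes_subset_Cons[of d ds' "[c]" cs a]) auto
  ultimately have "map cell_size cs = map cell_size ds'"
    using Cons ds by (intro Cons.IH) auto
  then show ?case using ds sz by simp
qed

lemma in_codesE:
  "p \<in> ccodes a cs \<Longrightarrow> \<exists>bs d es. cs = bs @ d # es \<and> p \<in> ccode (a + total_size bs) d"
proof (induction cs arbitrary: a)
  case (Cons c cs)
  show ?case
  proof (cases "p \<in> ccode a c")
    case True
    then show ?thesis by (intro exI[of _ "[]"]) auto
  next
    case False
    then have "p \<in> ccodes (a + cell_size c) cs" using Cons.prems by auto
    from Cons.IH[OF this] obtain bs d es where
      "cs = bs @ d # es" "p \<in> ccode (a + cell_size c + total_size bs) d" by blast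
    then show ?thesis
      by (intro exI[of _ "c # bs"] exI[of _ d] exI[of _ es]) (auto simp: add.assoc)
  qed
qed auto

lemma cell_size_split_less:
  assumes "is_cell (join cs)" "c \<in> set cs"
  shows "cell_size c < cell_size (join cs)"
proof -
  obtain bs es where cs: "cs = bs @ c # es" using split_list[OF assms(2)] by blast
  have "length (bs @ es) \<le> total_size (bs @ es)" "length (bs @ es) \<ge> 1"
  proof -
    have a: "are_cells cs" "length cs \<ge> 2" using assms(1) is_cell_join by blast+
    have "is_cell x" if "x \<in> set (bs @ es)" for x using a(1) that unfolding cs by auto
    then show "length (bs @ es) \<le> total_size (bs @ es)"
      using cell_size_pos by (intro sum_list_map_ge_length) blast
    show "length (bs @ es) \<ge> 1" using a(2) unfolding cs by simp
  qed
  moreover have "cell_size (join cs) = total_size (bs @ es) + cell_size c"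
    unfolding cell_size_join cs by simp
  ultimately show ?thesis by linarith
qed

text \<open>A factor of a join has fewer leaves than the join, so the top pair belongs to the lowest
  node alone and can be cancelled in comparisons of codes.\<close>

lemma top_notin_ccodes:
  assumes "is_cell (join cs)"
  shows "(0, cell_size (join cs)) \<notin> ccodes 0 cs"
proof
  assume "(0, cell_size (join cs)) \<in> ccodes 0 cs"
  from in_codesE[OF this] obtain bs d es where *: "cs = bs @ d # es"
    "(0, cell_size (join cs)) \<in> ccode (0 + total_size bs) d" by blast
  have "is_cell d" using assms * by (auto simp: is_cell_Upper)
  then have "(0, cell_size (join cs)) \<in> located (total_size bs) (total_size bs + cell_size d)"
    using *(2) ccode_located[of d "total_size bs"] by auto
  then have "cell_size (join cs) \<le> total_size bs + cell_size d" "total_size bs = 0"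
    by (auto simp: located_def simp del: sum_list_eq_0_iff)
  moreover have "cell_size d < cell_size (join cs)"
    using assms * by (intro cell_size_split_less) auto
  ultimately show False by simp
qed

lemma flat_code: "flat x \<Longrightarrow> is_cell x \<Longrightarrow> p \<in> ccode 0 x \<Longrightarrow> fst p = snd p \<or> p = (0, cell_size x)"
proof (induction x arbitrary: p)
  case (Whole n)
  then show ?case by simp
next
  case (Lower k c)
  have c: "is_cell c" "1 \<le> k" "k \<le> cell_size c" using Lower.prems by (auto simp: is_cell_Lower)
  consider "p = (k, k)" | q where "q \<in> ccode 0 c" "p = map_prod (bump k) (bump k) q"
    using Lower.prems by (auto simp: ccode_Lower)
  then show ?case
  proof cases
    case 2
    then show ?thesis
      using Lower.IH[OF _ _ 2(1)] Lower.prems c by (auto simp: cell_size_Lower bump_def)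
  qed auto
qed auto

text \<open>The first factor contributes a pair \<open>(0, r)\<close> with \<open>r\<close> positive
  and below the full size, whereas the only proper interval of a flat cell is the top one.\<close>

lemma join_not_flat_code:
  assumes "is_cell (join cs)" "flat y" "is_cell y" "cell_size y = cell_size (join cs)"
  shows "\<not> ccodes 0 cs \<subseteq> ccode 0 y"
proof -
  obtain c cs' where cs: "cs = c # cs'" using assms(1) by (cases cs) (auto simp: is_cell_Upper)
  have "is_cell c" using assms(1) unfolding is_cell_join by (simp add: cs)
  moreover have "cell_size c < cell_size (join cs)" using assms cs by (intro cell_size_split_less) auto
  ultimately show ?thesis
    using ccode_top[of c 0] cell_size_pos[of c] cs assms flat_code[of y "(0, cell_size c)"] by auto
qed

text \<open>Any unpainted gap of the code may serve as the outermost \<open>Lower\<close>: the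
  exchange rule carries it past other \<open>Lower\<close>s, and inside a join it is first brought
  to the front of its factor and then pulled out.\<close>

lemma zero_in_front:
  "is_cell x \<Longrightarrow> (k, k) \<in> ccode 0 x \<Longrightarrow> \<exists>c. x \<doteq> Lower k c"
proof (induction "cell_size x" arbitrary: x k rule: less_induct)
  case less
  consider "flat x" | cs where "x \<doteq> join cs" using normal_form[OF less.prems(1)] by blast
  then show ?case
  proof cases
    case 1
    show ?thesis
    proof (cases x)
      case (Whole n)
      then show ?thesis using less cell_size_pos by fastforce
    next
      case (Lower j d)
      have d: "is_cell d" "1 \<le> j" "j \<le> cell_size d" using less.prems Lower by (auto simp: is_cell_Lower)
      show ?thesis
      proof (cases "k = j")
        case True
        then show ?thesis using Lower less same_cell_refl by blast
      next
        case False
        then obtain c where c: "(c, c) \<in> ccode 0 d" "k = bump j c"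
          using less.prems Lower by (auto simp: ccode_Lower dest: injD[OF inj_bump])
        obtain e where e: "d \<doteq> Lower c e"
          using less.hyps[of d c] c d less.prems Lower by (auto simp: cell_size_Lower)
        have e': "is_cell e" "1 \<le> c" "c \<le> cell_size e" "cell_size d = Suc (cell_size e)"
          using same_cellD[OF e] cell_size_Lower[of c e] by (auto simp: is_cell_Lower)
        have x: "x \<doteq> Lower j (Lower c e)" using Lower d e by (auto intro: same_cell_Lower)
        show ?thesis
        \<comment> \<open>The gap \<open>k\<close> of \<open>x\<close> has the number
          \<open>c\<close> in \<open>d\<close>: either \<open>c = k\<close> lies below
          \<open>j\<close>, or \<open>bump\<close> raised it to \<open>k = Suc c\<close>. The two
          cases use the exchange rule in opposite directions.\<close>
        proof (cases "c < j")
          case True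
          then have "Lower c (Lower (j - 1) e) \<doteq> Lower j (Lower c e)"
            using e' d by (intro same_cell_Lower_Lower) auto
          moreover have "k = c" using c True by (simp add: bump_def)
          ultimately show ?thesis using same_cell_trans[OF x] same_cell_sym by blast
        next
          case False
          then have "Lower j (Lower (Suc c - 1) e) \<doteq> Lower (Suc c) (Lower j e)"
            using e' d by (intro same_cell_Lower_Lower) auto
          moreover have "k = Suc c" using c False by (simp add: bump_def)
          ultimately show ?thesis using same_cell_trans[OF x] by auto
        qed
      qed
    qed (use 1 in auto)
  next
    case 2
    have j: "is_cell (join cs)" "cell_size x = cell_size (join cs)" "ccode 0 x = ccode 0 (join cs)"
      using same_cellD[OF 2] by auto
    have "(k, k) \<in> ccodes 0 cs"
      using less.prems j cell_size_pos[OF less.prems(1)] by (auto simp: ccode_join cell_size_join)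
    from in_codesE[OF this] obtain bs d es where
      *: "cs = bs @ d # es" "(k, k) \<in> ccode (0 + total_size bs) d" by blast
    let ?m = "total_size bs"
    obtain k' where k': "(k', k') \<in> ccode 0 d" "k = ?m + k'"
      using *(2) unfolding ccode_shift by auto
    have "is_cell d" "cell_size d < cell_size x"
    proof -
      have "are_cells cs" using j(1) is_cell_join by blast
      then show "is_cell d" using *(1) by simp
      show "cell_size d < cell_size x" using j(2) cell_size_split_less[OF j(1), of d] *(1) by simp
    qed
    then obtain e where e: "d \<doteq> Lower k' e"
      using less.hyps k' by blast
    define T where "T = corolla (length cs)"
    have J: "is_cell (Upper T (bs @ d # es))" "x \<doteq> Upper T (bs @ d # es)"
      using j(1) 2 unfolding T_def *(1)[symmetric] by auto
    have L: "is_cell (Lower k' e)" "is_cell e"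
      using same_cellD(2)[OF e] is_cell_Lower by auto
    have E: "is_cell (Upper T (bs @ e # es))"
      using J(1) L by (simp add: is_cell_Upper)
    have "x \<doteq> Upper T (bs @ Lower k' e # es)"
      using same_cell_trans[OF J(2) same_cell_Upper_single[OF J(1) e]] .
    also have "\<dots> \<doteq> Lower k (Upper T (bs @ e # es))"
      unfolding k'(2) by (rule same_cell_sym[OF same_cell_Lower_Upper[OF E L(1)]])
    finally show ?thesis by blast
  qed
qed

text \<open>\<open>Lower k\<close> can be cancelled, because \<open>bump k\<close> is injective and
  omits \<open>k\<close>, so that the inserted pair \<open>(k, k)\<close> is never confused with an
  old one.\<close>

lemma Lower_code_subset:
  assumes "is_cell (Lower k c)" "is_cell (Lower k d)" "ccode 0 (Lower k d) \<subseteq> ccode 0 (Lower k c)"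
  shows "ccode 0 d \<subseteq> ccode 0 c"
proof
  fix p assume "p \<in> ccode 0 d"
  obtain x y where p: "p = (x, y)" by (cases p)
  have "(bump k x, bump k y) \<in> ccode 0 (Lower k c)"
    using assms(2,3) \<open>p \<in> ccode 0 d\<close> p by (force simp: ccode_Lower)
  then obtain q where q: "q \<in> ccode 0 c" "(bump k x, bump k y) = map_prod (bump k) (bump k) q"
    using assms(1) bump_neq[of k x] by (auto simp: ccode_Lower)
  then have "p = q"
    using p by (cases q) (auto dest: injD[OF inj_bump])
  then show "p \<in> ccode 0 c" using q by simp
qed

text \<open>Both names are brought to normal form. If both are flat, the outermost
  \<open>Lower\<close> of one is brought to the front of the other and cancelled; two joins have the
  same factor sizes and factor codes; a flat name and a join have different codes.\<close>

lemma same_cell_if_code_eq_aux: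
  "is_cell x \<Longrightarrow> is_cell y \<Longrightarrow> cell_size x = n \<Longrightarrow> cell_size y = n \<Longrightarrow> ccode 0 x = ccode 0 y \<Longrightarrow> x \<doteq> y"
proof (induction n arbitrary: x y rule: less_induct)
  case (less n)
  from normal_form[OF less.prems(1)] normal_form[OF less.prems(2)]
  consider "flat x" "flat y" | cs where "x \<doteq> join cs" "flat y" | ds where "flat x" "y \<doteq> join ds"
    | cs ds where "x \<doteq> join cs" "y \<doteq> join ds" by blast
  then show ?case
  proof cases
    case 1
    show ?thesis
    proof (cases x)
      case (Lower k c)
      have "(k, k) \<in> ccode 0 x" using less.prems(1) Lower by (simp add: ccode_Lower)
      then obtain d where d: "y \<doteq> Lower k d" using zero_in_front[OF less.prems(2), of k] less.prems(5) by blast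
      have *: "is_cell (Lower k c)" "is_cell (Lower k d)" "ccode 0 (Lower k d) = ccode 0 (Lower k c)"
        "cell_size (Lower k d) = cell_size (Lower k c)"
        using less.prems(1,3,4,5) same_cellD(2,3)[OF d] same_cellD(4)[OF d, of 0] unfolding Lower by presburger+
      have "c \<doteq> d"
        using * Lower_code_subset[of k c d] Lower_code_subset[of k d c] Lower
        less.prems(3) by (intro less.IH[of "cell_size c"]) (auto simp: cell_size_Lower is_cell_Lower)
      then have "Lower k c \<doteq> Lower k d" using *(1) by (intro same_cell_Lower) (auto simp: is_cell_Lower)
      then show ?thesis using same_cell_trans[OF _ same_cell_sym[OF d]] Lower by blast
    next
      case (Whole n)
      show ?thesis
      proof (cases y)
        case (Lower k d)
        then have "(k, k) \<in> ccode 0 x" using less.prems by (simp add: ccode_Lower)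
        then show ?thesis using Whole less.prems(1) by (auto simp: is_cell_Whole)
      next
        case (Whole m)
        then have "x = y" using \<open>x = Whole n\<close> less.prems(3,4) by simp
        then show ?thesis using same_cell_refl[OF less.prems(1)] by simp
      qed (use 1 in auto)
    qed (use 1 in auto)
  next
    case 2
    then have "\<not> ccodes 0 cs \<subseteq> ccode 0 y"
      using same_cellD[OF 2(1)] less.prems by (intro join_not_flat_code) auto
    then show ?thesis
      using same_cellD(4)[OF 2(1), of 0] less.prems(5) by (auto simp: ccode_join)
  next
    case 3
    then have "\<not> ccodes 0 ds \<subseteq> ccode 0 x"
      using same_cellD[OF 3(2)] less.prems by (intro join_not_flat_code) auto
    then show ?thesis
      using same_cellD(4)[OF 3(2), of 0] less.prems(5) by (auto simp: ccode_join)
  next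
    case 4
    have c: "is_cell (join cs)" "is_cell (join ds)" "cell_size (join cs) = cell_size (join ds)"
       "ccode 0 (join cs) = ccode 0 (join ds)" "cell_size x = cell_size (join cs)"
      using same_cellD(2,3)[OF 4(1)] same_cellD(4)[OF 4(1), of 0] same_cellD(2,3)[OF 4(2)] same_cellD(4)[OF 4(2), of 0] less.prems(3,4,5)
      by presburger+
    have eq: "ccodes 0 cs = ccodes 0 ds"
      using c top_notin_ccodes[of cs] top_notin_ccodes[of ds] by (simp add: ccode_join cell_size_join insert_ident)
    have cells: "are_cells cs" "are_cells ds" using c by (auto simp: is_cell_join)
    have sz: "map cell_size cs = map cell_size ds" using ccodes_eq_imp_sizes[OF cells eq] .
    have "list_all2 same_cell cs ds"
    proof (rule list_all2_all_nthI)
      show len: "length cs = length ds" using arg_cong[OF sz, of length] by simp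
      fix i assume i: "i < length cs"
      have "ccode 0 (cs ! i) = ccode 0 (ds ! i)"
        using ccodes_subset_imp[OF sz cells, of 0] ccodes_subset_imp[OF sz[symmetric] cells(2,1), of 0] eq i len
        by (simp add: list_all2_conv_all_nth subset_antisym)
      moreover have "cell_size (cs ! i) = cell_size (ds ! i)"
        using sz i len by (metis nth_map)
      ultimately show "cs ! i \<doteq> ds ! i"
      proof (intro less.IH[of "cell_size (cs ! i)"])
        show "cell_size (cs ! i) < n"
          using cell_size_split_less[OF c(1), of "cs ! i"] i c(5) less.prems(3) by simp
      qed (use cells i len in auto)
    qed
    then have "join cs \<doteq> join ds"
      using same_cell_Upper[OF c(1), of ds] list_all2_lengthD[of same_cell cs ds] by simp
    then show ?thesis using same_cell_trans[OF 4(1) same_cell_trans[OF _ same_cell_sym[OF 4(2)]]] by blast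
  qed
qed

lemma same_cell_if_code_eq:
  "is_cell x \<Longrightarrow> is_cell y \<Longrightarrow> cell_size x = cell_size y \<Longrightarrow> ccode 0 x = ccode 0 y \<Longrightarrow> x \<doteq> y"
  using same_cell_if_code_eq_aux by blast

section \<open>Inclusion of codes realised by faces\<close>

lemma prefix_split:
  "are_cells ds \<Longrightarrow> \<forall>(c, d)\<in>ccodes a ds. d \<le> x \<or> x \<le> c \<Longrightarrow> a \<le> x \<Longrightarrow>
   x \<le> a + total_size ds \<Longrightarrow>
   \<exists>ds' ds''. ds = ds' @ ds'' \<and> a + total_size ds' = x"
proof (induction ds arbitrary: a)
  case (Cons d ds)
  show ?case
  proof (cases "a = x")
    case False
    have "(a, a + cell_size d) \<in> ccodes a (d # ds)"
      using ccode_top[of d a] Cons.prems by simp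
    from bspec[OF Cons.prems(2) this] have "a + cell_size d \<le> x"
      using False Cons.prems by simp
    with Cons.prems Cons.IH[of "a + cell_size d"] obtain ds' ds''
      where "ds = ds' @ ds''" "a + cell_size d + total_size ds' = x" by auto
    then show ?thesis by (intro exI[of _ "d # ds'"] exI[of _ ds'']) auto
  qed (auto intro: exI[of _ "[]"])
qed auto

text \<open>No pair of \<open>ds\<close> crosses a boundary between factors of \<open>es\<close>,
  since it is also a pair of \<open>es\<close>; hence the \<open>ds\<close> fall into consecutive
  groups, one for each \<open>e\<close>.\<close>

lemma group_blocks:
  "are_cells es \<Longrightarrow> are_cells ds \<Longrightarrow>
   total_size ds = total_size es \<Longrightarrow> ccodes a ds \<subseteq> ccodes a es \<Longrightarrow>
   \<exists>dss. ds = concat dss \<and>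
     list_all2 (\<lambda>e ds'. cell_size e = total_size ds' \<and> ccodes 0 ds' \<subseteq> ccode 0 e) es dss"
proof (induction es arbitrary: a ds)
  case Nil
  have "length ds \<le> total_size ds"
    using Nil.prems(2) cell_size_pos by (intro sum_list_map_ge_length) blast
  then have "ds = []" using Nil.prems(3) by simp
  then show ?case by (intro exI[of _ "[]"]) simp
next
  case (Cons e es)
  let ?x = "a + cell_size e"
  have "d \<le> ?x \<or> ?x \<le> c" if "(c, d) \<in> ccodes a ds" for c d
  proof -
    have "(c, d) \<in> ccode a e \<union> ccodes ?x es" using that Cons.prems(4) by auto
    moreover have "ccode a e \<subseteq> located a ?x" "ccodes ?x es \<subseteq> located ?x (?x + total_size es)"
      using Cons.prems ccode_located ccodes_located by auto
    ultimately show ?thesis by (auto simp: located_def)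
  qed
  then obtain ds' ds'' where ds: "ds = ds' @ ds''" "a + total_size ds' = ?x"
    using prefix_split[of ds a ?x] Cons.prems by auto
  have *: "ccodes a ds' \<subseteq> ccode a e" "ccodes ?x ds'' \<subseteq> ccodes ?x es"
    using Cons.prems ds by (intro ccodes_subset_Cons[of e es ds' ds'' a]; simp)+
  obtain dss where "ds'' = concat dss"
     "list_all2 (\<lambda>e ds'. cell_size e = total_size ds' \<and> ccodes 0 ds' \<subseteq> ccode 0 e) es dss"
    using Cons.IH[OF _ _ _ *(2)] Cons.prems ds by auto
  then show ?case
    using ds * ccodes_subset_shift[of a ds' e] by (intro exI[of _ "ds' # dss"]) auto
qed

definition refines :: "cell \<Rightarrow> cell \<Rightarrow> bool" where
  "refines c d \<longleftrightarrow> is_cell c \<and> cell_size c = cell_size d \<and> ccode 0 d \<subseteq> ccode 0 c"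

lemma choose_packs:
  assumes "list_all2 (\<lambda>e ds. \<exists>S cs. unpainted S \<and> leaves S = length cs \<and> e \<doteq> pack S cs \<and> list_all2 refines cs ds) es dss"
  shows "\<exists>Ss css. length Ss = length es \<and> (\<forall>t\<in>set Ss. unpainted t) \<and> list_all2 (\<lambda>S cs. length cs = leaves S) Ss css \<and>
    (\<forall>cs\<in>set css. are_cells cs) \<and> list_all2 same_cell es (map2 pack Ss css) \<and>
    list_all2 refines (concat css) (concat dss)"
  using assms
proof (induction rule: list_all2_induct)
  case Nil
  show ?case by (intro exI[of _ "[]"]) auto
next
  case (Cons e es ds dss)
  from Cons(1) obtain S cs where *: "unpainted S" "leaves S = length cs" "e \<doteq> pack S cs" "list_all2 refines cs ds"
    by blast
  from Cons(3) obtain Ss css where **: "length Ss = length es" "\<forall>t\<in>set Ss. unpainted t"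
    "list_all2 (\<lambda>S cs. length cs = leaves S) Ss css" "\<forall>cs\<in>set css. are_cells cs"
    "list_all2 same_cell es (map2 pack Ss css)" "list_all2 refines (concat css) (concat dss)"
    by blast
  have "are_cells cs"
    using *(4) by (auto simp: refines_def list_all2_conv_all_nth in_set_conv_nth)
  with * ** show ?case
    by (intro exI[of _ "S # Ss"] exI[of _ "cs # css"]) (simp add: list_all2_appendI)
qed

text \<open>The intervals of the factors \<open>ds\<close> also occur in \<open>x\<close>, so
  \<open>x\<close> can be renamed to have exactly one factor for each of them. The painted intervals
  of \<open>x\<close> that contain several factors become the nodes of \<open>S\<close>.\<close>

lemma factor_through:
  "is_cell x \<Longrightarrow> is_cell (join ds) \<Longrightarrow> cell_size x = cell_size (join ds) \<Longrightarrow> ccodes 0 ds \<subseteq> ccode 0 x \<Longrightarrow>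
   \<exists>S cs. unpainted S \<and> leaves S = length cs \<and> x \<doteq> Upper S cs \<and> list_all2 refines cs ds"
proof (induction "cell_size x" arbitrary: x ds rule: less_induct)
  case less
  have "\<not> flat x" using join_not_flat_code less.prems by metis
  then obtain es where es: "x \<doteq> join es" using normal_form less.prems by blast
  have e: "is_cell (join es)" "cell_size (join es) = cell_size x" "ccode 0 x = ccode 0 (join es)"
    using same_cellD[OF es] by auto
  have cells: "are_cells es" "are_cells ds" "length es \<ge> 2"
    using e less.prems by (auto simp: is_cell_join)
  have sub: "ccodes 0 ds \<subseteq> ccodes 0 es"
    using less.prems e top_notin_ccodes[of ds] by (auto simp: ccode_join cell_size_join)
  obtain dss where dss: "ds = concat dss"
     "list_all2 (\<lambda>e ds'. cell_size e = total_size ds' \<and> ccodes 0 ds' \<subseteq> ccode 0 e) es dss"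
    using group_blocks[OF cells(1,2) _ sub] less.prems e by (auto simp: cell_size_join)
  have "list_all2 (\<lambda>e ds. \<exists>S cs. unpainted S \<and> leaves S = length cs \<and> e \<doteq> pack S cs \<and> list_all2 refines cs ds) es dss"
  proof (rule list_all2_all_nthI)
    show len: "length es = length dss" using dss(2) list_all2_lengthD by blast
    fix i assume i: "i < length es"
    let ?e = "es ! i" and ?ds = "dss ! i"
    have e': "is_cell ?e" "cell_size ?e < cell_size x"
      using i cells e cell_size_split_less[of es ?e] by auto
    have d': "\<forall>c\<in>set ?ds. is_cell c" using cells dss(1) i len by (auto dest: nth_mem)
    have s: "cell_size ?e = total_size ?ds" "ccodes 0 ?ds \<subseteq> ccode 0 ?e"
      using dss(2) i by (auto simp: list_all2_conv_all_nth)
    \<comment> \<open>A group of one \<open>d\<close> needs no further node, so its branch is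
      \<open>Leaf\<close>; a larger group forms a join to which the induction hypothesis for the
      smaller cell \<open>?e\<close> applies.\<close>
    consider "?ds = []" | d where "?ds = [d]" | "length ?ds \<ge> 2"
      by (metis One_nat_def Suc_leI length_0_conv length_greater_0_conv length_Suc_conv less_2_cases_iff linorder_not_less)
    then show "\<exists>S cs. unpainted S \<and> leaves S = length cs \<and> ?e \<doteq> pack S cs \<and> list_all2 refines cs ?ds"
    proof cases
      case 1
      then show ?thesis using s e' cell_size_pos[of ?e] by simp
    next
      case 2
      then show ?thesis using s e' same_cell_refl[of ?e]
        by (intro exI[of _ Leaf] exI[of _ "[?e]"]) (auto simp: pack_def refines_def)
    next
      case 3
      then obtain S cs where *: "unpainted S" "leaves S = length cs" "?e \<doteq> Upper S cs" "list_all2 refines cs ?ds"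
        using less.hyps[OF e'(2) e'(1), of ?ds] s d' by (auto simp: is_cell_join cell_size_join)
      moreover have "S \<noteq> Leaf" using * 3 list_all2_lengthD[OF *(4)] by auto
      ultimately show ?thesis by (intro exI[of _ S] exI[of _ cs]) (auto simp: pack_def)
    qed
  qed
  from choose_packs[OF this] obtain Ss css where *:
    "length Ss = length es" "\<forall>t\<in>set Ss. unpainted t" "list_all2 (\<lambda>S cs. length cs = leaves S) Ss css"
    "\<forall>cs\<in>set css. are_cells cs" "list_all2 same_cell es (map2 pack Ss css)"
    "list_all2 refines (concat css) (concat dss)" by blast
  have "x \<doteq> Upper (corolla (length es)) (map2 pack Ss css)"
    using es same_cell_Upper[OF e(1) *(5)] same_cell_trans by blast
  also have "\<dots> \<doteq> Upper (Node False Ss) (concat css)"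
    using same_cell_pack[OF *(2,3,4)] cells * same_cell_sym by auto
  finally have x: "x \<doteq> Upper (Node False Ss) (concat css)" .
  then show ?case
    using same_cellD(2)[OF x] * dss(1)
    by (intro exI[of _ "Node False Ss"] exI[of _ "concat css"]) (auto simp: is_cell_Upper)
qed

text \<open>Converse of \<open>cell_face_code\<close>, up to the choice of names. If
  \<open>y\<close> is \<open>Lower k d\<close>, the gap \<open>k\<close> is brought to the front of
  \<open>x\<close> as well; if \<open>y\<close> is a join, \<open>factor_through\<close> matches the
  factors of \<open>x\<close> with those of \<open>y\<close>.\<close>

lemma faces_if_refines:
  "refines x y \<Longrightarrow> is_cell y \<Longrightarrow> \<exists>x' y'. x \<doteq> x' \<and> y \<doteq> y' \<and> cell_face x' y'"
proof (induction "cell_size y" arbitrary: x y rule: less_induct)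
  case less
  have xy: "is_cell x" "is_cell y" "cell_size x = cell_size y" "ccode 0 y \<subseteq> ccode 0 x"
    using less.prems by (auto simp: refines_def)
  consider "flat y" | ds where "y \<doteq> join ds" using normal_form less.prems by blast
  then show ?case
  proof cases
    case 1
    show ?thesis
    proof (cases y)
      case (Whole n)
      then show ?thesis using xy cell_face_Whole[of x] same_cell_refl by auto
    next
      case (Lower k d)
      then have "(k, k) \<in> ccode 0 x" using xy by (auto simp: ccode_Lower)
      then obtain c where c: "x \<doteq> Lower k c" using zero_in_front xy by blast
      have *: "is_cell (Lower k c)" "is_cell (Lower k d)" "cell_size (Lower k c) = cell_size (Lower k d)"
        "ccode 0 (Lower k d) \<subseteq> ccode 0 (Lower k c)"
        using xy same_cellD[OF c] Lower by auto
      have "refines c d" "is_cell d" "cell_size d < cell_size y"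
        using * Lower_code_subset[of k c d] Lower by (auto simp: refines_def is_cell_Lower cell_size_Lower)
      then obtain c' d' where "c \<doteq> c'" "d \<doteq> d'" "cell_face c' d'" using less.hyps by blast
      moreover have "Lower k c \<doteq> Lower k c'" "Lower k d \<doteq> Lower k d'"
        using calculation * by (auto simp: is_cell_Lower intro!: same_cell_Lower)
      ultimately show ?thesis
        using same_cell_trans[OF c] cell_face.intros(3)[of c' d' k] Lower by blast
    qed (use 1 in auto)
  next
    case 2
    have d: "is_cell (join ds)" "cell_size (join ds) = cell_size y" "ccode 0 y = ccode 0 (join ds)"
      using same_cellD[OF 2] by auto
    have "ccodes 0 ds \<subseteq> ccode 0 x" using d xy by (auto simp: ccode_join)
    from factor_through[OF xy(1) d(1) _ this] obtain S cs
      where S: "unpainted S" "leaves S = length cs" "x \<doteq> Upper S cs" "list_all2 refines cs ds"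
      using xy d by auto
    have len: "length cs = length ds" using S(4) list_all2_lengthD by blast
    have "\<exists>c' d'. cs ! i \<doteq> c' \<and> ds ! i \<doteq> d' \<and> cell_face c' d'" if "i < length cs" for i
    proof (rule less.hyps)
      show "cell_size (ds ! i) < cell_size y"
        using d that len cell_size_split_less[of ds "ds ! i"] by auto
      show "refines (cs ! i) (ds ! i)" using S(4) that by (auto simp: list_all2_conv_all_nth)
      show "is_cell (ds ! i)" using d(1) that len by (auto simp: is_cell_join)
    qed
    then obtain c' d' where *: "cs ! i \<doteq> c' i" "ds ! i \<doteq> d' i" "cell_face (c' i) (d' i)" if "i < length cs" for i
      by metis
    let ?cs = "map c' [0..<length cs]" and ?ds = "map d' [0..<length cs]"
    have "Upper S cs \<doteq> Upper S ?cs" "join ds \<doteq> Upper (corolla (length ds)) ?ds"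
      using * len same_cellD(2)[OF S(3)] d(1) by (auto intro!: same_cell_Upper simp: list_all2_conv_all_nth)
    moreover have "cell_face (Upper S ?cs) (Upper (corolla (length ds)) ?ds)"
    proof (rule cell_face.intros)
      have "S \<noteq> Leaf" using S(2) len d(1) by (auto simp: is_cell_join)
      then show "assoc_le S (corolla (length ds))" using assoc_le_corolla[OF S(1)] S(2) len by simp
    qed (use * in \<open>auto simp: list_all2_conv_all_nth\<close>)
    ultimately show ?thesis using same_cell_trans[OF 2] same_cell_trans[OF S(3)] by blast
  qed
qed

section \<open>The coverage function\<close>

text \<open>Here \<open>(s, t)\<close> stands for the interval of gaps from \<open>s\<close> to
  \<open>t\<close> inclusive, whereas the proper pairs in codes and in \<open>comps\<close> have cut
  points as ends.\<close>

definition pairs :: "nat \<Rightarrow> nat \<Rightarrow> (nat \<times> nat) set" where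
  "pairs a b = {(s, t). a < s \<and> s \<le> t \<and> t < b}"

definition hit :: "nat set \<Rightarrow> (nat \<times> nat) set" where
  "hit B = {(s, t). B \<inter> {s..t} \<noteq> {}}"

definition coverage :: "nat \<Rightarrow> nat \<Rightarrow> nat set \<Rightarrow> nat" where
  "coverage a b B = card (pairs a b \<inter> hit B)"

text \<open>The pieces into which the cuts \<open>M\<close> divide the leaves \<open>a, \<dots>, b - 1\<close>.\<close>

definition comps :: "nat \<Rightarrow> nat \<Rightarrow> nat set \<Rightarrow> (nat \<times> nat) set" where
  "comps a b M = {(c, d). c \<in> insert a M \<and> d \<in> insert b M \<and> c < d \<and> M \<inter> {c<..<d} = {}}"

lemma finite_pairs [simp]: "finite (pairs a b)"
  by (rule finite_subset[of _ "{..b} \<times> {..b}"]) (auto simp: pairs_def)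

lemma hit_Un: "hit (A \<union> B) = hit A \<union> hit B"
  by (auto simp: hit_def)

lemma hit_empty [simp]: "hit {} = {}"
  by (auto simp: hit_def)

lemma hit_mono: "A \<subseteq> B \<Longrightarrow> hit A \<subseteq> hit B"
  by (auto simp: hit_def)

lemma coverage_empty [simp]: "coverage a b {} = 0"
  by (simp add: coverage_def)

lemma comps_bounds:
  "M \<subseteq> {a<..<b} \<Longrightarrow> (c, d) \<in> comps a b M \<Longrightarrow> a \<le> c \<and> c < d \<and> d \<le> b"
  by (auto simp: comps_def)

lemma finite_comps: "M \<subseteq> {a<..<b} \<Longrightarrow> finite (comps a b M)"
  by (rule finite_subset[of _ "{..b} \<times> {..b}"]) (auto dest: comps_bounds)

lemma comps_disjoint:
  assumes "M \<subseteq> {a<..<b}" "(c, d) \<in> comps a b M" "(c', d') \<in> comps a b M"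
  shows "(c, d) = (c', d') \<or> d \<le> c' \<or> d' \<le> c"
proof -
  have 1: "\<not> (c < x \<and> x < d)" "\<not> (c' < x \<and> x < d')" if "x \<in> {a, b} \<union> M" for x
  proof -
    have "x = a \<or> x = b \<or> x \<in> M" using that by blast
    moreover have "M \<inter> {c<..<d} = {}" "M \<inter> {c'<..<d'} = {}" using assms(2,3) by (simp_all add: comps_def)
    moreover note comps_bounds[OF assms(1,2)] comps_bounds[OF assms(1,3)]
    ultimately show "\<not> (c < x \<and> x < d)" "\<not> (c' < x \<and> x < d')"
      by (metis IntI empty_iff greaterThanLessThan_iff leD)+
  qed
  have 2: "c \<in> {a, b} \<union> M" "c' \<in> {a, b} \<union> M" "d \<in> {a, b} \<union> M" "d' \<in> {a, b} \<union> M" 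
    using assms(2,3) by (simp_all add: comps_def) blast+
  show ?thesis
  proof (rule ccontr)
    assume "\<not> ?thesis"
    then have n: "c' < d" "c < d'" "\<not> (c = c' \<and> d = d')" by (simp_all add: not_le)
    have "c = c'" using 1(1)[OF 2(2)] 1(2)[OF 2(1)] n by linarith
    moreover have "d = d'" using 1(1)[OF 2(4)] 1(2)[OF 2(3)] n by linarith
    ultimately show False using n(3) by blast
  qed
qed

lemma comps_enclose:
  assumes "M \<subseteq> {a<..<b}" "a \<le> x" "x < y" "y \<le> b" "M \<inter> {x<..<y} = {}"
  shows "\<exists>c d. (c, d) \<in> comps a b M \<and> c \<le> x \<and> y \<le> d"
proof -
  have fin: "finite M" using assms(1) finite_subset by blast
  define c where "c = Max (insert a {i\<in>M. i \<le> x})"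
  define d where "d = Min (insert b {i\<in>M. y \<le> i})"
  have c: "c \<in> insert a {i\<in>M. i \<le> x}" "\<And>i. i \<in> M \<Longrightarrow> i \<le> x \<Longrightarrow> i \<le> c"
    unfolding c_def using fin by (intro Max_in Max_ge; simp)+
  have d: "d \<in> insert b {i\<in>M. y \<le> i}" "\<And>i. i \<in> M \<Longrightarrow> y \<le> i \<Longrightarrow> d \<le> i"
    unfolding d_def using fin by (intro Min_in Min_le; simp)+
  have cd: "c \<le> x" "y \<le> d" using c(1) d(1) assms by auto
  have "M \<inter> {c<..<d} = {}"
  proof -
    have False if i: "i \<in> M" "c < i" "i < d" for i
    proof -
      have "\<not> i \<le> x" "\<not> y \<le> i" using c(2)[OF i(1)] d(2)[OF i(1)] i by linarith+
      then show False using assms(5) i by auto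
    qed
    then show ?thesis by auto
  qed
  then have "(c, d) \<in> comps a b M" using c(1) d(1) assms cd by (auto simp: comps_def)
  then show ?thesis using cd by blast
qed

lemma comps_cover:
  assumes "M \<subseteq> {a<..<b}" "(s, t) \<in> pairs a b" "(s, t) \<notin> hit M"
  shows "\<exists>(c, d)\<in>comps a b M. c < s \<and> t < d"
proof -
  have "a \<le> s - 1" "s - 1 < t + 1" "t + 1 \<le> b" "0 < s" and M: "M \<inter> {s..t} = {}"
    using assms(2,3) by (auto simp: pairs_def hit_def)
  moreover have "{s - 1<..<t + 1} = {s..t}" using \<open>0 < s\<close> by auto
  ultimately obtain c d where "(c, d) \<in> comps a b M" "c \<le> s - 1" "t + 1 \<le> d"
    using comps_enclose[OF assms(1), of "s - 1" "t + 1"] by auto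
  then show ?thesis using \<open>0 < s\<close> by (intro bexI[of _ "(c, d)"]) auto
qed

lemma hit_restrict: "(s, t) \<in> pairs c d \<Longrightarrow> (s, t) \<in> hit (B \<inter> {c<..<d}) \<longleftrightarrow> (s, t) \<in> hit B"
  by (auto simp: pairs_def hit_def)

lemma pairs_comps:
  assumes "M \<subseteq> {a<..<b}"
  shows "pairs a b - hit M = (\<Union>(c, d)\<in>comps a b M. pairs c d)"
proof -
  have "(s, t) \<in> pairs a b - hit M" if "(c, d) \<in> comps a b M" "(s, t) \<in> pairs c d" for s t c d
    using that comps_bounds[OF assms that(1)] by (fastforce simp: pairs_def hit_def comps_def)
  moreover have "p \<in> (\<Union>(c, d)\<in>comps a b M. pairs c d)" if "p \<in> pairs a b - hit M" for p
    using comps_cover[OF assms, of "fst p" "snd p"] that by (fastforce simp: pairs_def)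
  ultimately show ?thesis by auto
qed

text \<open>An interval that avoids \<open>M\<close> lies in exactly one piece, and only the part of
  \<open>B\<close> in that piece can meet it.\<close>

lemma coverage_outside:
  assumes "M \<subseteq> {a<..<b}"
  shows "card (pairs a b \<inter> hit B - hit M) = (\<Sum>(c, d)\<in>comps a b M. coverage c d (B \<inter> {c<..<d}))"
proof -
  have "pairs a b \<inter> hit B - hit M = (\<Union>(c, d)\<in>comps a b M. pairs c d \<inter> hit (B \<inter> {c<..<d}))"
    (is "?L = ?R")
  proof -
    have "?L = (pairs a b - hit M) \<inter> hit B" by auto
    also have "\<dots> = (\<Union>(c, d)\<in>comps a b M. pairs c d \<inter> hit B)" unfolding pairs_comps[OF assms] by auto
    also have "\<dots> = ?R"
    proof -
      have "pairs c d \<inter> hit B = pairs c d \<inter> hit (B \<inter> {c<..<d})" for c d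
        using hit_restrict[of _ _ c d B] by auto
      then show ?thesis by simp
    qed
    finally show ?thesis .
  qed
  also have "card \<dots> = (\<Sum>x\<in>comps a b M. card (case x of (c, d) \<Rightarrow> pairs c d \<inter> hit (B \<inter> {c<..<d})))"
  proof (rule card_UN_disjoint)
    show "finite (comps a b M)" using assms by (rule finite_comps)
    show "\<forall>x\<in>comps a b M. \<forall>y\<in>comps a b M. x \<noteq> y \<longrightarrow>
       (case x of (c, d) \<Rightarrow> pairs c d \<inter> hit (B \<inter> {c<..<d})) \<inter> (case y of (c, d) \<Rightarrow> pairs c d \<inter> hit (B \<inter> {c<..<d})) = {}"
    proof (intro ballI impI)
      fix x y assume *: "x \<in> comps a b M" "y \<in> comps a b M" "x \<noteq> y"
      obtain c d c' d' where xy: "x = (c, d)" "y = (c', d')" by (cases x; cases y)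
      then have "d \<le> c' \<or> d' \<le> c" using comps_disjoint[OF assms, of c d c' d'] * by auto
      then have "pairs c d \<inter> pairs c' d' = {}" by (auto simp: pairs_def)
      then show "(case x of (c, d) \<Rightarrow> pairs c d \<inter> hit (B \<inter> {c<..<d})) \<inter> (case y of (c, d) \<Rightarrow> pairs c d \<inter> hit (B \<inter> {c<..<d})) = {}"
        using xy by auto
    qed
  qed auto
  finally show ?thesis by (simp add: coverage_def case_prod_beta')
qed

lemma card_hit_split: "card (pairs a b \<inter> hit B) = card (pairs a b \<inter> hit B \<inter> hit M) + card (pairs a b \<inter> hit B - hit M)"
proof -
  have "pairs a b \<inter> hit B = (pairs a b \<inter> hit B \<inter> hit M) \<union> (pairs a b \<inter> hit B - hit M)" by blast
  also have "card \<dots> = card (pairs a b \<inter> hit B \<inter> hit M) + card (pairs a b \<inter> hit B - hit M)"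
    by (intro card_Un_disjoint) auto
  finally show ?thesis .
qed

text \<open>In matroid language: contracting \<open>M\<close> turns \<open>coverage\<close> into the
  direct sum of the coverage functions of the pieces. All recursions below rest on this.\<close>

lemma coverage_Un:
  assumes "M \<subseteq> {a<..<b}" "M \<subseteq> B"
  shows "coverage a b B = coverage a b M + (\<Sum>(c, d)\<in>comps a b M. coverage c d (B \<inter> {c<..<d}))"
proof -
  have "hit B \<inter> hit M = hit M" using hit_mono[OF assms(2)] by auto
  then have "coverage a b B = coverage a b M + card (pairs a b \<inter> hit B - hit M)"
    unfolding coverage_def using card_hit_split[of a b B M] by (simp add: Int_assoc)
  then show ?thesis
    by (simp add: coverage_outside[OF assms(1)])
qed

lemma sum_comps:
  fixes z :: "nat \<Rightarrow> real"
  assumes M: "M \<subseteq> {a<..<b}" and B: "B \<subseteq> {a<..<b}"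
  shows "sum z B = sum z (B \<inter> M) + (\<Sum>(c, d)\<in>comps a b M. sum z (B \<inter> {c<..<d}))"
proof -
  have fin: "finite B" using B finite_subset by blast
  have "B - M = (\<Union>(c, d)\<in>comps a b M. B \<inter> {c<..<d})"
  proof -
    have "i \<in> (\<Union>(c, d)\<in>comps a b M. B \<inter> {c<..<d})" if "i \<in> B - M" for i
      using comps_cover[OF M, of i i] that B by (fastforce simp: pairs_def hit_def)
    then show ?thesis by (auto simp: comps_def)
  qed
  moreover have "sum z (\<Union>(c, d)\<in>comps a b M. B \<inter> {c<..<d}) =
      (\<Sum>x\<in>comps a b M. sum z (case x of (c, d) \<Rightarrow> B \<inter> {c<..<d}))"
  proof (rule sum.UNION_disjoint)
    show "finite (comps a b M)" using M by (rule finite_comps)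
    show "\<forall>x\<in>comps a b M. finite (case x of (c, d) \<Rightarrow> B \<inter> {c<..<d})" by auto
    show "\<forall>x\<in>comps a b M. \<forall>y\<in>comps a b M. x \<noteq> y \<longrightarrow>
       (case x of (c, d) \<Rightarrow> B \<inter> {c<..<d}) \<inter> (case y of (c, d) \<Rightarrow> B \<inter> {c<..<d}) = {}"
    proof (intro ballI impI)
      fix x y assume *: "x \<in> comps a b M" "y \<in> comps a b M" "x \<noteq> y"
      obtain c d c' d' where xy: "x = (c, d)" "y = (c', d')" by (cases x; cases y)
      then have "d \<le> c' \<or> d' \<le> c" using comps_disjoint[OF M, of c d c' d'] * by auto
      then show "(case x of (c, d) \<Rightarrow> B \<inter> {c<..<d}) \<inter> (case y of (c, d) \<Rightarrow> B \<inter> {c<..<d}) = {}"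
        using xy by auto
    qed
  qed
  moreover have "sum z B = sum z (B \<inter> M) + sum z (B - M)"
    using fin by (metis sum.Int_Diff)
  ultimately show ?thesis by (simp add: case_prod_beta')
qed

section \<open>The polymatroid\<close>

definition feasible :: "nat \<Rightarrow> nat \<Rightarrow> (nat \<Rightarrow> real) \<Rightarrow> bool" where
  "feasible a b z \<longleftrightarrow> (\<forall>i\<in>{a<..<b}. 0 \<le> z i) \<and> (\<forall>B\<subseteq>{a<..<b}. sum z B \<le> real (coverage a b B))"

definition tight :: "nat \<Rightarrow> nat \<Rightarrow> (nat \<Rightarrow> real) \<Rightarrow> nat set \<Rightarrow> bool" where
  "tight a b z B \<longleftrightarrow> B \<subseteq> {a<..<b} \<and> sum z B = real (coverage a b B)"

text \<open>Uncrossing: the defect of modularity of \<open>coverage\<close> counts the intervals that meet \<open>A\<close> and \<open>B\<close>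
  but not \<open>A \<inter> B\<close>.\<close>

lemma tight_Int:
  assumes "feasible a b z" "tight a b z A" "tight a b z B"
  shows "tight a b z (A \<inter> B)" "pairs a b \<inter> hit A \<inter> hit B \<subseteq> hit (A \<inter> B)"
proof -
  have sub: "A \<subseteq> {a<..<b}" "B \<subseteq> {a<..<b}" using assms by (auto simp: tight_def)
  then have fin: "finite A" "finite B" using finite_subset by blast+
  let ?I = "pairs a b \<inter> hit A \<inter> hit B"
  have "coverage a b A + coverage a b B = coverage a b (A \<union> B) + card ?I"
    unfolding coverage_def hit_Un using card_Un_Int[of "pairs a b \<inter> hit A" "pairs a b \<inter> hit B"]
    by (simp add: Int_Un_distrib Int_assoc Int_left_commute)
  moreover have "sum z A + sum z B = sum z (A \<union> B) + sum z (A \<inter> B)"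
    using fin by (simp add: sum.union_inter)
  moreover have "sum z (A \<union> B) \<le> coverage a b (A \<union> B)" "sum z (A \<inter> B) \<le> coverage a b (A \<inter> B)"
    using assms(1) sub unfolding feasible_def by (meson Un_least le_infI1)+
  moreover have "sum z A = coverage a b A" "sum z B = coverage a b B" using assms by (auto simp: tight_def)
  ultimately have *: "card ?I \<le> sum z (A \<inter> B)" "sum z (A \<inter> B) \<le> coverage a b (A \<inter> B)" by linarith+
  have s: "pairs a b \<inter> hit (A \<inter> B) \<subseteq> ?I" using hit_mono by blast
  have "card ?I \<le> card (pairs a b \<inter> hit (A \<inter> B))" using * unfolding coverage_def by linarith
  then have eq: "pairs a b \<inter> hit (A \<inter> B) = ?I" using s by (intro card_seteq) auto
  then show "pairs a b \<inter> hit A \<inter> hit B \<subseteq> hit (A \<inter> B)" by auto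
  have "card ?I = coverage a b (A \<inter> B)" using eq by (simp add: coverage_def)
  then have "sum z (A \<inter> B) = coverage a b (A \<inter> B)" using * by linarith
  then show "tight a b z (A \<inter> B)" using sub by (auto simp: tight_def)
qed

text \<open>A nonempty tight set of minimal size lies in every other one, since intersecting it with
  another cannot produce a smaller nonempty tight set.\<close>

lemma least_tight:
  assumes P: "feasible a b z" and ex: "tight a b z B0" "B0 \<noteq> {}"
  obtains M where "tight a b z M" "M \<noteq> {}" "\<And>B. tight a b z B \<Longrightarrow> B \<noteq> {} \<Longrightarrow> M \<subseteq> B"
proof -
  define M where "M = arg_min card (\<lambda>B. tight a b z B \<and> B \<noteq> {})"
  have M: "tight a b z M \<and> M \<noteq> {}" "\<And>B. tight a b z B \<and> B \<noteq> {} \<Longrightarrow> card M \<le> card B"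
    unfolding M_def using ex
    by (rule_tac arg_min_natI[of "\<lambda>B. tight a b z B \<and> B \<noteq> {}"], simp)
       (rule arg_min_nat_le[of "\<lambda>B. tight a b z B \<and> B \<noteq> {}"], simp)
  have "M \<subseteq> B" if B: "tight a b z B" "B \<noteq> {}" for B
  proof -
    have sub: "M \<subseteq> {a<..<b}" "B \<subseteq> {a<..<b}" using M B by (auto simp: tight_def)
    then have fin: "finite M" using finite_subset by blast
    have "(Suc a, b - 1) \<in> pairs a b \<inter> hit M \<inter> hit B"
      using sub M(1) B(2) by (fastforce simp: pairs_def hit_def)
    then have "(Suc a, b - 1) \<in> hit (M \<inter> B)" using tight_Int(2)[OF P, of M B] M B by blast
    then have "M \<inter> B \<noteq> {}" by (auto simp: hit_def)
    then have "card M \<le> card (M \<inter> B)" using M tight_Int(1)[OF P, of M B] B by blast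
    then have "M \<inter> B = M" using fin by (intro card_seteq) auto
    then show ?thesis by blast
  qed
  then show ?thesis using that M(1) by blast
qed

lemma coverage_block:
  assumes "M \<subseteq> {a<..<b}" "(c, d) \<in> comps a b M" "B \<subseteq> {c<..<d}"
  shows "coverage a b (M \<union> B) = coverage a b M + coverage c d B"
proof -
  have "(M \<union> B) \<inter> {c'<..<d'} = (if (c', d') = (c, d) then B else {})" if "(c', d') \<in> comps a b M" for c' d'
  proof -
    have "M \<inter> {c'<..<d'} = {}" using that by (auto simp: comps_def)
    moreover have "B \<inter> {c'<..<d'} = {}" if "(c', d') \<noteq> (c, d)"
      using comps_disjoint[OF assms(1,2) \<open>(c', d') \<in> _\<close>] that assms(3) by fastforce
    ultimately show ?thesis using assms(3) by auto
  qed
  then have "(\<Sum>(c', d')\<in>comps a b M. coverage c' d' ((M \<union> B) \<inter> {c'<..<d'})) =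
     (\<Sum>x\<in>comps a b M. if x = (c, d) then coverage c d B else 0)"
    by (intro sum.cong) (auto split: if_splits)
  also have "\<dots> = coverage c d B"
    using assms(2) finite_comps[OF assms(1)] by simp
  finally show ?thesis using coverage_Un[OF assms(1), of "M \<union> B"] by simp
qed

text \<open>Adding the tight set \<open>M\<close> to a subset of a piece adds the same constant
  \<open>coverage a b M\<close> to both sides of its bound.\<close>

lemma feasible_block:
  assumes "feasible a b z" "tight a b z M" "(c, d) \<in> comps a b M"
  shows "feasible c d z"
proof -
  have M: "M \<subseteq> {a<..<b}" using assms by (auto simp: tight_def)
  have cd: "{c<..<d} \<subseteq> {a<..<b}" using comps_bounds[OF M assms(3)] by auto
  have "sum z B \<le> coverage c d B" if B: "B \<subseteq> {c<..<d}" for B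
  proof -
    have "M \<inter> B = {}" using assms(3) B by (auto simp: comps_def)
    moreover have "finite M" "finite B" using M B finite_subset by blast+
    ultimately have "sum z (M \<union> B) = sum z M + sum z B" by (simp add: sum.union_disjoint)
    moreover have "sum z (M \<union> B) \<le> coverage a b (M \<union> B)"
      using assms(1) M B cd unfolding feasible_def by (meson Un_least order_trans)
    moreover have "sum z M = coverage a b M" using assms(2) by (simp add: tight_def)
    ultimately show ?thesis using coverage_block[OF M assms(3) B] by simp
  qed
  then show ?thesis using assms(1) cd unfolding feasible_def by blast
qed

text \<open>The slack of the bound for \<open>B\<close> is the sum of the slacks for its parts in
  the pieces; these are nonnegative, so the sum vanishes only if each of them does.\<close>

lemma tight_blocks:
  assumes P: "feasible a b z" and M: "tight a b z M" "M \<subseteq> B" and B: "B \<subseteq> {a<..<b}"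
  shows "tight a b z B \<longleftrightarrow> (\<forall>(c, d)\<in>comps a b M. tight c d z (B \<inter> {c<..<d}))"
proof -
  have Ms: "M \<subseteq> {a<..<b}" using M by (auto simp: tight_def)
  have "sum z B = sum z M + (\<Sum>(c, d)\<in>comps a b M. sum z (B \<inter> {c<..<d}))"
    using sum_comps[OF Ms B, of z] M(2) by (simp add: Int_absorb1)
  moreover have "real (coverage a b B) = real (coverage a b M) + (\<Sum>(c, d)\<in>comps a b M. real (coverage c d (B \<inter> {c<..<d})))"
    using coverage_Un[OF Ms M(2)] by (simp add: case_prod_beta')
  moreover have "sum z M = coverage a b M" using M by (simp add: tight_def)
  ultimately have "tight a b z B \<longleftrightarrow>
     (\<Sum>(c, d)\<in>comps a b M. real (coverage c d (B \<inter> {c<..<d})) - sum z (B \<inter> {c<..<d})) = 0"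
    using B unfolding tight_def by (auto simp: case_prod_beta' sum_subtractf)
  also have "\<dots> \<longleftrightarrow> (\<forall>(c, d)\<in>comps a b M. real (coverage c d (B \<inter> {c<..<d})) - sum z (B \<inter> {c<..<d}) = 0)"
  proof (subst sum_nonneg_eq_0_iff)
    show "finite (comps a b M)" using Ms by (rule finite_comps)
    show "0 \<le> (case x of (c, d) \<Rightarrow> real (coverage c d (B \<inter> {c<..<d})) - sum z (B \<inter> {c<..<d}))"
      if "x \<in> comps a b M" for x
      using feasible_block[OF P M(1), of "fst x" "snd x"] that by (cases x) (auto simp: feasible_def)
  qed auto
  also have "\<dots> \<longleftrightarrow> (\<forall>(c, d)\<in>comps a b M. tight c d z (B \<inter> {c<..<d}))"
    by (intro ball_cong) (auto simp: tight_def)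
  finally show ?thesis .
qed

lemma coverage_remove_less:
  assumes "M \<subseteq> {a<..<b}" "i \<in> M"
  shows "coverage a b (M - {i}) < coverage a b M"
proof -
  have "(i, i) \<in> pairs a b \<inter> hit M" "(i, i) \<notin> pairs a b \<inter> hit (M - {i})"
    using assms by (auto simp: pairs_def hit_def)
  then have "pairs a b \<inter> hit (M - {i}) \<subset> pairs a b \<inter> hit M"
    using hit_mono[of "M - {i}" M] by blast
  then show ?thesis unfolding coverage_def by (intro psubset_card_mono) auto
qed

text \<open>Removing \<open>i\<close> from \<open>M\<close> loses at least the interval
  \<open>(i, i)\<close>, so with \<open>z i = 0\<close> the bound for \<open>M - {i}\<close> would
  be violated. Hence cuts and vanishing coordinates never compete for the same gap.\<close>

lemma tight_pos:
  assumes "feasible a b z" "tight a b z M" "i \<in> M"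
  shows "0 < z i"
proof -
  have M: "M \<subseteq> {a<..<b}" using assms by (auto simp: tight_def)
  then have "finite M" using finite_subset by blast
  then have "sum z M = z i + sum z (M - {i})" using assms(3) by (simp add: sum.remove)
  moreover have "sum z (M - {i}) \<le> coverage a b (M - {i})"
    using assms(1) M unfolding feasible_def by blast
  ultimately show ?thesis
    using coverage_remove_less[OF M assms(3)] assms(2) by (simp add: tight_def)
qed

lemma comps_empty: "a < b \<Longrightarrow> comps a b {} = {(a, b)}"
  by (auto simp: comps_def)

lemma comps_block_subset:
  assumes "(c, d) \<in> comps a b M" "M \<subseteq> B"
  shows "comps c d (B \<inter> {c<..<d}) \<subseteq> comps a b B"
proof
  fix p assume "p \<in> comps c d (B \<inter> {c<..<d})"
  then obtain x y where p: "p = (x, y)" "x \<in> insert c (B \<inter> {c<..<d})" "y \<in> insert d (B \<inter> {c<..<d})" "x < y"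
    "B \<inter> {c<..<d} \<inter> {x<..<y} = {}" by (auto simp: comps_def)
  have cd: "c \<in> insert a M" "d \<in> insert b M" using assms(1) by (auto simp: comps_def)
  have "{x<..<y} \<subseteq> {c<..<d}" using p by auto
  then have "B \<inter> {x<..<y} = {}" using p(5) by blast
  moreover have "x \<in> insert a B" "y \<in> insert b B" using p(2,3) cd assms(2) by blast+
  ultimately show "p \<in> comps a b B" using p(1,4) by (simp add: comps_def)
qed

lemma comps_in_block:
  assumes M: "M \<subseteq> {a<..<b}" "M \<subseteq> B" and B: "B \<subseteq> {a<..<b}" and xy: "(x, y) \<in> comps a b B"
  shows "\<exists>c d. (c, d) \<in> comps a b M \<and> (x, y) \<in> comps c d (B \<inter> {c<..<d})"
proof -
  have 1: "x \<in> insert a B" "y \<in> insert b B" "x < y" "B \<inter> {x<..<y} = {}" using xy by (auto simp: comps_def)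
  have 2: "a \<le> x" "y \<le> b" using comps_bounds[OF B xy] by auto
  have "M \<inter> {x<..<y} = {}" using 1(4) M(2) by blast
  from comps_enclose[OF M(1) 2(1) 1(3) 2(2) this]
  obtain c d where cd: "(c, d) \<in> comps a b M" "c \<le> x" "y \<le> d" by blast
  have 3: "a \<le> c" "d \<le> b" using comps_bounds[OF M(1) cd(1)] by auto
  have "x \<in> insert c (B \<inter> {c<..<d})" "y \<in> insert d (B \<inter> {c<..<d})" using 1 cd 3 by auto
  moreover have "B \<inter> {c<..<d} \<inter> {x<..<y} = {}" using 1(4) by blast
  ultimately have "(x, y) \<in> comps c d (B \<inter> {c<..<d})" using 1(3) by (simp add: comps_def)
  then show ?thesis using cd(1) by blast
qed

lemma located_same_block:
  assumes "M \<subseteq> {a<..<b}" "(c, d) \<in> comps a b M" "(c', d') \<in> comps a b M"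
    and "p \<in> located c d" "p \<in> located c' d'"
  shows "c = c' \<and> d = d'"
  using comps_disjoint[OF assms(1,2,3)] assms(4,5) by (auto simp: located_def)

text \<open>Combinatorial counterpart of \<open>tight_blocks\<close>. If a nonempty \<open>B\<close>
  omits some \<open>m\<close> in \<open>M\<close>, one of its pieces extends across \<open>m\<close>
  and fits into no \<open>D c d\<close>.\<close>

lemma comps_subset_node_iff:
  assumes M: "M \<subseteq> {a<..<b}" "M \<noteq> {}" and B: "B \<subseteq> {a<..<b}"
    and loc: "\<And>c d. (c, d) \<in> comps a b M \<Longrightarrow> D c d \<subseteq> located c d"
  shows "comps a b B \<subseteq> insert (a, b) (\<Union>(c, d)\<in>comps a b M. D c d) \<longleftrightarrow>
    B = {} \<or> (M \<subseteq> B \<and> (\<forall>(c, d)\<in>comps a b M. comps c d (B \<inter> {c<..<d}) \<subseteq> D c d))"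
    (is "?L \<longleftrightarrow> _ \<or> ?R")
proof (cases "B = {}")
  case True
  have "a < b" using M by auto
  then show ?thesis using True by (simp add: comps_empty)
next
  case False
  have "?L \<longleftrightarrow> ?R"
  proof
    assume L: ?L
    have "(a, b) \<notin> comps a b B" using B False by (auto simp: comps_def)
    then have L': "comps a b B \<subseteq> (\<Union>(c, d)\<in>comps a b M. D c d)" using L by blast
    have MB: "M \<subseteq> B"
    proof
      fix m assume m: "m \<in> M"
      show "m \<in> B"
      proof (rule ccontr)
        assume "m \<notin> B"
        then have "(m, m) \<in> pairs a b" "(m, m) \<notin> hit B" using m M by (auto simp: pairs_def hit_def)
        then obtain x y where xy: "(x, y) \<in> comps a b B" "x < m" "m < y"
          using comps_cover[OF B, of m m] by blast
        then obtain c d where cd: "(c, d) \<in> comps a b M" "(x, y) \<in> D c d" using L' by blast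
        then have "c \<le> x" "y \<le> d" using loc by (auto simp: located_def)
        then have "m \<in> M \<inter> {c<..<d}" using xy m by auto
        then show False using cd(1) by (auto simp: comps_def)
      qed
    qed
    have "p \<in> D c d" if cd: "(c, d) \<in> comps a b M" and p: "p \<in> comps c d (B \<inter> {c<..<d})" for c d p
    proof -
      have "p \<in> comps a b B" using comps_block_subset[OF cd MB] p by blast
      then obtain c' d' where cd': "(c', d') \<in> comps a b M" "p \<in> D c' d'" using L' by blast
      have "B \<inter> {c<..<d} \<subseteq> {c<..<d}" by auto
      then have "p \<in> located c d" using p comps_bounds[of "B \<inter> {c<..<d}" c d "fst p" "snd p"] by (auto simp: located_def)
      moreover have "p \<in> located c' d'" using cd' loc by auto
      ultimately show ?thesis using located_same_block[OF M(1) cd cd'(1)] cd' by blast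
    qed
    then show ?R using MB by blast
  next
    assume R: ?R
    show ?L
    proof
      fix p assume p: "p \<in> comps a b B"
      then obtain c d where "(c, d) \<in> comps a b M" "p \<in> comps c d (B \<inter> {c<..<d})"
        using comps_in_block[OF M(1) _ B, of "fst p" "snd p"] R by auto
      then show "p \<in> insert (a, b) (\<Union>(c, d)\<in>comps a b M. D c d)" using R by blast
    qed
  qed
  then show ?thesis using False by blast
qed

section \<open>Admissible codes\<close>

text \<open>Codes built up from the lowest node: in \<open>base\<close> it has type 6, and
  \<open>Z\<close> consists of the gaps above unpainted edges; in \<open>node\<close> it has type 5,
  \<open>M\<close> consists of the gaps between its branches, and the pieces are the leaf sets of
  the branches.\<close>

inductive adm :: "nat \<Rightarrow> nat \<Rightarrow> (nat \<times> nat) set \<Rightarrow> bool" where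
  base: "a < b \<Longrightarrow> Z \<subseteq> {a<..<b} \<Longrightarrow> adm a b (insert (a, b) ((\<lambda>i. (i, i)) ` Z))"
| node: "M \<subseteq> {a<..<b} \<Longrightarrow> M \<noteq> {} \<Longrightarrow> (\<And>c d. (c, d) \<in> comps a b M \<Longrightarrow> adm c d (D c d)) \<Longrightarrow>
     adm a b (insert (a, b) (\<Union>(c, d)\<in>comps a b M. D c d))"

lemma adm_less: "adm a b C \<Longrightarrow> a < b"
proof (induction rule: adm.induct)
  case (node M a b D)
  show ?case using node.hyps(1,2) by auto
qed auto

lemma adm_top: "adm a b C \<Longrightarrow> (a, b) \<in> C"
  by (induction rule: adm.induct) auto

lemma adm_located: "adm a b C \<Longrightarrow> C \<subseteq> located a b"
proof (induction rule: adm.induct)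
  case (base a b Z)
  then show ?case by (auto simp: located_def)
next
  case (node M a b D)
  have "D c d \<subseteq> located a b" if "(c, d) \<in> comps a b M" for c d
  proof -
    have "located c d \<subseteq> located a b" using comps_bounds[OF node(1) that] by (intro located_mono) auto
    then show ?thesis using node.IH[OF that] by blast
  qed
  moreover have "(a, b) \<in> located a b" using node.hyps(1,2) by (auto simp: located_def)
  ultimately show ?case by blast
qed

text \<open>The witness collects the cut sets on the way from \<open>(a, b)\<close> to the pair. All
  other pieces stay uncut, and an uncut piece is in the code by \<open>adm_top\<close>.\<close>

lemma adm_comps:
  "adm a b C \<Longrightarrow> (x, y) \<in> C \<Longrightarrow> x < y \<Longrightarrow> \<exists>B\<subseteq>{a<..<b}. (x, y) \<in> comps a b B \<and> comps a b B \<subseteq> C"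
proof (induction arbitrary: x y rule: adm.induct)
  case (base a b Z)
  then have "(x, y) = (a, b)" by auto
  then have "(x, y) \<in> comps a b {}" "comps a b {} \<subseteq> insert (a, b) ((\<lambda>i. (i, i)) ` Z)"
    using base.hyps by (simp_all add: comps_empty)
  then show ?case by blast
next
  case (node M a b D)
  have ab: "a < b" using node.hyps(1,2) by auto
  have loc: "D c d \<subseteq> located c d" if "(c, d) \<in> comps a b M" for c d
    by (rule adm_located[OF node.hyps(3)[OF that]])
  show ?case
  proof (cases "(x, y) = (a, b)")
    case True
    then have "(x, y) \<in> comps a b {}" "comps a b {} \<subseteq> insert (a, b) (\<Union>(c, d)\<in>comps a b M. D c d)"
      using ab by (simp_all add: comps_empty)
    then show ?thesis by blast
  next
    case False
    then obtain c d where cd: "(c, d) \<in> comps a b M" "(x, y) \<in> D c d" using node.prems by blast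
    then obtain B where B: "B \<subseteq> {c<..<d}" "(x, y) \<in> comps c d B" "comps c d B \<subseteq> D c d"
      using node.IH[OF cd(1) cd(2) node.prems(2)] by blast
    let ?B = "M \<union> B"
    have sub: "?B \<subseteq> {a<..<b}" using B(1) node.hyps(1) comps_bounds[OF node.hyps(1) cd(1)] by auto
    have Bc: "?B \<inter> {c<..<d} = B" using B(1) cd(1) by (auto simp: comps_def)
    have "comps c' d' (?B \<inter> {c'<..<d'}) \<subseteq> D c' d'" if c': "(c', d') \<in> comps a b M" for c' d'
    proof (cases "(c', d') = (c, d)")
      case True
      then show ?thesis using Bc B by auto
    next
      case False
      then have "?B \<inter> {c'<..<d'} = {}"
        using comps_disjoint[OF node.hyps(1) cd(1) c'] B(1) c' by (fastforce simp: comps_def)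
      then show ?thesis
        using adm_less[OF node.hyps(3)[OF c']] adm_top[OF node.hyps(3)[OF c']] by (simp add: comps_empty)
    qed
    then have "comps a b ?B \<subseteq> insert (a, b) (\<Union>(c, d)\<in>comps a b M. D c d)"
      using comps_subset_node_iff[OF node.hyps(1,2) sub loc] by blast
    moreover have "(x, y) \<in> comps a b ?B"
      using comps_block_subset[OF cd(1), of ?B] Bc B(2) by auto
    ultimately show ?thesis using sub by blast
  qed
qed

text \<open>A code is determined by its degenerate pairs and by the sets whose pieces it contains.
  These are the data that a point supplies, as vanishing coordinates and tight sets.\<close>

lemma adm_subset_iff:
  assumes "adm a b C"
  shows "C \<subseteq> C' \<longleftrightarrow> (\<forall>B\<subseteq>{a<..<b}. comps a b B \<subseteq> C \<longrightarrow> comps a b B \<subseteq> C') \<and>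
    (\<forall>i\<in>{a<..<b}. (i, i) \<in> C \<longrightarrow> (i, i) \<in> C')" (is "_ \<longleftrightarrow> ?R")
proof
  assume R: ?R
  show "C \<subseteq> C'"
  proof
    fix p assume p: "p \<in> C"
    obtain x y where xy: "p = (x, y)" by (cases p)
    have "p \<in> located a b" using adm_located[OF assms] p by blast
    then consider "x < y" | "x = y" "x \<in> {a<..<b}" using xy by (fastforce simp: located_def)
    then show "p \<in> C'"
    proof cases
      case 1
      then show ?thesis using adm_comps[OF assms, of x y] p xy R by blast
    qed (use R p xy in auto)
  qed
qed auto

definition represents :: "nat \<Rightarrow> nat \<Rightarrow> (nat \<Rightarrow> real) \<Rightarrow> (nat \<times> nat) set \<Rightarrow> bool" where
  "represents a b z C \<longleftrightarrow> (\<forall>B\<subseteq>{a<..<b}. tight a b z B \<longleftrightarrow> comps a b B \<subseteq> C) \<and>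
     (\<forall>i\<in>{a<..<b}. z i = 0 \<longleftrightarrow> (i, i) \<in> C)"

lemma represents_subset_iff:
  assumes "adm a b C" "represents a b z C" "represents a b z' C'"
  shows "C \<subseteq> C' \<longleftrightarrow> (\<forall>B. tight a b z B \<longrightarrow> tight a b z' B) \<and> (\<forall>i\<in>{a<..<b}. z i = 0 \<longrightarrow> z' i = 0)"
proof -
  have "(\<forall>B. tight a b z B \<longrightarrow> tight a b z' B) \<longleftrightarrow> (\<forall>B\<subseteq>{a<..<b}. tight a b z B \<longrightarrow> tight a b z' B)"
    unfolding tight_def by blast
  then show ?thesis
    unfolding adm_subset_iff[OF assms(1)] using assms(2,3) unfolding represents_def by simp
qed

lemma represents_base:
  assumes "a < b" "\<And>B. tight a b z B \<Longrightarrow> B = {}"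
  shows "represents a b z (insert (a, b) ((\<lambda>i. (i, i)) ` {i\<in>{a<..<b}. z i = 0}))"
  unfolding represents_def
proof (intro conjI allI impI ballI)
  fix B assume B: "B \<subseteq> {a<..<b}"
  have t: "tight a b z {}" by (simp add: tight_def)
  show "tight a b z B \<longleftrightarrow> comps a b B \<subseteq> insert (a, b) ((\<lambda>i. (i, i)) ` {i\<in>{a<..<b}. z i = 0})"
  proof (cases "B = {}")
    case True
    then show ?thesis using t assms(1) by (simp add: comps_empty)
  next
    case False
    have fin: "finite B" using B finite_subset by blast
    \<comment> \<open>The first piece of a nonempty \<open>B\<close> is proper and shorter than
      \<open>(a, b)\<close>, so it is missing from the code.\<close>
    have "(a, Min B) \<in> comps a b B"
      using B False Min_in[OF fin False] Min_le[OF fin] by (fastforce simp: comps_def)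
    moreover have "(a, Min B) \<noteq> (a, b)" "a \<noteq> Min B" using B Min_in[OF fin False] by auto
    ultimately show ?thesis using assms(2)[of B] False by blast
  qed
qed (use assms in auto)

text \<open>\<open>tight_blocks\<close> and \<open>comps_subset_node_iff\<close> are recursions of
  the same shape, which carries the correspondence over from the pieces to the whole.\<close>

lemma represents_node:
  assumes P: "feasible a b z" and M: "tight a b z M" "M \<noteq> {}" "\<And>B. tight a b z B \<Longrightarrow> B \<noteq> {} \<Longrightarrow> M \<subseteq> B"
    and D: "\<And>c d. (c, d) \<in> comps a b M \<Longrightarrow> adm c d (D c d)"
      "\<And>c d. (c, d) \<in> comps a b M \<Longrightarrow> represents c d z (D c d)"
  shows "represents a b z (insert (a, b) (\<Union>(c, d)\<in>comps a b M. D c d))" (is "represents a b z ?C")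
proof -
  have Ms: "M \<subseteq> {a<..<b}" using M by (auto simp: tight_def)
  have loc: "D c d \<subseteq> located c d" if "(c, d) \<in> comps a b M" for c d
    by (rule adm_located[OF D(1)[OF that]])
  have "tight a b z B \<longleftrightarrow> comps a b B \<subseteq> ?C" if B: "B \<subseteq> {a<..<b}" for B
  proof -
    have "tight a b z B \<longleftrightarrow> B = {} \<or> (M \<subseteq> B \<and> tight a b z B)"
      using M(3)[of B] by (auto simp: tight_def)
    also have "\<dots> \<longleftrightarrow> B = {} \<or> (M \<subseteq> B \<and> (\<forall>(c, d)\<in>comps a b M. tight c d z (B \<inter> {c<..<d})))"
      using tight_blocks[OF P M(1) _ B] by blast
    also have "\<dots> \<longleftrightarrow> B = {} \<or> (M \<subseteq> B \<and> (\<forall>(c, d)\<in>comps a b M. comps c d (B \<inter> {c<..<d}) \<subseteq> D c d))"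
    proof -
      have "tight c d z (B \<inter> {c<..<d}) \<longleftrightarrow> comps c d (B \<inter> {c<..<d}) \<subseteq> D c d" if "(c, d) \<in> comps a b M" for c d
        using D(2)[OF that] by (simp add: represents_def)
      then have "(\<forall>(c, d)\<in>comps a b M. tight c d z (B \<inter> {c<..<d})) \<longleftrightarrow>
          (\<forall>(c, d)\<in>comps a b M. comps c d (B \<inter> {c<..<d}) \<subseteq> D c d)"
      proof (intro ball_cong HOL.refl)
        fix p assume "p \<in> comps a b M" and
          eq: "\<And>c d. (c, d) \<in> comps a b M \<Longrightarrow> tight c d z (B \<inter> {c<..<d}) \<longleftrightarrow> comps c d (B \<inter> {c<..<d}) \<subseteq> D c d"
        then show "(case p of (c, d) \<Rightarrow> tight c d z (B \<inter> {c<..<d})) \<longleftrightarrow>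
            (case p of (c, d) \<Rightarrow> comps c d (B \<inter> {c<..<d}) \<subseteq> D c d)"
          by (cases p) simp
      qed
      then show ?thesis by simp
    qed
    also have "\<dots> \<longleftrightarrow> comps a b B \<subseteq> ?C"
      using comps_subset_node_iff[OF Ms M(2) B loc] by simp
    finally show ?thesis .
  qed
  moreover have "z i = 0 \<longleftrightarrow> (i, i) \<in> ?C" if i: "i \<in> {a<..<b}" for i
  proof (cases "i \<in> M")
    case True
    have "(i, i) \<notin> D c d" if "(c, d) \<in> comps a b M" for c d
    proof
      assume "(i, i) \<in> D c d"
      then have "c < i" "i < d" using loc[OF that] by (auto simp: located_def)
      then show False using that True by (auto simp: comps_def)
    qed
    moreover have "z i > 0" using tight_pos[OF P M(1) True] .
    ultimately show ?thesis using i by auto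
  next
    case False
    then have "(i, i) \<in> pairs a b" "(i, i) \<notin> hit M" using i by (auto simp: pairs_def hit_def)
    then obtain c d where cd: "(c, d) \<in> comps a b M" "c < i" "i < d"
      using comps_cover[OF Ms, of i i] by blast
    have "z i = 0 \<longleftrightarrow> (i, i) \<in> D c d" using D(2)[OF cd(1)] cd(2,3) by (simp add: represents_def)
    also have "\<dots> \<longleftrightarrow> (i, i) \<in> ?C"
    proof
      assume "(i, i) \<in> ?C"
      then obtain c' d' where c': "(c', d') \<in> comps a b M" "(i, i) \<in> D c' d'" using i by auto
      moreover have "(i, i) \<in> located c d" using cd by (auto simp: located_def)
      ultimately show "(i, i) \<in> D c d"
        using located_same_block[OF Ms cd(1) c'(1), of "(i, i)"] loc[OF c'(1)] by blast
    qed (use cd in blast)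
    finally show ?thesis .
  qed
  ultimately show ?thesis unfolding represents_def by blast
qed

text \<open>Recursion at the least nonempty tight set, which becomes the cut set of the lowest node;
  if there is none, only the vanishing coordinates are recorded.\<close>

lemma ex_code:
  "a < b \<Longrightarrow> feasible a b z \<Longrightarrow> \<exists>C. adm a b C \<and> represents a b z C"
proof (induction "b - a" arbitrary: a b rule: less_induct)
  case less
  show ?case
  proof (cases "\<exists>B. tight a b z B \<and> B \<noteq> {}")
    case False
    then have "represents a b z (insert (a, b) ((\<lambda>i. (i, i)) ` {i\<in>{a<..<b}. z i = 0}))"
      using less.prems by (intro represents_base) auto
    moreover have "adm a b (insert (a, b) ((\<lambda>i. (i, i)) ` {i\<in>{a<..<b}. z i = 0}))"
      using less.prems by (intro adm.base) auto
    ultimately show ?thesis by blast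
  next
    case True
    then obtain M where M: "tight a b z M" "M \<noteq> {}" "\<And>B. tight a b z B \<Longrightarrow> B \<noteq> {} \<Longrightarrow> M \<subseteq> B"
      using least_tight[OF less.prems(2)] by blast
    have Ms: "M \<subseteq> {a<..<b}" using M by (auto simp: tight_def)
    have "\<exists>C. adm c d C \<and> represents c d z C" if cd: "(c, d) \<in> comps a b M" for c d
    proof (rule less.hyps)
      have "(c, d) \<noteq> (a, b)" using cd Ms M(2) by (auto simp: comps_def)
      then show "d - c < b - a" using comps_bounds[OF Ms cd] by auto
      show "c < d" using comps_bounds[OF Ms cd] by simp
      show "feasible c d z" using feasible_block[OF less.prems(2) M(1) cd] .
    qed
    then obtain D where D: "\<And>c d. (c, d) \<in> comps a b M \<Longrightarrow> adm c d (D c d) \<and> represents c d z (D c d)"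
      by metis
    have "represents a b z (insert (a, b) (\<Union>(c, d)\<in>comps a b M. D c d))"
      using D by (intro represents_node[OF less.prems(2) M]) auto
    moreover have "adm a b (insert (a, b) (\<Union>(c, d)\<in>comps a b M. D c d))"
      using D Ms M(2) by (intro adm.node) auto
    ultimately show ?thesis by blast
  qed
qed

text \<open>Every pair met by \<open>M\<close> distributes a unit weight evenly over the elements of \<open>M\<close> in it.\<close>

lemma cut_weights:
  assumes M: "M \<subseteq> {a<..<b}" "M \<noteq> {}"
  obtains y :: "nat \<Rightarrow> real" where "\<And>i. 0 \<le> y i" "sum y M = coverage a b M"
    "\<And>B. sum y (B \<inter> M) \<le> card (pairs a b \<inter> hit B \<inter> hit M)"
    "\<And>B. B \<subseteq> {a<..<b} \<Longrightarrow> B \<noteq> {} \<Longrightarrow> \<not> M \<subseteq> B \<Longrightarrow> sum y (B \<inter> M) < card (pairs a b \<inter> hit B \<inter> hit M)"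
proof -
  define w where "w p = real (card (M \<inter> {fst p..snd p}))" for p :: "nat \<times> nat"
  define y where "y i = (\<Sum>p\<in>pairs a b. if i \<in> {fst p..snd p} then 1 / w p else 0)" for i
  have fin: "finite M" using M finite_subset by blast
  define g where "g B p = real (card (B \<inter> M \<inter> {fst p..snd p})) / w p" for B p
  have sum_y: "sum y (B \<inter> M) = (\<Sum>p\<in>pairs a b \<inter> hit B \<inter> hit M. g B p)" for B
  proof -
    have "sum y (B \<inter> M) = (\<Sum>p\<in>pairs a b. \<Sum>i\<in>B \<inter> M. if i \<in> {fst p..snd p} then 1 / w p else 0)"
      unfolding y_def by (rule sum.swap)
    also have "\<dots> = (\<Sum>p\<in>pairs a b. g B p)"
    proof (rule sum.cong[OF HOL.refl])
      have "(\<Sum>i\<in>A. if i \<in> S then k else 0) = real (card (A \<inter> S)) * k" if "finite A" for A S :: "nat set" and k :: real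
        using that by (simp add: sum.If_cases)
      from this[of "B \<inter> M"] show "(\<Sum>i\<in>B \<inter> M. if i \<in> {fst p..snd p} then 1 / w p else 0) = g B p" for p
        unfolding g_def using fin by (simp del: atLeastAtMost_iff)
    qed
    also have "\<dots> = (\<Sum>p\<in>pairs a b \<inter> hit B \<inter> hit M. g B p)"
    proof (rule sum.mono_neutral_right)
      show "\<forall>p\<in>pairs a b - pairs a b \<inter> hit B \<inter> hit M. g B p = 0"
      proof
        fix p assume "p \<in> pairs a b - pairs a b \<inter> hit B \<inter> hit M"
        then have "B \<inter> M \<inter> {fst p..snd p} = {}" by (cases p) (auto simp: hit_def)
        then show "g B p = 0" by (simp add: g_def)
      qed
    qed auto
    finally show ?thesis .
  qed
  have g_le: "g B p \<le> 1" for B p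
  proof -
    have "card (B \<inter> M \<inter> {fst p..snd p}) \<le> card (M \<inter> {fst p..snd p})"
      using fin by (intro card_mono) auto
    then show ?thesis by (simp add: g_def w_def divide_le_eq)
  qed
  have g_M: "g M p = 1" if "p \<in> hit M" for p
  proof -
    have "M \<inter> {fst p..snd p} \<noteq> {}" using that by (cases p) (auto simp: hit_def)
    then have "w p \<noteq> 0" using fin by (simp add: w_def)
    then show ?thesis by (simp add: g_def w_def)
  qed
  show ?thesis
  proof (rule that)
    show "0 \<le> y i" for i unfolding y_def w_def by (intro sum_nonneg) auto
    show "sum y M = coverage a b M"
      using sum_y[of M] g_M by (simp add: coverage_def Int_assoc)
    show "sum y (B \<inter> M) \<le> card (pairs a b \<inter> hit B \<inter> hit M)" for B
    proof -
      have "sum y (B \<inter> M) \<le> (\<Sum>p\<in>pairs a b \<inter> hit B \<inter> hit M. 1)"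
        unfolding sum_y using g_le by (intro sum_mono) auto
      then show ?thesis by simp
    qed
    show "sum y (B \<inter> M) < card (pairs a b \<inter> hit B \<inter> hit M)"
      if B: "B \<subseteq> {a<..<b}" "B \<noteq> {}" "\<not> M \<subseteq> B" for B
    proof -
      \<comment> \<open>The interval of all gaps meets \<open>B\<close> and contains the whole of
        \<open>M\<close>, so \<open>B\<close> misses a part of its weight; this makes the inequality
        strict.\<close>
      let ?p = "(Suc a, b - 1)"
      have all: "i \<in> {Suc a..b - 1}" if "i \<in> {a<..<b}" for i using that by auto
      have "?p \<in> pairs a b \<inter> hit B \<inter> hit M"
      proof -
        obtain i j where ij: "i \<in> B" "j \<in> M" using B(2) M(2) by blast
        then have "a < i" "i < b" "a < j" "j < b" using B(1) M(1) by auto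
        then show ?thesis using ij by (auto simp: pairs_def hit_def intro!: exI[of _ i] exI[of _ j])
      qed
      moreover have "g B ?p < 1"
      proof -
        have "M \<inter> {fst ?p..snd ?p} = M" "B \<inter> M \<inter> {fst ?p..snd ?p} = B \<inter> M" using M(1) all by auto
        moreover have "card (B \<inter> M) < card M" using fin B(3) by (intro psubset_card_mono) auto
        ultimately show ?thesis by (simp add: g_def w_def divide_less_eq)
      qed
      ultimately have "(\<Sum>p\<in>pairs a b \<inter> hit B \<inter> hit M. g B p) < (\<Sum>p\<in>pairs a b \<inter> hit B \<inter> hit M. 1)"
        using g_le by (intro sum_strict_mono_ex1) auto
      then show ?thesis unfolding sum_y by simp
    qed
  qed
qed

lemma feasible_cong: "(\<And>i. a < i \<Longrightarrow> i < b \<Longrightarrow> z i = z' i) \<Longrightarrow> feasible a b z \<longleftrightarrow> feasible a b z'"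
proof -
  assume *: "\<And>i. a < i \<Longrightarrow> i < b \<Longrightarrow> z i = z' i"
  have "sum z B = sum z' B" if "B \<subseteq> {a<..<b}" for B using * that by (intro sum.cong) auto
  then show ?thesis using * unfolding feasible_def by auto
qed

lemma represents_cong: "(\<And>i. a < i \<Longrightarrow> i < b \<Longrightarrow> z i = z' i) \<Longrightarrow> represents a b z C \<longleftrightarrow> represents a b z' C"
proof -
  assume *: "\<And>i. a < i \<Longrightarrow> i < b \<Longrightarrow> z i = z' i"
  have "sum z B = sum z' B" if "B \<subseteq> {a<..<b}" for B using * that by (intro sum.cong) auto
  then show ?thesis using * unfolding represents_def tight_def by auto
qed

lemma card_le_coverage: "B \<subseteq> {a<..<b} \<Longrightarrow> card B \<le> coverage a b B"
proof -
  assume B: "B \<subseteq> {a<..<b}"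
  have "card ((\<lambda>i. (i, i)) ` B) \<le> coverage a b B"
  proof (unfold coverage_def, rule card_mono)
    show "(\<lambda>i. (i, i)) ` B \<subseteq> pairs a b \<inter> hit B" using B by (auto simp: pairs_def hit_def)
  qed simp
  then show ?thesis by (simp add: card_image inj_on_def)
qed

text \<open>Converse of \<open>ex_code\<close>: every admissible code belongs to a point.\<close>

lemma ex_point: "adm a b C \<Longrightarrow> \<exists>z. feasible a b z \<and> represents a b z C"
proof (induction rule: adm.induct)
  case (base a b Z)
  \<comment> \<open>Already the one-gap intervals give \<open>card B \<le> coverage a b B\<close>,
    so the value 1/2 keeps all bounds of nonempty sets strict.\<close>
  define z where "z i = (if i \<in> Z then 0 else 1 / 2 :: real)" for i
  have le: "sum z B \<le> card B / 2" for B
    using sum_mono[of B z "\<lambda>_. 1 / 2"] by (simp add: z_def)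
  have "feasible a b z"
    unfolding feasible_def
  proof (intro conjI allI impI ballI)
    fix B assume "B \<subseteq> {a<..<b}"
    then show "sum z B \<le> coverage a b B" using le[of B] card_le_coverage[of B a b] by linarith
  qed (auto simp: z_def)
  moreover have "B = {}" if B: "tight a b z B" for B
  proof -
    have "B \<subseteq> {a<..<b}" "sum z B = coverage a b B" using B by (auto simp: tight_def)
    then have "card B = 0" using le[of B] card_le_coverage[of B a b] by linarith
    moreover have "finite B" using \<open>B \<subseteq> _\<close> finite_subset by blast
    ultimately show ?thesis by simp
  qed
  then have "represents a b z (insert (a, b) ((\<lambda>i. (i, i)) ` {i\<in>{a<..<b}. z i = 0}))"
    using base(1) by (intro represents_base)
  moreover have "{i\<in>{a<..<b}. z i = 0} = Z" using base(2) by (auto simp: z_def)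
  ultimately have "feasible a b z \<and> represents a b z (insert (a, b) ((\<lambda>i. (i, i)) ` Z))" by simp
  then show ?case by blast
next
  case (node M a b D)
  obtain y :: "nat \<Rightarrow> real" where y: "\<And>i. 0 \<le> y i" "sum y M = coverage a b M"
    "\<And>B. sum y (B \<inter> M) \<le> card (pairs a b \<inter> hit B \<inter> hit M)"
    "\<And>B. B \<subseteq> {a<..<b} \<Longrightarrow> B \<noteq> {} \<Longrightarrow> \<not> M \<subseteq> B \<Longrightarrow> sum y (B \<inter> M) < card (pairs a b \<inter> hit B \<inter> hit M)"
    by (rule cut_weights[OF node(1,2)]) (rule that)
  obtain w where w: "\<And>c d. (c, d) \<in> comps a b M \<Longrightarrow> feasible c d (w c d) \<and> represents c d (w c d) (D c d)"
    using node.IH by metis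
  define blk where "blk i = (SOME p. p \<in> comps a b M \<and> fst p < i \<and> i < snd p)" for i
  \<comment> \<open>On \<open>M\<close> the even distribution of weights makes \<open>M\<close>
    tight and no nonempty set that fails to contain \<open>M\<close>; in each piece the point given
    by induction is used.\<close>
  define z where "z i = (if i \<in> M then y i else w (fst (blk i)) (snd (blk i)) i)" for i
  have zw: "z i = w c d i" if cd: "(c, d) \<in> comps a b M" and i: "c < i" "i < d" for c d i
  proof -
    have "blk i \<in> comps a b M \<and> fst (blk i) < i \<and> i < snd (blk i)"
      unfolding blk_def by (rule someI[of _ "(c, d)"]) (use that in auto)
    then have "blk i = (c, d)"
      using comps_disjoint[OF node(1) cd, of "fst (blk i)" "snd (blk i)"] i by (cases "blk i") auto
    moreover have "i \<notin> M" using cd i by (auto simp: comps_def)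
    ultimately show ?thesis by (simp add: z_def)
  qed
  have Pz: "feasible c d z" and Rz: "represents c d z (D c d)" if "(c, d) \<in> comps a b M" for c d
    using w[OF that] feasible_cong[of c d z "w c d", OF zw[OF that]] represents_cong[of c d z "w c d", OF zw[OF that]] by simp_all
  have sum_z: "sum z B \<le> sum y (B \<inter> M) + card (pairs a b \<inter> hit B - hit M)" if B: "B \<subseteq> {a<..<b}" for B
  proof -
    have "sum z B = sum z (B \<inter> M) + (\<Sum>(c, d)\<in>comps a b M. sum z (B \<inter> {c<..<d}))"
      by (rule sum_comps[OF node(1) B])
    also have "sum z (B \<inter> M) = sum y (B \<inter> M)" by (intro sum.cong) (auto simp: z_def)
    also have "(\<Sum>(c, d)\<in>comps a b M. sum z (B \<inter> {c<..<d})) \<le> (\<Sum>(c, d)\<in>comps a b M. real (coverage c d (B \<inter> {c<..<d})))"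
    proof (rule sum_mono)
      fix p assume "p \<in> comps a b M"
      then show "(case p of (c, d) \<Rightarrow> sum z (B \<inter> {c<..<d})) \<le> (case p of (c, d) \<Rightarrow> real (coverage c d (B \<inter> {c<..<d})))"
        using Pz[of "fst p" "snd p"] by (cases p) (simp add: feasible_def)
    qed
    also have "\<dots> = card (pairs a b \<inter> hit B - hit M)"
      unfolding coverage_outside[OF node(1)] by (simp add: case_prod_beta')
    finally show ?thesis by simp
  qed
  have split: "real (coverage a b B) = card (pairs a b \<inter> hit B \<inter> hit M) + card (pairs a b \<inter> hit B - hit M)" for B
    unfolding coverage_def by (subst card_hit_split[of a b B M]) simp
  have P: "feasible a b z"
    unfolding feasible_def
  proof (intro conjI allI impI ballI)
    fix i assume i: "i \<in> {a<..<b}"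
    show "0 \<le> z i"
    proof (cases "i \<in> M")
      case False
      then have "(i, i) \<in> pairs a b" "(i, i) \<notin> hit M" using i by (auto simp: pairs_def hit_def)
      then obtain c d where cd: "(c, d) \<in> comps a b M" "c < i" "i < d"
        using comps_cover[OF node(1), of i i] by blast
      then show ?thesis using Pz[OF cd(1)] by (auto simp: feasible_def)
    qed (simp add: z_def y)
  next
    fix B assume "B \<subseteq> {a<..<b}"
    then show "sum z B \<le> coverage a b B" using sum_z[of B] y(3)[of B] split[of B] by linarith
  qed
  moreover have "represents a b z (insert (a, b) (\<Union>(c, d)\<in>comps a b M. D c d))"
  proof (rule represents_node[OF P _ node(2)])
    have "sum z M = sum y M" by (intro sum.cong) (auto simp: z_def)
    then show "tight a b z M" using y(2) node(1) by (simp add: tight_def)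
    show "M \<subseteq> B" if B: "tight a b z B" "B \<noteq> {}" for B
    proof (rule ccontr)
      assume "\<not> M \<subseteq> B"
      moreover have "B \<subseteq> {a<..<b}" "sum z B = coverage a b B" using B by (auto simp: tight_def)
      ultimately show False using y(4)[of B] B(2) sum_z[of B] split[of B] by linarith
    qed
    show "adm c d (D c d)" "represents c d z (D c d)" if "(c, d) \<in> comps a b M" for c d
      using node.hyps(3)[OF that] Rz[OF that] .
  qed
  ultimately show ?case by blast
qed

lemma comps_insert:
  assumes "a < m" "m < b" "M \<subseteq> {m<..<b}"
  shows "comps a b (insert m M) = insert (a, m) (comps m b M)"
proof (rule set_eqI)
  fix p :: "nat \<times> nat"
  obtain c d where p: "p = (c, d)" by (cases p)
  have M: "\<forall>i\<in>M. m < i \<and> i < b" using assms(3) by auto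
  show "p \<in> comps a b (insert m M) \<longleftrightarrow> p \<in> insert (a, m) (comps m b M)"
  proof
    assume "p \<in> comps a b (insert m M)"
    then have *: "c = a \<or> c = m \<or> c \<in> M" "d = b \<or> d = m \<or> d \<in> M" "c < d" "\<not> (c < m \<and> m < d)" "M \<inter> {c<..<d} = {}"
      using p by (auto simp: comps_def)
    show "p \<in> insert (a, m) (comps m b M)"
    proof (cases "c = a")
      case True
      then have "d = m" using * assms M by fastforce
      then show ?thesis using True p by simp
    next
      case False
      then have "d \<noteq> m" using * M by fastforce
      then show ?thesis using False * p by (auto simp: comps_def)
    qed
  next
    assume "p \<in> insert (a, m) (comps m b M)"
    then consider "p = (a, m)" | "p \<in> comps m b M" by blast
    then show "p \<in> comps a b (insert m M)"
    proof cases
      case 1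
      then show ?thesis using assms M by (fastforce simp: comps_def)
    next
      case 2
      then have "m \<le> c" using comps_bounds[OF assms(3), of c d] p by simp
      then show ?thesis using 2 p by (auto simp: comps_def)
    qed
  qed
qed

section \<open>Admissible codes are the codes of cells\<close>

text \<open>\<open>M\<close> consists of the boundaries between consecutive cells, so its pieces are
  the leaf sets of the cells.\<close>

lemma adm_ccodes:
  "cs \<noteq> [] \<Longrightarrow> are_cells cs \<Longrightarrow> \<forall>c\<in>set cs. \<forall>a. adm a (a + cell_size c) (ccode a c) \<Longrightarrow>
   b = a + total_size cs \<Longrightarrow>
   \<exists>M D. M \<subseteq> {a<..<b} \<and> (length cs \<ge> 2 \<longrightarrow> M \<noteq> {}) \<and> (\<forall>(c, d)\<in>comps a b M. adm c d (D c d)) \<and>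
     ccodes a cs = (\<Union>(c, d)\<in>comps a b M. D c d)"
proof (induction cs arbitrary: a)
  case (Cons c cs)
  have c: "cell_size c \<ge> 1" "adm a (a + cell_size c) (ccode a c)" using Cons.prems cell_size_pos by auto
  show ?case
  proof (cases "cs = []")
    case True
    then have b: "b = a + cell_size c" using Cons.prems by simp
    show ?thesis
      by (rule exI[of _ "{}"], rule exI[of _ "\<lambda>_ _. ccode a c"]) (use c b True in \<open>simp add: comps_empty\<close>)
  next
    case False
    let ?m = "a + cell_size c"
    obtain M D where M: "M \<subseteq> {?m<..<b}" "\<forall>(c, d)\<in>comps ?m b M. adm c d (D c d)"
      "ccodes ?m cs = (\<Union>(c, d)\<in>comps ?m b M. D c d)"
      using Cons.IH[of ?m] False Cons.prems by auto
    obtain c' where c': "c' \<in> set cs" using False by (cases cs) auto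
    then have "cell_size c' \<le> total_size cs" "cell_size c' \<ge> 1"
      using Cons.prems(2) cell_size_pos by (auto intro: member_le_sum_list)
    then have m: "a < ?m" "?m < b" using c Cons.prems(4) by auto
    let ?D = "\<lambda>x y. if x = a then ccode a c else D x y"
    have cm: "comps a b (insert ?m M) = insert (a, ?m) (comps ?m b M)"
      by (rule comps_insert[OF m M(1)])
    have neq: "x \<noteq> a" if "(x, y) \<in> comps ?m b M" for x y
      using comps_bounds[OF M(1) that] c by auto
    show ?thesis
    proof (intro exI conjI)
      show "insert ?m M \<subseteq> {a<..<b}" using M(1) m by auto
      show "2 \<le> length (c # cs) \<longrightarrow> insert ?m M \<noteq> {}" by simp
      show "\<forall>(x, y)\<in>comps a b (insert ?m M). adm x y (?D x y)"
        using M(2) c neq unfolding cm by auto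
      have "(\<Union>(x, y)\<in>comps a b (insert ?m M). ?D x y) = ccode a c \<union> (\<Union>(x, y)\<in>comps ?m b M. D x y)"
        unfolding cm using neq by auto
      then show "ccodes a (c # cs) = (\<Union>(x, y)\<in>comps a b (insert ?m M). ?D x y)"
        using M(3) by simp
    qed
  qed
qed auto

lemma adm_ccode_aux: "is_cell x \<Longrightarrow> cell_size x = n \<Longrightarrow> adm a (a + n) (ccode a x)"
proof (induction n arbitrary: x a rule: less_induct)
  case (less n)
  have n: "n \<ge> 1" using less.prems cell_size_pos by blast
  from normal_form[OF less.prems(1)] consider "flat x" | cs where "x \<doteq> join cs" by blast
  then show ?case
  proof cases
    case 1
    define Z where "Z = {i. (i, i) \<in> ccode a x}"
    have loc: "ccode a x \<subseteq> located a (a + n)" using ccode_located[OF less.prems(1)] less.prems(2) by simp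
    have "p \<in> insert (a, a + n) ((\<lambda>i. (i, i)) ` Z)" if p: "p \<in> ccode a x" for p
    proof -
      have "p \<in> (\<lambda>(c, d). (c + a, d + a)) ` ccode 0 x" using p ccode_shift[of 0 a x] by simp
      then obtain q where q: "q \<in> ccode 0 x" "p = (fst q + a, snd q + a)" by (auto simp: case_prod_beta')
      have "fst q = snd q \<or> q = (0, n)" using flat_code[OF 1 less.prems(1) q(1)] less.prems(2) by simp
      then show ?thesis
      proof
        assume "fst q = snd q"
        then have "p = (snd q + a, snd q + a)" using q(2) by simp
        then show ?thesis using p by (auto simp: Z_def)
      qed (use q in auto)
    qed
    moreover have "(a, a + n) \<in> ccode a x" using ccode_top[OF less.prems(1)] less.prems(2) by blast
    moreover have "(\<lambda>i. (i, i)) ` Z \<subseteq> ccode a x" by (auto simp: Z_def)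
    ultimately have "ccode a x = insert (a, a + n) ((\<lambda>i. (i, i)) ` Z)" by blast
    moreover have "Z \<subseteq> {a<..<a + n}" using loc by (auto simp: Z_def located_def)
    ultimately show ?thesis using n adm.base[of a "a + n" Z] by simp
  next
    case 2
    have j: "is_cell (join cs)" "cell_size (join cs) = n" "ccode a x = ccode a (join cs)"
      using same_cellD(2)[OF 2] same_cellD(3)[OF 2] same_cellD(4)[OF 2] less.prems(2) by simp_all
    have cs: "are_cells cs" "length cs \<ge> 2" using j(1) is_cell_join by blast+
    have sum: "a + n = a + total_size cs" using j(2) by (simp add: cell_size_join)
    have "\<forall>c\<in>set cs. \<forall>a. adm a (a + cell_size c) (ccode a c)"
    proof (intro ballI allI)
      fix c a assume "c \<in> set cs"
      then show "adm a (a + cell_size c) (ccode a c)"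
        using less.IH[of "cell_size c" c a] cell_size_split_less[OF j(1), of c] cs(1) j(2) by simp
    qed
    moreover have "cs \<noteq> []" using cs(2) by auto
    ultimately obtain M D where M: "M \<subseteq> {a<..<a + n}" "2 \<le> length cs \<longrightarrow> M \<noteq> {}" "\<forall>(c, d)\<in>comps a (a + n) M. adm c d (D c d)"
      "ccodes a cs = (\<Union>(c, d)\<in>comps a (a + n) M. D c d)"
      using adm_ccodes[OF _ cs(1) _ sum] by blast
    then have "M \<noteq> {}" using cs(2) by blast
    have "adm a (a + n) (insert (a, a + n) (\<Union>(c, d)\<in>comps a (a + n) M. D c d))"
      by (rule adm.node[OF M(1) \<open>M \<noteq> {}\<close>]) (use M(3) in blast)
    then show ?thesis unfolding j(3) ccode_join M(4) using sum by simp
  qed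
qed

lemma adm_ccode: "is_cell x \<Longrightarrow> adm a (a + cell_size x) (ccode a x)"
  using adm_ccode_aux by blast

section \<open>Every admissible code is the code of a cell\<close>

lemma ex_flat_cell:
  "a < b \<Longrightarrow> Z \<subseteq> {a<..<b} \<Longrightarrow>
   \<exists>x. is_cell x \<and> cell_size x = b - a \<and> ccode a x = insert (a, b) ((\<lambda>i. (i, i)) ` Z)"
proof (induction "card Z" arbitrary: b Z)
  case 0
  have "finite Z" using 0 finite_subset by blast
  then have "Z = {}" using 0 by simp
  then show ?case using 0 by (intro exI[of _ "Whole (b - a)"]) (simp add: is_cell_Whole)
next
  case (Suc m)
  have fin: "finite Z" "Z \<noteq> {}" using Suc.prems Suc.hyps(2) finite_subset by auto
  \<comment> \<open>With the largest gap outermost, \<open>bump k\<close> moves nothing but the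
    right end, from \<open>b - 1\<close> to \<open>b\<close>.\<close>
  define k where "k = Max Z"
  have k: "k \<in> Z" "\<And>i. i \<in> Z \<Longrightarrow> i \<le> k" using fin by (auto simp: k_def)
  then have ab: "a < k" "k < b" using Suc.prems by auto
  define Z' where "Z' = Z - {k}"
  have Z': "i < k \<and> a < i" if "i \<in> Z'" for i using that k(2)[of i] Suc.prems by (auto simp: Z'_def order.not_eq_order_implies_strict)
  have "card Z' = m" using Suc.hyps(2) fin k by (simp add: Z'_def)
  moreover have "Z' \<subseteq> {a<..<b - 1}" using Z' ab by fastforce
  moreover have "a < b - 1" using ab by simp
  ultimately obtain x where x: "is_cell x" "cell_size x = b - 1 - a" "ccode a x = insert (a, b - 1) ((\<lambda>i. (i, i)) ` Z')"
    using Suc.hyps(1)[of Z' "b - 1"] by blast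
  have "1 \<le> k - a" "k - a \<le> cell_size x" using x(2) ab by linarith+
  then have L: "is_cell (Lower (k - a) x)" using x(1) is_cell_Lower by blast
  have "ccode a (Lower (k - a) x) = insert (k, k) (map_prod (bump k) (bump k) ` ccode a x)"
    using ccode_Lower[OF L] ab by simp
  also have "map_prod (bump k) (bump k) ` ccode a x = insert (a, b) ((\<lambda>i. (i, i)) ` Z')"
  proof -
    have "map_prod (bump k) (bump k) ` (\<lambda>i. (i, i)) ` Z' = (\<lambda>i. (i, i)) ` Z'"
      unfolding image_image by (intro image_cong) (use Z' in \<open>auto simp: bump_def\<close>)
    moreover have "bump k a = a" "bump k (b - 1) = b" using ab by (auto simp: bump_def)
    ultimately show ?thesis unfolding x(3) by simp
  qed
  also have "insert (k, k) (insert (a, b) ((\<lambda>i. (i, i)) ` Z')) = insert (a, b) ((\<lambda>i. (i, i)) ` Z)"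
    using k(1) by (auto simp: Z'_def)
  finally have "ccode a (Lower (k - a) x) = insert (a, b) ((\<lambda>i. (i, i)) ` Z)" .
  moreover have "cell_size (Lower (k - a) x) = b - a" using cell_size_Lower[OF L] x(2) ab by simp
  ultimately show ?case using L by blast
qed

lemma ex_cell_list:
  "a < b \<Longrightarrow> M \<subseteq> {a<..<b} \<Longrightarrow>
   (\<And>c d. (c, d) \<in> comps a b M \<Longrightarrow> \<exists>x. is_cell x \<and> cell_size x = d - c \<and> ccode c x = D c d) \<Longrightarrow>
   \<exists>cs. (are_cells cs) \<and> length cs = Suc (card M) \<and> total_size cs = b - a \<and>
     ccodes a cs = (\<Union>(c, d)\<in>comps a b M. D c d)"
proof (induction "card M" arbitrary: a M)
  case 0
  have "finite M" using 0 finite_subset by blast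
  then have M: "M = {}" using 0 by simp
  then obtain x where "is_cell x" "cell_size x = b - a" "ccode a x = D a b"
    using 0(4)[of a b] 0(2) by (auto simp: comps_empty)
  then show ?case using M 0(2) by (intro exI[of _ "[x]"]) (simp add: comps_empty)
next
  case (Suc n)
  have fin: "finite M" "M \<noteq> {}" using finite_subset[OF Suc.prems(2)] Suc.hyps(2) by auto
  define m where "m = Min M"
  have m: "m \<in> M" "\<And>i. i \<in> M \<Longrightarrow> m \<le> i" using fin by (auto simp: m_def)
  then have ab: "a < m" "m < b" using Suc.prems by auto
  define M' where "M' = M - {m}"
  have M': "M' \<subseteq> {m<..<b}" using m(2) Suc.prems(2) by (force simp: M'_def)
  have M: "M = insert m M'" using m(1) by (auto simp: M'_def)
  have cm: "comps a b M = insert (a, m) (comps m b M')" unfolding M by (rule comps_insert[OF ab M'])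
  have card: "n = card M'" using Suc.hyps(2) fin m by (simp add: M'_def)
  obtain cs where cs: "are_cells cs" "length cs = Suc (card M')" "total_size cs = b - m"
    "ccodes m cs = (\<Union>(c, d)\<in>comps m b M'. D c d)"
    using Suc.hyps(1)[OF card ab(2) M'] Suc.prems(3) cm by auto
  obtain x where x: "is_cell x" "cell_size x = m - a" "ccode a x = D a m"
    using Suc.prems(3)[of a m] cm by auto
  have "ccodes a (x # cs) = (\<Union>(c, d)\<in>comps a b M. D c d)"
    using x ab cs(4) unfolding cm by simp
  then show ?case using x cs ab card Suc.hyps(2) by (intro exI[of _ "x # cs"]) auto
qed

lemma ex_cell: "adm a b C \<Longrightarrow> \<exists>x. is_cell x \<and> cell_size x = b - a \<and> ccode a x = C"
proof (induction rule: adm.induct)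
  case (base a b Z)
  then show ?case by (rule ex_flat_cell)
next
  case (node M a b D)
  have ab: "a < b" using node.hyps(1,2) by auto
  from ex_cell_list[OF ab node.hyps(1) node.IH] obtain cs where
    cs: "are_cells cs" "length cs = Suc (card M)" "total_size cs = b - a"
     "ccodes a cs = (\<Union>(c, d)\<in>comps a b M. D c d)" by blast
  have "finite M" using node.hyps(1) finite_subset by blast
  then have "card M \<ge> 1" using node.hyps(2) by (simp add: Suc_le_eq card_gt_0_iff)
  then have "is_cell (join cs)" unfolding is_cell_join using cs by simp
  moreover have "ccode a (join cs) = insert (a, b) (\<Union>(c, d)\<in>comps a b M. D c d)"
    unfolding ccode_join cs(3,4) using ab by simp
  ultimately show ?case using cs(3) cell_size_join by metis
qed

section \<open>Vertices\<close>

fun ubin :: "ptree \<Rightarrow> bool" where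
  "ubin Leaf \<longleftrightarrow> True"
| "ubin (Node p ts) \<longleftrightarrow> \<not> p \<and> length ts = 2 \<and> (\<forall>t\<in>set ts. ubin t)"

inductive pbin :: "ptree \<Rightarrow> bool" where
  single: "ubin u \<Longrightarrow> pbin (Node True [u])"
| pair: "pbin l \<Longrightarrow> pbin r \<Longrightarrow> pbin (Node True [l, r])"

lemma ubin_unpainted: "ubin t \<Longrightarrow> \<not> painted_edge t"
  by (cases t) auto

lemma pbin_painted: "pbin t \<Longrightarrow> painted_edge t"
  by (induction rule: pbin.induct) auto

lemma ubin_node_types: "ubin t \<Longrightarrow> v \<in> nodes t \<Longrightarrow> node_type 1 v"
proof (induction t)
  case (Node p ts)
  show ?case
  proof (cases "v = Node p ts")
    case True
    then show ?thesis using Node.prems(1) ubin_unpainted by (auto simp: node_type_1_iff)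
  qed (use Node in auto)
qed auto

lemma pbin_node_types: "pbin t \<Longrightarrow> v \<in> nodes t \<Longrightarrow> \<exists>k\<in>{1,2,3}. node_type k v"
proof (induction rule: pbin.induct)
  case (single u)
  have "node_type 3 (Node True [u])" using single(1) ubin_unpainted by (auto intro: node_type.intros)
  then show ?case using single ubin_node_types by fastforce
next
  case (pair l r)
  have "node_type 2 (Node True [l, r])" 
    using pbin_painted[OF pair(1)] pbin_painted[OF pair(2)] by (intro node_type.intros(2)) auto
  then show ?case using pair by auto
qed

lemma painted_binary_tree_if_pbin: "pbin t \<Longrightarrow> painted_binary_tree t"
  unfolding painted_binary_tree_def using pbin_painted pbin_node_types by blast

lemma ubin_if_node_types:
  "\<not> painted_edge t \<Longrightarrow> \<forall>v\<in>nodes t. \<exists>k\<in>{1,2,3}. node_type k v \<Longrightarrow> ubin t"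
proof (induction t)
  case (Node p ts)
  have "\<exists>k\<in>{1,2,3}. node_type k (Node p ts)" using Node.prems(2) by simp
  then have "length ts = 2" "\<forall>u\<in>set ts. \<not> painted_edge u"
    using Node.prems(1) by (auto simp: node_type.simps)
  then show ?case using Node by auto
qed auto

lemma pbin_if_node_types:
  "painted_edge t \<Longrightarrow> \<forall>v\<in>nodes t. \<exists>k\<in>{1,2,3}. node_type k v \<Longrightarrow> pbin t"
proof (induction t)
  case (Node p ts)
  have "\<exists>k\<in>{1,2,3}. node_type k (Node p ts)" using Node.prems(2) by simp
  then consider "length ts = 2" "\<forall>u\<in>set ts. painted_edge u" | "length ts = 1" "\<forall>u\<in>set ts. \<not> painted_edge u"
    using Node.prems(1) by (auto simp: node_type.simps)
  then show ?case
  proof cases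
    case 1
    then obtain l r where "ts = [l, r]" by (auto simp: length_Suc_conv numeral_2_eq_2)
    then show ?thesis using Node 1 by (auto intro!: pbin.pair)
  next
    case 2
    then obtain u where "ts = [u]" by (auto simp: length_Suc_conv)
    then show ?thesis using Node 2 ubin_if_node_types[of u] by (auto intro!: pbin.single)
  qed
qed auto

lemma painted_binary_tree_iff: "painted_binary_tree t \<longleftrightarrow> pbin t"
  using painted_binary_tree_if_pbin pbin_if_node_types unfolding painted_binary_tree_def by blast

lemma M0_coord_ubin: "ubin u \<Longrightarrow> M0_coord u i = 0"
proof -
  assume u: "ubin u"
  have "meet_node i u = Leaf \<or> (\<exists>ts. meet_node i u = Node False ts)" using u
  proof (induction i u rule: meet_node.induct)
    case (2 i p l r)
    then show ?case by (cases "i < leaves l"; cases "i = leaves l") auto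
  qed auto
  then show ?thesis
    by (auto simp: M0_coord_def node_type.simps split: ptree.splits list.splits)
qed

lemma M0_coord_single: "ubin u \<Longrightarrow> M0_coord (Node True [u]) i = 0"
  using M0_coord_ubin[of u i] by (simp add: M0_coord_def)

lemma M0_coord_pair:
  assumes "pbin l" "pbin r"
  shows "M0_coord (Node True [l, r]) i =
    (if i < leaves l then M0_coord l i else if i = leaves l then real (leaves l * leaves r)
     else M0_coord r (i - leaves l))"
proof -
  have "node_type 2 (Node True [l, r])"
    using pbin_painted[OF assms(1)] pbin_painted[OF assms(2)] by (intro node_type.intros(2)) auto
  then show ?thesis by (simp add: M0_coord_def)
qed

lemma ubin_leaves: "ubin t \<Longrightarrow> leaves t \<ge> 1"
proof (induction t)
  case (Node p ts)
  then obtain l r where ts: "ts = [l, r]" by (auto simp: length_Suc_conv numeral_2_eq_2)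
  then have "1 \<le> leaves l" using Node.IH[of l] Node.prems by simp
  then show ?case using ts by simp
qed auto

lemma pbin_leaves: "pbin t \<Longrightarrow> leaves t \<ge> 1"
proof (induction rule: pbin.induct)
  case (single u)
  then show ?case using ubin_leaves[of u] by simp
qed auto

lemma ex_ubin: "n \<ge> 1 \<Longrightarrow> \<exists>u. ubin u \<and> leaves u = n"
proof (induction n rule: nat_induct_at_least)
  case base
  show ?case by (intro exI[of _ Leaf]) simp
next
  case (Suc n)
  then obtain u where "ubin u" "leaves u = n" by blast
  then show ?case by (intro exI[of _ "Node False [Leaf, u]"]) simp
qed

text \<open>An interval through \<open>p\<close> is a free choice of a left end up to
  \<open>p\<close> and a right end from \<open>p\<close> on; this is where the products of leaf
  numbers come from.\<close>

lemma coverage_singleton: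
  assumes "a < p" "p < b"
  shows "coverage a b {p} = (p - a) * (b - p)"
proof -
  have "pairs a b \<inter> hit {p} = {a<..p} \<times> {p..<b}"
    using assms by (auto simp: pairs_def hit_def)
  then show ?thesis by (simp add: coverage_def card_cartesian_product)
qed

lemma comps_singleton: "a < p \<Longrightarrow> p < b \<Longrightarrow> comps a b {p} = {(a, p), (p, b)}"
  using comps_insert[of a p b "{}"] by (simp add: comps_empty)

text \<open>Cut at the gap \<open>?p\<close> of the root. Intervals that avoid \<open>?p\<close> are
  accounted for by the two subtrees, and if \<open>?p\<close> belongs to \<open>B\<close>, the root
  coordinate is exactly the number of intervals through \<open>?p\<close>.\<close>

lemma feasible_pbin: "pbin t \<Longrightarrow> feasible a (a + leaves t) (\<lambda>i. M0_coord t (i - a))"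
proof (induction arbitrary: a rule: pbin.induct)
  case (single u)
  then show ?case by (simp add: feasible_def M0_coord_single)
next
  case (pair l r)
  let ?p = "a + leaves l" and ?b = "a + leaves (Node True [l, r])"
  define z where "z i = M0_coord (Node True [l, r]) (i - a)" for i
  have lr: "leaves l \<ge> 1" "leaves r \<ge> 1" using pair pbin_leaves by auto
  have p: "a < ?p" "?p < ?b" using lr by auto
  have b: "?b = ?p + leaves r" by simp
  have L: "feasible a ?p z"
    using pair.IH(1)[of a] by (subst feasible_cong[of a ?p z]) (auto simp: z_def M0_coord_pair[OF pair(1,2)])
  have R: "feasible ?p ?b z"
  proof -
    have "z i = M0_coord r (i - ?p)" if "?p < i" for i
    proof -
      have "\<not> i - a < leaves l" "i - a \<noteq> leaves l" using that by linarith+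
      then show ?thesis by (simp add: z_def M0_coord_pair[OF pair(1,2)])
    qed
    then show ?thesis using pair.IH(2)[of ?p] b by (subst feasible_cong[of ?p ?b z "\<lambda>i. M0_coord r (i - ?p)"]) (simp_all add: add.assoc)
  qed
  have zp: "z ?p = coverage a ?b {?p}"
    using p by (subst coverage_singleton) (simp_all add: z_def M0_coord_pair[OF pair(1,2)])
  have "feasible a ?b z"
    unfolding feasible_def
  proof (intro conjI allI impI ballI)
    fix i assume i: "i \<in> {a<..<?b}"
    consider "i < ?p" | "i = ?p" | "?p < i" by linarith
    then show "0 \<le> z i"
      by cases (use i L R zp in \<open>auto simp: feasible_def\<close>)
  next
    fix B assume B: "B \<subseteq> {a<..<?b}"
    have pb: "{?p} \<subseteq> {a<..<?b}" using p by simp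
    have cm: "comps a ?b {?p} = {(a, ?p), (?p, ?b)}" "(a, ?p) \<noteq> (?p, ?b)" using comps_singleton[OF p] p by auto
    have s: "sum z B = sum z (B \<inter> {?p}) + (sum z (B \<inter> {a<..<?p}) + sum z (B \<inter> {?p<..<?b}))"
      using sum_comps[OF pb B, of z] cm by simp
    have o: "card (pairs a ?b \<inter> hit B - hit {?p}) = coverage a ?p (B \<inter> {a<..<?p}) + coverage ?p ?b (B \<inter> {?p<..<?b})"
      using coverage_outside[OF pb, of B] cm by simp
    have le: "sum z (B \<inter> {a<..<?p}) \<le> coverage a ?p (B \<inter> {a<..<?p})"
      "sum z (B \<inter> {?p<..<?b}) \<le> coverage ?p ?b (B \<inter> {?p<..<?b})"
      using L R unfolding feasible_def by auto
    have h: "coverage a ?b B = card (pairs a ?b \<inter> hit B \<inter> hit {?p}) + card (pairs a ?b \<inter> hit B - hit {?p})"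
      unfolding coverage_def by (rule card_hit_split)
    show "sum z B \<le> coverage a ?b B"
    proof (cases "?p \<in> B")
      case True
      then have "B \<inter> {?p} = {?p}" by auto
      moreover have "hit B \<inter> hit {?p} = hit {?p}" using True by (auto simp: hit_def)
      then have "card (pairs a ?b \<inter> hit B \<inter> hit {?p}) = coverage a ?b {?p}"
        by (simp add: coverage_def Int_assoc)
      ultimately show ?thesis using s o le h zp by simp
    next
      case False
      then have "B \<inter> {?p} = {}" by auto
      then show ?thesis using s o le h by simp
    qed
  qed
  then show ?case unfolding z_def .
qed

definition edge_direction :: "nat \<Rightarrow> nat \<Rightarrow> (nat \<Rightarrow> real) \<Rightarrow> (nat \<Rightarrow> real) \<Rightarrow> bool" where
  "edge_direction a b z v \<longleftrightarrow> (\<exists>i. v i \<noteq> 0) \<and> (\<forall>i. v i \<noteq> 0 \<longrightarrow> i \<in> {a<..<b} \<and> z i \<noteq> 0) \<and>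
     (\<forall>B. tight a b z B \<longrightarrow> sum v B = 0)"

text \<open>\<open>v\<close> vanishes outside the piece, and a nonempty tight set of the whole
  contains \<open>M\<close> and hence restricts to a tight set of the piece.\<close>

lemma edge_direction_block:
  assumes P: "feasible a b z" and M: "tight a b z M" "\<And>B. tight a b z B \<Longrightarrow> B \<noteq> {} \<Longrightarrow> M \<subseteq> B"
    and cd: "(c, d) \<in> comps a b M" and v: "edge_direction c d z v"
  shows "edge_direction a b z v"
proof -
  have Ms: "M \<subseteq> {a<..<b}" using M by (auto simp: tight_def)
  have sub: "{c<..<d} \<subseteq> {a<..<b}" using comps_bounds[OF Ms cd] by auto
  have "sum v B = 0" if B: "tight a b z B" for B
  proof (cases "B = {}")
    case False
    have Bs: "B \<subseteq> {a<..<b}" using B by (simp add: tight_def)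
    have "tight c d z (B \<inter> {c<..<d})"
      using tight_blocks[OF P M(1) M(2)[OF B False] Bs] B cd by blast
    then have "sum v (B \<inter> {c<..<d}) = 0" using v by (simp add: edge_direction_def)
    moreover have "sum v (B \<inter> {c<..<d}) = sum v B"
      using v finite_subset[OF Bs] by (intro sum.mono_neutral_left) (auto simp: edge_direction_def)
    ultimately show ?thesis by simp
  qed simp
  then show ?thesis using v sub unfolding edge_direction_def by blast
qed

text \<open>An edge direction keeps all active constraints active, so a point that has one is not a vertex.\<close>

lemma vertex_or_direction:
  "a < b \<Longrightarrow> feasible a b z \<Longrightarrow> (\<exists>v. edge_direction a b z v) \<or>
    (\<exists>t. pbin t \<and> leaves t = b - a \<and> (\<forall>i\<in>{a<..<b}. z i = M0_coord t (i - a)))"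
proof (induction "b - a" arbitrary: a b rule: less_induct)
  case less
  show ?case
  proof (cases "\<exists>B. tight a b z B \<and> B \<noteq> {}")
    case False
    show ?thesis
    proof (cases "\<exists>i\<in>{a<..<b}. z i \<noteq> 0")
      case True
      then obtain i where i: "i \<in> {a<..<b}" "z i \<noteq> 0" by blast
      \<comment> \<open>Without nonempty tight sets, a nonzero coordinate can be changed
        alone.\<close>
      have "edge_direction a b z (\<lambda>j. if j = i then 1 else 0)"
        unfolding edge_direction_def
      proof (intro conjI allI impI)
        show "\<exists>j. (if j = i then 1 else 0 :: real) \<noteq> 0" by (rule exI[of _ i]) simp
        show "sum (\<lambda>j. if j = i then 1 else 0) B = (0 :: real)" if "tight a b z B" for B
          using that False by auto
      qed (use i in \<open>auto split: if_splits\<close>)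
      then show ?thesis by blast
    next
      case zero: False
      \<comment> \<open>All coordinates vanish; a single type 3 node below any unpainted binary tree
        gives this point, so the shape of \<open>u\<close> is arbitrary.\<close>
      obtain u where u: "ubin u" "leaves u = b - a" 
      proof -
        have "1 \<le> b - a" using less.prems(1) by simp
        then show ?thesis using ex_ubin that by blast
      qed
      have "pbin (Node True [u])" "leaves (Node True [u]) = b - a" using u by (auto intro: pbin.single)
      moreover have "\<forall>i\<in>{a<..<b}. z i = M0_coord (Node True [u]) (i - a)"
        using zero M0_coord_single[OF u(1)] by simp
      ultimately show ?thesis by blast
    qed
  next
    case True
    then obtain M where M: "tight a b z M" "M \<noteq> {}" "\<And>B. tight a b z B \<Longrightarrow> B \<noteq> {} \<Longrightarrow> M \<subseteq> B"
      using least_tight[OF less.prems(2)] by blast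
    have Ms: "M \<subseteq> {a<..<b}" using M by (auto simp: tight_def)
    obtain p where p: "p \<in> M" using M(2) by blast
    then have ab: "a < p" "p < b" using Ms by auto
    show ?thesis
    proof (cases "M = {p}")
      case False
      then obtain q where q: "q \<in> M" "q \<noteq> p" using p by blast
      have pos: "z p \<noteq> 0" "z q \<noteq> 0" using tight_pos[OF less.prems(2) M(1)] p q by force+
      \<comment> \<open>Weight is moved from \<open>q\<close> to \<open>p\<close>; every nonempty
        tight set contains \<open>M\<close> and thus both, so its sum does not change.\<close>
      define v where "v j = (if j = p then 1 else 0) - (if j = q then 1 else 0 :: real)" for j
      have "edge_direction a b z v"
        unfolding edge_direction_def
      proof (intro conjI allI impI)
        show "\<exists>j. v j \<noteq> 0" by (rule exI[of _ p]) (use q in \<open>simp add: v_def\<close>)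
        show "j \<in> {a<..<b}" "z j \<noteq> 0" if "v j \<noteq> 0" for j
          using that p q pos Ms by (auto simp: v_def split: if_splits)
        show "sum v B = 0" if B: "tight a b z B" for B
        proof (cases "B = {}")
          case False
          then have "p \<in> B" "q \<in> B" using M(3)[OF B] p q by auto
          moreover have "finite B" using B finite_subset[of B "{a<..<b}"] by (simp add: tight_def)
          ultimately show ?thesis by (simp add: v_def sum_subtractf)
        qed simp
      qed
      then show ?thesis by blast
    next
      case True
      \<comment> \<open>A least tight set with one element \<open>p\<close> is the gap of the root;
        the two pieces supply its left and right subtrees, unless one of them has an edge
        direction.\<close>
      have cm: "(a, p) \<in> comps a b M" "(p, b) \<in> comps a b M"
        using comps_singleton[OF ab] True by auto
      have IHl: "(\<exists>v. edge_direction a p z v) \<or>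
         (\<exists>t. pbin t \<and> leaves t = p - a \<and> (\<forall>i\<in>{a<..<p}. z i = M0_coord t (i - a)))"
        using less.hyps[of p a] ab feasible_block[OF less.prems(2) M(1) cm(1)] by auto
      have IHr: "(\<exists>v. edge_direction p b z v) \<or>
         (\<exists>t. pbin t \<and> leaves t = b - p \<and> (\<forall>i\<in>{p<..<b}. z i = M0_coord t (i - p)))"
        using less.hyps[of b p] ab feasible_block[OF less.prems(2) M(1) cm(2)] by auto
      show ?thesis
      proof (cases "(\<exists>v. edge_direction a p z v) \<or> (\<exists>v. edge_direction p b z v)")
        case True
        then show ?thesis
          using edge_direction_block[OF less.prems(2) M(1,3) cm(1)] edge_direction_block[OF less.prems(2) M(1,3) cm(2)]
          by blast
      next
        case False
        then obtain l r where l: "pbin l" "leaves l = p - a" "\<forall>i\<in>{a<..<p}. z i = M0_coord l (i - a)"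
          and r: "pbin r" "leaves r = b - p" "\<forall>i\<in>{p<..<b}. z i = M0_coord r (i - p)"
          using IHl IHr by blast
        have "z p = coverage a b {p}" using M(1) \<open>M = {p}\<close> by (simp add: tight_def)
        then have zp: "z p = real ((p - a) * (b - p))" using coverage_singleton[OF ab] by simp
        have "z i = M0_coord (Node True [l, r]) (i - a)" if i: "i \<in> {a<..<b}" for i
        proof -
          consider "i < p" | "i = p" | "p < i" by linarith
          then show ?thesis
          proof cases
            case 1
            then have "i - a < p - a" using i by auto
            then show ?thesis using 1 l i r by (simp add: M0_coord_pair)
          next
            case 2
            then show ?thesis using zp l r by (simp add: M0_coord_pair)
          next
            case 3
            then have "\<not> i - a < p - a" "i - a \<noteq> p - a" "i - a - (p - a) = i - p" using ab by auto
            then show ?thesis using 3 l r i by (simp add: M0_coord_pair)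
          qed
        qed
        moreover have "pbin (Node True [l, r])" "leaves (Node True [l, r]) = b - a"
          using l r ab by (auto intro: pbin.pair)
        ultimately show ?thesis by blast
      qed
    qed
  qed
qed

section \<open>Constraints\<close>

text \<open>The inequalities of the polytope: \<open>Inl i\<close> stands for \<open>x\<^sub>i \<ge> 0\<close>, and \<open>Inr B\<close> for the bound
  on the sum of the coordinates in \<open>B\<close>.\<close>

type_synonym constraint = "nat + nat set"

definition constraints :: "nat \<Rightarrow> constraint set" where
  "constraints n = Inl ` {0<..<n} \<union> Inr ` Pow {0<..<n}"

fun slack :: "nat \<Rightarrow> (nat \<Rightarrow>\<^sub>0 real) \<Rightarrow> constraint \<Rightarrow> real" where
  "slack n x (Inl i) = Poly_Mapping.lookup x i"
| "slack n x (Inr B) = real (coverage 0 n B) - (\<Sum>i\<in>B. Poly_Mapping.lookup x i)"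

definition polymatroid :: "nat \<Rightarrow> (nat \<Rightarrow>\<^sub>0 real) set" where
  "polymatroid n = {x. Poly_Mapping.keys x \<subseteq> {0<..<n} \<and> (\<forall>j\<in>constraints n. 0 \<le> slack n x j)}"

definition active :: "nat \<Rightarrow> (nat \<Rightarrow>\<^sub>0 real) \<Rightarrow> constraint set" where
  "active n x = {j \<in> constraints n. slack n x j = 0}"

lemma finite_constraints [simp]: "finite (constraints n)"
  by (simp add: constraints_def)

lemma finite_active [simp]: "finite (active n x)"
  by (simp add: active_def)

lemma lookup_scaleR [simp]: "Poly_Mapping.lookup (c *\<^sub>R x) i = c * Poly_Mapping.lookup x i" for x :: "nat \<Rightarrow>\<^sub>0 real"
proof -
  have "finite {i. c *\<^sub>R Poly_Mapping.lookup x i \<noteq> 0}"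
    by (rule finite_subset[OF _ finite_lookup[of x]]) auto
  then show ?thesis unfolding scaleR_poly_mapping_def by simp
qed

lemma slack_affine:
  "u + v = 1 \<Longrightarrow> slack n (u *\<^sub>R x + v *\<^sub>R y) j = u * slack n x j + v * slack n y j"
proof (cases j)
  case (Inr B)
  assume "u + v = 1"
  then have "real (coverage 0 n B) = u * real (coverage 0 n B) + v * real (coverage 0 n B)"
    by (simp flip: distrib_right)
  then show ?thesis
    using Inr by (simp add: lookup_add sum.distrib algebra_simps sum_distrib_left)
qed (simp add: lookup_add)

lemma keys_combination: "Poly_Mapping.keys (u *\<^sub>R x + v *\<^sub>R y) \<subseteq> Poly_Mapping.keys x \<union> Poly_Mapping.keys y" for x y :: "nat \<Rightarrow>\<^sub>0 real"
  by (auto simp: in_keys_iff lookup_add)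

lemma polymatroid_iff: "x \<in> polymatroid n \<longleftrightarrow> Poly_Mapping.keys x \<subseteq> {0<..<n} \<and> feasible 0 n (Poly_Mapping.lookup x)"
  unfolding polymatroid_def feasible_def constraints_def by (auto simp: ball_Un)

lemma convex_polymatroid: "convex (polymatroid n)"
proof (rule convexI)
  fix x y :: "nat \<Rightarrow>\<^sub>0 real" and u v :: real
  assume *: "x \<in> polymatroid n" "y \<in> polymatroid n" "0 \<le> u" "0 \<le> v" "u + v = 1"
  then have "Poly_Mapping.keys (u *\<^sub>R x + v *\<^sub>R y) \<subseteq> {0<..<n}"
    using keys_combination[of u x v y] by (auto simp: polymatroid_def)
  moreover have "0 \<le> slack n (u *\<^sub>R x + v *\<^sub>R y) j" if "j \<in> constraints n" for j
    using * that by (simp add: slack_affine polymatroid_def)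
  ultimately show "u *\<^sub>R x + v *\<^sub>R y \<in> polymatroid n" by (simp add: polymatroid_def)
qed

lemma active_subset_iff:
  "active n x \<subseteq> active n y \<longleftrightarrow>
     (\<forall>B. tight 0 n (Poly_Mapping.lookup x) B \<longrightarrow> tight 0 n (Poly_Mapping.lookup y) B) \<and>
     (\<forall>i\<in>{0<..<n}. Poly_Mapping.lookup x i = 0 \<longrightarrow> Poly_Mapping.lookup y i = 0)"
proof -
  have "active n x \<subseteq> active n y \<longleftrightarrow> (\<forall>j\<in>constraints n. slack n x j = 0 \<longrightarrow> slack n y j = 0)"
    by (auto simp: active_def)
  also have "\<dots> \<longleftrightarrow> (\<forall>i\<in>{0<..<n}. Poly_Mapping.lookup x i = 0 \<longrightarrow> Poly_Mapping.lookup y i = 0) \<and>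
      (\<forall>B\<in>Pow {0<..<n}. slack n x (Inr B) = 0 \<longrightarrow> slack n y (Inr B) = 0)"
    unfolding constraints_def ball_Un by simp
  also have "(\<forall>B\<in>Pow {0<..<n}. slack n x (Inr B) = 0 \<longrightarrow> slack n y (Inr B) = 0) \<longleftrightarrow>
      (\<forall>B. tight 0 n (Poly_Mapping.lookup x) B \<longrightarrow> tight 0 n (Poly_Mapping.lookup y) B)"
    by (auto simp: tight_def)
  finally show ?thesis by blast
qed

section \<open>The hull is the polymatroid\<close>

text \<open>The ratio test of linear programming: \<open>e\<close> is the smallest quotient of slack
  and rate of decrease, and a constraint that attains it becomes active.\<close>

lemma max_step:
  fixes s r :: "'j \<Rightarrow> real"
  assumes J: "finite J" and s: "\<And>j. j \<in> J \<Longrightarrow> 0 \<le> s j" "\<And>j. j \<in> J \<Longrightarrow> s j = 0 \<Longrightarrow> r j \<le> 0"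
    and ex: "j0 \<in> J" "r j0 > 0"
  obtains e j where "e > 0" "\<And>j. j \<in> J \<Longrightarrow> e * r j \<le> s j" "j \<in> J" "s j \<noteq> 0" "e * r j = s j"
proof -
  let ?J = "{j\<in>J. r j > 0}"
  define e where "e = Min ((\<lambda>j. s j / r j) ` ?J)"
  have fin: "finite ((\<lambda>j. s j / r j) ` ?J)" "(\<lambda>j. s j / r j) ` ?J \<noteq> {}" using J ex by auto
  have pos: "s j > 0" if "j \<in> ?J" for j using s[of j] that by fastforce
  obtain j where j: "j \<in> ?J" "e = s j / r j" using Min_in[OF fin] unfolding e_def by auto
  have "e * r j \<le> s j" if "j \<in> J" for j
  proof (cases "r j > 0")
    case True
    then have "e \<le> s j / r j" unfolding e_def using fin(1) that by (intro Min_le) auto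
    then show ?thesis using True by (simp add: pos_le_divide_eq)
  next
    case False
    have "e > 0" using j pos[OF j(1)] by simp
    then have "e * r j \<le> 0" using False by (simp add: mult_le_0_iff)
    then show ?thesis using s(1)[OF that] by linarith
  qed
  moreover have "e > 0" "e * r j = s j" "s j \<noteq> 0" using j pos[OF j(1)] by auto
  ultimately show ?thesis using that j(1) by blast
qed

lemma M0_lookup: "Poly_Mapping.lookup (M0 t) i = (if i \<in> {1..<leaves t} then M0_coord t i else 0)"
proof -
  have "Poly_Mapping.lookup (M0 t) i = (\<Sum>j = 1..<leaves t. if j = i then M0_coord t j else 0)"
    by (simp add: M0_def lookup_sum lookup_single when_def)
  then show ?thesis by simp
qed

lemma M0_in_polymatroid:
  assumes "pbin t"
  shows "M0 t \<in> polymatroid (leaves t)"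
proof -
  have "feasible 0 (leaves t) (Poly_Mapping.lookup (M0 t))"
    using feasible_pbin[OF assms, of 0] by (subst feasible_cong[of 0 _ _ "\<lambda>i. M0_coord t (i - 0)"]) (auto simp: M0_lookup)
  moreover have "Poly_Mapping.keys (M0 t) \<subseteq> {0<..<leaves t}" by (auto simp: in_keys_iff M0_lookup split: if_splits)
  ultimately show ?thesis by (simp add: polymatroid_iff)
qed

text \<open>The speed at which the slack of a constraint decreases along \<open>v\<close>.\<close>

definition rate :: "(nat \<Rightarrow> real) \<Rightarrow> constraint \<Rightarrow> real" where
  "rate v j = (case j of Inl i \<Rightarrow> - v i | Inr B \<Rightarrow> sum v B)"

lemma push:
  assumes x: "x \<in> polymatroid n" and v: "edge_direction 0 n (Poly_Mapping.lookup x) v"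
  obtains e y where "e > 0" "y \<in> polymatroid n" "\<And>i. Poly_Mapping.lookup y i = Poly_Mapping.lookup x i + e * v i" "active n x \<subset> active n y"
proof -
  have supp: "finite {i. v i \<noteq> 0}"
    by (rule finite_subset[of _ "{0<..<n}"]) (use v in \<open>auto simp: edge_direction_def\<close>)
  have act: "rate v j = 0" if "j \<in> active n x" for j
    using that v by (cases j) (auto simp: active_def constraints_def rate_def edge_direction_def tight_def)
  obtain i where i: "v i \<noteq> 0" "i \<in> {0<..<n}" using v by (auto simp: edge_direction_def)
  \<comment> \<open>The motion is bounded: an increasing coordinate runs into the bound for
    \<open>{i}\<close>, a decreasing one into zero.\<close>
  have "\<exists>j0\<in>constraints n. rate v j0 > 0"
  proof (cases "v i > 0")
    case True
    then show ?thesis using i by (intro bexI[of _ "Inr {i}"]) (auto simp: rate_def constraints_def)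
  next
    case False
    then show ?thesis using i by (intro bexI[of _ "Inl i"]) (auto simp: rate_def constraints_def)
  qed
  then obtain j0 where j0: "j0 \<in> constraints n" "rate v j0 > 0" by blast
  have s: "0 \<le> slack n x j" if "j \<in> constraints n" for j using x that by (simp add: polymatroid_def)
  have r: "rate v j \<le> 0" if "j \<in> constraints n" "slack n x j = 0" for j
    using act[of j] that by (simp add: active_def)
  obtain e j where e: "e > 0" "\<And>j. j \<in> constraints n \<Longrightarrow> e * rate v j \<le> slack n x j" "j \<in> constraints n"
    "slack n x j \<noteq> 0" "e * rate v j = slack n x j"
    by (rule max_step[where s = "slack n x" and r = "rate v", OF finite_constraints s r j0]) (assumption | rule that)+
  define y where "y = x + e *\<^sub>R Abs_poly_mapping v"
  have y: "Poly_Mapping.lookup y i = Poly_Mapping.lookup x i + e * v i" for i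
    using supp by (simp add: y_def lookup_add)
  have sy: "slack n y j = slack n x j - e * rate v j" for j
    by (cases j) (simp_all add: y rate_def sum.distrib sum_distrib_left)
  have "y \<in> polymatroid n"
  proof -
    have "Poly_Mapping.keys y \<subseteq> {0<..<n}"
    proof
      fix i assume "i \<in> Poly_Mapping.keys y"
      then have "Poly_Mapping.lookup x i \<noteq> 0 \<or> v i \<noteq> 0" using e(1) by (auto simp: in_keys_iff y)
      then show "i \<in> {0<..<n}"
        using x v by (auto simp: polymatroid_def edge_direction_def in_keys_iff subset_iff)
    qed
    then show ?thesis using e(2) sy by (simp add: polymatroid_def)
  qed
  moreover have "active n x \<subseteq> active n y" using act sy by (auto simp: active_def)
  moreover have "j \<in> active n y" "j \<notin> active n x" using e sy by (auto simp: active_def)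
  ultimately show ?thesis using that e(1) y by blast
qed

text \<open>Induction on the number of inactive constraints: \<open>push\<close> along an edge
  direction and its opposite gives two points with more active constraints, and \<open>x\<close>
  lies between them.\<close>

lemma polymatroid_subset_hull:
  assumes "n \<ge> 1"
  shows "x \<in> polymatroid n \<Longrightarrow> x \<in> M0_hull n"
proof (induction "card (constraints n - active n x)" arbitrary: x rule: less_induct)
  case less
  have P: "feasible 0 n (Poly_Mapping.lookup x)" and "Poly_Mapping.keys x \<subseteq> {0<..<n}"
    using less.prems by (simp_all add: polymatroid_iff)
  have "0 < n" using assms by simp
  from vertex_or_direction[OF this P] consider v where "edge_direction 0 n (Poly_Mapping.lookup x) v"
    | t where "pbin t" "leaves t = n" "\<forall>i\<in>{0<..<n}. Poly_Mapping.lookup x i = M0_coord t i" by fastforce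
  then show ?case
  proof cases
    case (2 t)
    have "Poly_Mapping.lookup x i = Poly_Mapping.lookup (M0 t) i" for i
      using 2 \<open>Poly_Mapping.keys x \<subseteq> _\<close> by (cases "i \<in> {0<..<n}") (auto simp: M0_lookup in_keys_iff)
    then have "x = M0 t" by (rule poly_mapping_eqI)
    then show ?thesis using 2 unfolding M0_hull_def
      by (intro hull_inc) (auto simp: painted_binary_tree_iff)
  next
    case (1 v)
    have v': "edge_direction 0 n (Poly_Mapping.lookup x) (\<lambda>i. - v i)"
      using 1 by (auto simp: edge_direction_def sum_negf)
    obtain e y where y: "e > 0" "y \<in> polymatroid n" "\<And>i. Poly_Mapping.lookup y i = Poly_Mapping.lookup x i + e * v i" "active n x \<subset> active n y"
      by (rule push[OF less.prems 1]) (rule that)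
    obtain e' y' where y': "e' > 0" "y' \<in> polymatroid n" "\<And>i. Poly_Mapping.lookup y' i = Poly_Mapping.lookup x i + e' * - v i" "active n x \<subset> active n y'"
      by (rule push[OF less.prems v']) (rule that)
    have closer: "card (constraints n - active n z) < card (constraints n - active n x)"
      if "active n x \<subset> active n z" for z
    proof (rule psubset_card_mono)
      have "active n z \<subseteq> constraints n" by (auto simp: active_def)
      then show "constraints n - active n z \<subset> constraints n - active n x"
        using that by blast
    qed simp
    have "y \<in> M0_hull n" "y' \<in> M0_hull n"
      using less.hyps[OF closer[OF y(4)] y(2)] less.hyps[OF closer[OF y'(4)] y'(2)] by auto
    \<comment> \<open>Each end is weighted by the length of the step to the other, so that the
      displacements cancel.\<close>
    moreover have "x = (e' / (e + e')) *\<^sub>R y + (e / (e + e')) *\<^sub>R y'"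
    proof (rule poly_mapping_eqI)
      fix i
      have "e + e' \<noteq> 0" using y(1) y'(1) by linarith
      then show "Poly_Mapping.lookup x i = Poly_Mapping.lookup ((e' / (e + e')) *\<^sub>R y + (e / (e + e')) *\<^sub>R y') i"
      proof -
        let ?X = "Poly_Mapping.lookup x i"
        have "e' * (?X + e * v i) + e * (?X + e' * - v i) = (e + e') * ?X" by (simp add: algebra_simps)
        then have "(e' * (?X + e * v i) + e * (?X + e' * - v i)) / (e + e') = ?X"
          using \<open>e + e' \<noteq> 0\<close> by simp
        then show ?thesis by (simp add: lookup_add y(3) y'(3) add_divide_distrib)
      qed
    qed
    moreover have "e' / (e + e') + e / (e + e') = 1" "e' / (e + e') \<ge> 0" "e / (e + e') \<ge> 0"
      using y(1) y'(1) by (auto simp flip: add_divide_distrib)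
    ultimately show ?thesis
      using convexD[of "M0_hull n" y y' "e' / (e + e')" "e / (e + e')"] by (simp add: M0_hull_def)
  qed
qed

lemma M0_hull_eq:
  assumes "n \<ge> 1"
  shows "M0_hull n = polymatroid n"
proof
  show "M0_hull n \<subseteq> polymatroid n"
    unfolding M0_hull_def
    by (rule hull_minimal) (auto simp: painted_binary_tree_iff M0_in_polymatroid convex_polymatroid)
  show "polymatroid n \<subseteq> M0_hull n" using polymatroid_subset_hull[OF assms] by blast
qed

section \<open>Faces\<close>

text \<open>For \<open>z\<close> in the polymatroid this is the smallest face containing
  \<open>z\<close>.\<close>

definition minimal_face :: "nat \<Rightarrow> (nat \<Rightarrow>\<^sub>0 real) \<Rightarrow> (nat \<Rightarrow>\<^sub>0 real) set" where
  "minimal_face n z = {y \<in> polymatroid n. active n z \<subseteq> active n y}"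

text \<open>Slacks are affine and nonnegative, so one that vanishes inside a segment vanishes at
  both ends.\<close>

lemma minimal_face_face:
  assumes "z \<in> polymatroid n"
  shows "minimal_face n z face_of polymatroid n" "z \<in> minimal_face n z"
proof -
  have conv: "slack n x j = 0 \<and> slack n y j = 0"
    if "x \<in> polymatroid n" "y \<in> polymatroid n" "j \<in> constraints n" "0 < u" "u < 1"
      "slack n ((1 - u) *\<^sub>R x + u *\<^sub>R y) j = 0" for x y j u
  proof -
    have "(1 - u) * slack n x j + u * slack n y j = 0" using that(6) by (simp add: slack_affine)
    moreover have "0 \<le> slack n x j" "0 \<le> slack n y j" using that by (auto simp: polymatroid_def)
    ultimately have "(1 - u) * slack n x j = 0" "u * slack n y j = 0"
      using that(4,5) by (simp_all add: add_nonneg_eq_0_iff)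
    then show ?thesis using that(4,5) by simp
  qed
  show "minimal_face n z face_of polymatroid n"
    unfolding face_of_def
  proof (intro conjI ballI impI)
    show "minimal_face n z \<subseteq> polymatroid n" by (auto simp: minimal_face_def)
    show "convex (minimal_face n z)"
    proof (rule convexI)
      fix x y :: "nat \<Rightarrow>\<^sub>0 real" and u v :: real
      assume *: "x \<in> minimal_face n z" "y \<in> minimal_face n z" "0 \<le> u" "0 \<le> v" "u + v = 1"
      then have "u *\<^sub>R x + v *\<^sub>R y \<in> polymatroid n"
        using convexD[OF convex_polymatroid, of x n y u v] by (simp add: minimal_face_def)
      moreover have "active n z \<subseteq> active n (u *\<^sub>R x + v *\<^sub>R y)"
      proof
        fix j assume "j \<in> active n z"
        then have "j \<in> active n x" "j \<in> active n y" using *(1,2) by (auto simp: minimal_face_def)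
        then show "j \<in> active n (u *\<^sub>R x + v *\<^sub>R y)"
          using slack_affine[OF *(5), of n x y j] by (simp add: active_def)
      qed
      ultimately show "u *\<^sub>R x + v *\<^sub>R y \<in> minimal_face n z" by (simp add: minimal_face_def)
    qed
    fix x y w assume *: "x \<in> polymatroid n" "y \<in> polymatroid n" "w \<in> minimal_face n z" "w \<in> open_segment x y"
    then obtain u where u: "0 < u" "u < 1" "w = (1 - u) *\<^sub>R x + u *\<^sub>R y" by (auto simp: in_segment)
    have "j \<in> active n x \<and> j \<in> active n y" if "j \<in> active n z" for j
    proof -
      have "j \<in> active n w" using that *(3) by (auto simp: minimal_face_def)
      then show ?thesis using conv[OF *(1,2) _ u(1,2), of j] u(3) by (simp add: active_def)
    qed
    then show "x \<in> minimal_face n z" "y \<in> minimal_face n z"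
      using *(1,2) unfolding minimal_face_def by blast+
  qed
  show "z \<in> minimal_face n z" using assms by (simp add: minimal_face_def)
qed

text \<open>A point \<open>z\<close> of \<open>F\<close> with the fewest active constraints plays
  the role of a relative interior point.\<close>

lemma face_is_minimal_face:
  assumes F: "F face_of polymatroid n" "F \<noteq> {}"
  obtains z where "z \<in> polymatroid n" "F = minimal_face n z"
proof -
  have FP: "F \<subseteq> polymatroid n" "convex F" using F(1) by (auto simp: face_of_def)
  define z where "z = arg_min (\<lambda>z. card (active n z)) (\<lambda>z. z \<in> F)"
  obtain x0 where x0: "x0 \<in> F" using F(2) by blast
  have z: "z \<in> F" "\<And>x. x \<in> F \<Longrightarrow> card (active n z) \<le> card (active n x)"
    unfolding z_def by (rule arg_min_natI[of _ x0], rule x0) (rule arg_min_nat_le)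
  have zP: "z \<in> polymatroid n" using z(1) FP by blast
  have sub: "active n z \<subseteq> active n x" if x: "x \<in> F" for x
  proof -
    \<comment> \<open>The midpoint has exactly the common active constraints, so by minimality those
      of \<open>z\<close> are active on all of \<open>F\<close>.\<close>
    let ?m = "(1 / 2) *\<^sub>R z + (1 / 2) *\<^sub>R x"
    have m: "?m \<in> F" using convexD[OF FP(2) z(1) x, of "1 / 2" "1 / 2"] by simp
    have "active n ?m = active n z \<inter> active n x"
    proof -
      have "slack n ?m j = 0 \<longleftrightarrow> slack n z j = 0 \<and> slack n x j = 0" if "j \<in> constraints n" for j
      proof -
        have "slack n ?m j = 1 / 2 * slack n z j + 1 / 2 * slack n x j" by (rule slack_affine) simp
        moreover have "0 \<le> slack n z j" "0 \<le> slack n x j" using FP(1) z(1) x that by (auto simp: polymatroid_def)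
        ultimately show ?thesis by linarith
      qed
      then show ?thesis by (auto simp: active_def)
    qed
    then have "card (active n z) \<le> card (active n z \<inter> active n x)" using z(2)[OF m] by simp
    then have "active n z \<inter> active n x = active n z" by (intro card_seteq) auto
    then show ?thesis by blast
  qed
  have "y \<in> F" if y: "y \<in> polymatroid n" "active n z \<subseteq> active n y" for y
  proof (cases "y = z")
    case False
    define r where "r j = slack n y j - slack n z j" for j
    have s: "0 \<le> slack n z j" if "j \<in> constraints n" for j using zP that by (simp add: polymatroid_def)
    have r0: "r j \<le> 0" if "j \<in> constraints n" "slack n z j = 0" for j
      using y(2) that by (auto simp: r_def active_def)
    have "\<exists>e>0. \<forall>j\<in>constraints n. e * r j \<le> slack n z j"
    proof (cases "\<exists>j0\<in>constraints n. r j0 > 0")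
      case True
      then obtain j0 where j0: "j0 \<in> constraints n" "r j0 > 0" by blast
      show ?thesis
        by (rule max_step[where s = "slack n z" and r = r, OF finite_constraints s r0 j0]) (assumption | blast)+
    next
      case False
      then have "1 * r j \<le> slack n z j" if "j \<in> constraints n" for j using s[OF that] that by force
      then show ?thesis by (intro exI[of _ 1]) simp
    qed
    then obtain e where e: "e > 0" "\<And>j. j \<in> constraints n \<Longrightarrow> e * r j \<le> slack n z j" by blast
    \<comment> \<open>The segment from \<open>y\<close> is prolonged a little beyond
      \<open>z\<close>, which is possible because every constraint active at \<open>z\<close> is
      active at \<open>y\<close>. Then \<open>z\<close> is interior to the segment from
      \<open>y\<close> to \<open>w\<close>, and the face property puts \<open>y\<close> into
      \<open>F\<close>.\<close>
    define w where "w = (1 + e) *\<^sub>R z + (- e) *\<^sub>R y"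
    have "w \<in> polymatroid n"
    proof -
      have "Poly_Mapping.keys w \<subseteq> {0<..<n}"
        using keys_combination[of "1 + e" z "- e" y] zP y(1) unfolding w_def polymatroid_def by blast
      moreover have "0 \<le> slack n w j" if "j \<in> constraints n" for j
      proof -
        have "slack n w j = (1 + e) * slack n z j + (- e) * slack n y j"
          unfolding w_def by (rule slack_affine) simp
        then show ?thesis using e(2)[OF that] by (simp add: r_def algebra_simps)
      qed
      ultimately show ?thesis by (simp add: polymatroid_def)
    qed
    moreover have "z \<in> open_segment y w"
    proof -
      have w: "w = z + e *\<^sub>R (z - y)" by (simp add: w_def algebra_simps)
      have "z = (1 - 1 / (1 + e)) *\<^sub>R y + (1 / (1 + e)) *\<^sub>R w"
      proof (rule poly_mapping_eqI)
        fix i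
        let ?Y = "Poly_Mapping.lookup y i" and ?Z = "Poly_Mapping.lookup z i"
        have c: "1 - 1 / (1 + e) = e / (1 + e)" using e(1) by (simp add: field_simps)
        let ?W = "Poly_Mapping.lookup w i"
        have W: "?W = (1 + e) * ?Z + - e * ?Y" unfolding w_def by (simp only: lookup_add lookup_scaleR)
        have "e / (1 + e) * ?Y + 1 / (1 + e) * ?W = (e * ?Y + ?W) / (1 + e)"
          by (simp add: add_divide_distrib)
        also have "e * ?Y + ?W = (1 + e) * ?Z" unfolding W by simp
        also have "(1 + e) * ?Z / (1 + e) = ?Z" using e(1) by simp
        finally show "?Z = Poly_Mapping.lookup ((1 - 1 / (1 + e)) *\<^sub>R y + (1 / (1 + e)) *\<^sub>R w) i"
          unfolding c by (simp only: lookup_add lookup_scaleR)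
      qed
      moreover have "y \<noteq> w"
      proof
        assume "y = w"
        then have "(1 + e) *\<^sub>R (z - y) = 0" unfolding w by (simp add: algebra_simps)
        then show False using e(1) False by simp
      qed
      moreover have "0 < 1 / (1 + e)" "1 / (1 + e) < 1" using e(1) by auto
      ultimately show ?thesis unfolding in_segment by blast
    qed
    ultimately show ?thesis using F(1) y(1) z(1) unfolding face_of_def by blast
  qed (use z in simp)
  then have "F = minimal_face n z" using FP sub by (auto simp: minimal_face_def)
  then show ?thesis using that zP by blast
qed

section \<open>The isomorphism\<close>

definition code_of :: "nat \<Rightarrow> (nat \<Rightarrow>\<^sub>0 real) \<Rightarrow> (nat \<times> nat) set" where
  "code_of n x = (SOME C. adm 0 n C \<and> represents 0 n (Poly_Mapping.lookup x) C)"

lemma code_of: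
  assumes "n \<ge> 1" "x \<in> polymatroid n"
  shows "adm 0 n (code_of n x)" "represents 0 n (Poly_Mapping.lookup x) (code_of n x)"
proof -
  have "\<exists>C. adm 0 n C \<and> represents 0 n (Poly_Mapping.lookup x) C"
    using assms by (intro ex_code) (auto simp: polymatroid_iff)
  from someI_ex[OF this] show "adm 0 n (code_of n x)" "represents 0 n (Poly_Mapping.lookup x) (code_of n x)"
    unfolding code_of_def by auto
qed

lemma code_of_subset_iff:
  assumes "n \<ge> 1" "x \<in> polymatroid n" "y \<in> polymatroid n"
  shows "code_of n x \<subseteq> code_of n y \<longleftrightarrow> active n x \<subseteq> active n y"
  using represents_subset_iff[OF code_of(1)[OF assms(1,2)] code_of(2)[OF assms(1,2)] code_of(2)[OF assms(1,3)]]
  by (simp add: active_subset_iff)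

lemma minimal_face_subset_iff:
  assumes "n \<ge> 1" "x \<in> polymatroid n" "y \<in> polymatroid n"
  shows "minimal_face n x \<subseteq> minimal_face n y \<longleftrightarrow> code_of n y \<subseteq> code_of n x"
  unfolding code_of_subset_iff[OF assms(1,3,2)]
  using minimal_face_face(2)[OF assms(2)] by (auto simp: minimal_face_def)

lemma ex_point_code_of:
  assumes "n \<ge> 1" "adm 0 n C"
  obtains x where "x \<in> polymatroid n" "code_of n x = C"
proof -
  obtain z where z: "feasible 0 n z" "represents 0 n z C" using ex_point[OF assms(2)] by blast
  \<comment> \<open>\<open>feasible\<close> and \<open>represents\<close> only look at the gaps; the
    other coordinates are set to zero to get finite support inside \<open>{0<..<n}\<close>.\<close>
  define v where "v i = (if i \<in> {0<..<n} then z i else 0)" for i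
  have fin: "finite {i. v i \<noteq> 0}"
    by (rule finite_subset[of _ "{0<..<n}"]) (auto simp: v_def)
  define x where "x = Abs_poly_mapping v"
  have x: "Poly_Mapping.lookup x = v" using fin by (simp add: x_def)
  have "feasible 0 n v" "represents 0 n v C"
    using z feasible_cong[of 0 n v z] represents_cong[of 0 n v z] by (simp_all add: v_def)
  moreover from this have P: "x \<in> polymatroid n"
    by (auto simp: polymatroid_iff x in_keys_iff v_def split: if_splits)
  ultimately have "C \<subseteq> code_of n x" "code_of n x \<subseteq> C"
    using represents_subset_iff[OF assms(2) _ code_of(2)[OF assms(1) P], of v]
      represents_subset_iff[OF code_of[OF assms(1) P], of v C] x by auto
  then show ?thesis using that P by blast
qed

section \<open>Cells of the complex as codes\<close>

definition cells_of_code :: "nat \<Rightarrow> (nat \<times> nat) set \<Rightarrow> cell set" where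
  "cells_of_code n C = {x. ck_cell n x \<and> ccode 0 x = C}"

text \<open>The code is a complete invariant of the identifications: \<open>glued_invariant\<close>
  gives one direction, the normal forms the other.\<close>

lemma glued_iff: "glued n x y \<longleftrightarrow> ck_cell n x \<and> ck_cell n y \<and> ccode 0 x = ccode 0 y"
proof
  assume "glued n x y"
  from glued_invariant[OF this] show "ck_cell n x \<and> ck_cell n y \<and> ccode 0 x = ccode 0 y"
    by (auto simp: ck_cell_iff)
next
  assume "ck_cell n x \<and> ck_cell n y \<and> ccode 0 x = ccode 0 y"
  then show "glued n x y"
    using same_cell_if_code_eq[of x y] by (simp add: ck_cell_iff same_cell_def)
qed

lemma ex_cell_code: "adm 0 n C \<Longrightarrow> \<exists>x. ck_cell n x \<and> ccode 0 x = C"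
  using ex_cell[of 0 n C] by (auto simp: ck_cell_iff)

lemma composihedron_cells_eq: "composihedron_cells n = cells_of_code n ` {C. adm 0 n C}"
proof -
  have class_eq: "{(x, y). glued n x y} `` {x} = cells_of_code n (ccode 0 x)" if "ck_cell n x" for x
    using that by (auto simp: glued_iff cells_of_code_def)
  have "ccode 0 x \<in> {C. adm 0 n C}" if "ck_cell n x" for x
    using that adm_ccode[of x 0] by (simp add: ck_cell_iff)
  moreover have "\<exists>x. ck_cell n x \<and> ccode 0 x = C" if "adm 0 n C" for C
    using ex_cell_code[OF that] .
  ultimately have codes: "{C. adm 0 n C} = ccode 0 ` {x. ck_cell n x}" by blast
  show ?thesis
    unfolding composihedron_cells_def quotient_def codes image_image using class_eq by auto
qed

lemma cells_of_code_le_iff: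
  assumes "adm 0 n C" "adm 0 n D"
  shows "composihedron_le (cells_of_code n C) (cells_of_code n D) \<longleftrightarrow> D \<subseteq> C"
proof
  assume "composihedron_le (cells_of_code n C) (cells_of_code n D)"
  then obtain x y where "ck_cell n x" "ck_cell n y" "ccode 0 x = C" "ccode 0 y = D" "cell_face x y"
    by (auto simp: composihedron_le_def cells_of_code_def)
  then show "D \<subseteq> C" using cell_face_code[of x y] by (auto simp: ck_cell_iff)
next
  assume DC: "D \<subseteq> C"
  obtain x y where x: "ck_cell n x" "ccode 0 x = C" and y: "ck_cell n y" "ccode 0 y = D"
    using ex_cell_code assms by blast
  have "refines x y" "is_cell y" using x y DC by (auto simp: refines_def ck_cell_iff)
  from faces_if_refines[OF this] obtain x' y' where f: "x \<doteq> x'" "y \<doteq> y'" "cell_face x' y'" by blast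
  have "glued n x x'" "glued n y y'" using f(1,2) x(1) y(1) by (auto simp: same_cell_def ck_cell_iff)
  then have "x' \<in> cells_of_code n C" "y' \<in> cells_of_code n D"
    using x y by (auto simp: glued_iff cells_of_code_def)
  then show "composihedron_le (cells_of_code n C) (cells_of_code n D)"
    using f(3) unfolding composihedron_le_def by blast
qed

lemma inj_on_cells_of_code: "inj_on (cells_of_code n) {C. adm 0 n C}"
proof (rule inj_onI)
  fix C D assume *: "C \<in> {C. adm 0 n C}" "D \<in> {C. adm 0 n C}" "cells_of_code n C = cells_of_code n D"
  then obtain x where "ck_cell n x" "ccode 0 x = C" using ex_cell_code by blast
  then have "x \<in> cells_of_code n D" using *(3) by (auto simp: cells_of_code_def)
  then show "C = D" using \<open>ccode 0 x = C\<close> by (simp add: cells_of_code_def)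
qed

theorem theorem5p2:
  fixes n :: nat
  assumes "n \<ge> 1"
  shows "poset_isomorphic (polytope_faces (M0_hull n)) (\<subseteq>)
           (composihedron_cells n) composihedron_le"
proof -
  let ?A = "polytope_faces (M0_hull n)"
  \<comment> \<open>\<open>pt F\<close> is a point whose minimal face is \<open>F\<close>, so its
    code depends on the face only.\<close>
  define pt where "pt F = (SOME z. z \<in> polymatroid n \<and> F = minimal_face n z)" for F
  have pt: "pt F \<in> polymatroid n" "F = minimal_face n (pt F)" if "F \<in> ?A" for F
  proof -
    have "F face_of polymatroid n" "F \<noteq> {}"
      using that by (auto simp: polytope_faces_def M0_hull_eq[OF assms])
    then have "\<exists>z. z \<in> polymatroid n \<and> F = minimal_face n z"
      by (rule face_is_minimal_face) blast
    from someI_ex[OF this] show "pt F \<in> polymatroid n" "F = minimal_face n (pt F)"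
      unfolding pt_def by blast+
  qed
  define c where "c F = code_of n (pt F)" for F
  have adm_c: "adm 0 n (c F)" if "F \<in> ?A" for F
    unfolding c_def using code_of(1)[OF assms pt(1)[OF that]] .
  have le: "F \<subseteq> G \<longleftrightarrow> c G \<subseteq> c F" if "F \<in> ?A" "G \<in> ?A" for F G
    unfolding c_def minimal_face_subset_iff[OF assms pt(1)[OF that(1)] pt(1)[OF that(2)], symmetric]
    using pt(2)[OF that(1)] pt(2)[OF that(2)] by simp
  have bij_c: "bij_betw c ?A {C. adm 0 n C}"
  proof (rule bij_betw_imageI)
    show "inj_on c ?A"
    proof (rule inj_onI)
      fix F G assume "F \<in> ?A" "G \<in> ?A" "c F = c G"
      then show "F = G" using le[of F G] le[of G F] by blast
    qed
    have "\<exists>F\<in>?A. c F = C" if C: "adm 0 n C" for C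
    proof -
      obtain z where z: "z \<in> polymatroid n" "code_of n z = C" by (rule ex_point_code_of[OF assms C])
      let ?F = "minimal_face n z"
      have F: "?F \<in> ?A"
        using minimal_face_face[OF z(1)] by (auto simp: polytope_faces_def M0_hull_eq[OF assms])
      have "c ?F \<subseteq> C" "C \<subseteq> c ?F"
        unfolding c_def z(2)[symmetric]
          minimal_face_subset_iff[OF assms z(1) pt(1)[OF F], symmetric]
          minimal_face_subset_iff[OF assms pt(1)[OF F] z(1), symmetric]
        using pt(2)[OF F] by simp_all
      then show ?thesis using F by blast
    qed
    then show "c ` ?A = {C. adm 0 n C}" using adm_c by blast
  qed
  \<comment> \<open>This bijection and \<open>c\<close> both reverse the order, so their composition
    preserves it.\<close>
  have "bij_betw (cells_of_code n) {C. adm 0 n C} (composihedron_cells n)"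
    unfolding composihedron_cells_eq using inj_on_cells_of_code by (rule inj_on_imp_bij_betw)
  from bij_betw_trans[OF bij_c this] have "bij_betw (cells_of_code n \<circ> c) ?A (composihedron_cells n)" .
  moreover have "F \<subseteq> G \<longleftrightarrow> composihedron_le ((cells_of_code n \<circ> c) F) ((cells_of_code n \<circ> c) G)"
    if "F \<in> ?A" "G \<in> ?A" for F G
    unfolding o_def cells_of_code_le_iff[OF adm_c[OF that(1)] adm_c[OF that(2)]] by (rule le[OF that])
  ultimately show ?thesis unfolding poset_isomorphic_def by blast
qed

end
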